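(* Let $\alpha\in(0,2\pi)$, let $\mathcal{D}$ be the wedge of angle $\alpha$, let $T>0$ and let $x_0\in\mathcal{D}\setminus\{0\}$. For $\varepsilon>0$ let $\bar N$ denote the number of iterations of the modified algorithm with parameter $\varepsilon$ (described in the context) started from $x_0$. Then for any $1\le a<p<2$ there exists a quantity $C(a,p,x_0,T,m)>0$ such that for all $\varepsilon>0$ small enough, $$\mathbb{E}^{x_0}[\bar N^a]\le\frac{C(a,p,x_0,T,m)}{\varepsilon^{p-1}} .$$
   Context: $\mathcal{D}=\{(r\cos\theta,r\sin\theta): r\ge0,\ \theta\in[0,\alpha]\}$. Let $\Theta:=\max\left(\{\pi/k: k\in\mathbb{N}, k\ge1\}\cap(0,\alpha]\right)$ and $m:=\pi/\Theta\in\mathbb{N}$. Algorithm II (for reflected Brownian motion in $\mathcal{D}$) generates random variables recursively. Start with $y_0=x_0$ of polar angle $\theta_0\in[0,\alpha]$ and with $T_0=0$. Given $y_n=(r_n\cos\theta_n,r_n\sin\theta_n)\in\mathcal{D}\setminus\{0\}$, set $\beta_{n+1}^\pm=\theta_n\pm\Theta/2$, and let $\mathcal{V}_{n+1}$ be the wedge of polar angles in $[\beta_{n+1}^-,\beta_{n+1}^+]$ (not necessarily contained in $\mathcal{D}$). Conditionally on the past, let $Z$ be a standard planar Brownian motion started at $y_n$; let $\tau_{n+1}$ be its first hitting time of $\partial\mathcal{V}_{n+1}$, let $z_{n+1}=Z_{\tau_{n+1}}$, and let $r_{n+1}=|z_{n+1}|$ and $\widetilde\theta_{n+1}\in\{\beta_{n+1}^-,\beta_{n+1}^+\}$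 be its radius and angle. Set $\theta_{n+1}=\widetilde\theta_{n+1}$ if $\widetilde\theta_{n+1}\in[0,\alpha]$, $\theta_{n+1}=-\widetilde\theta_{n+1}$ if $\widetilde\theta_{n+1}<0$, and $\theta_{n+1}=2\alpha-\widetilde\theta_{n+1}$ if $\widetilde\theta_{n+1}>\alpha$. Set $y_{n+1}=(r_{n+1}\cos\theta_{n+1},r_{n+1}\sin\theta_{n+1})$ and $T_{n+1}=T_n+\tau_{n+1}$. The algorithm stops at the first index $n$ with $T_n>T$, after $n$ iterations. Modified algorithm with parameter $\varepsilon\in(0,r_0)$, $r_0=|x_0|$: run Algorithm II, but if at some step $n$ with $T_n<T$ one has $r_n^2/(T-T_n)<\varepsilon$, then the final value is directly sampled from an approximate law and the algorithm ends after one additional iteration. Thus $\bar N=n+1$ for the first such $n$ if one exists before Algorithm II stops, and otherwise $\bar N=\inf\{n: T_n>T\}$. $\mathbb{E}^{x_0}$ denotes expectation for the algorithm started at $x_0$. *)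

theory Defs
  imports "HOL-Probability.Probability"
begin

text \<open>The plane is identified with the complex numbers; \<^term>\<open>rcis r \<phi>\<close> is the point with polar
  coordinates \<open>r\<close>, \<open>\<phi>\<close>.\<close>

section \<open>Planar Brownian motion\<close>

text \<open>The library's \<open>indep_var\<close> requires both random variables to take values in the same type;
  the following is the same notion without this restriction.\<close>

definition indep_rv ::
    "'a measure \<Rightarrow> 'b measure \<Rightarrow> ('a \<Rightarrow> 'b) \<Rightarrow> 'c measure \<Rightarrow> ('a \<Rightarrow> 'c) \<Rightarrow> bool" where
  "indep_rv M N X N' Y \<longleftrightarrow>
     X \<in> measurable M N \<and> Y \<in> measurable M N' \<and>
     prob_space.indep_set M {X -` A \<inter> space M | A. A \<in> sets N} {Y -` A \<inter> space M | A. A \<in> sets N'}"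

lemma (in prob_space) indep_rv_eq_indep_var: "indep_rv M N X N' Y \<longleftrightarrow> indep_var N X N' Y"
proof -
  have eq: "sigma_sets (space M) {f -` A \<inter> space M | A. A \<in> sets K} = {f -` A \<inter> space M | A. A \<in> sets K}"
    if "f \<in> measurable M K" for f :: "'a \<Rightarrow> 'b" and K
    using sets_vimage_algebra[of "space M" f K] sets_vimage_algebra2[of f "space M" K]
      measurable_space[OF that] by auto
  show ?thesis
    unfolding indep_rv_def indep_var_eq by (auto simp: eq)
qed

definition linear_brownian_motion :: "'a measure \<Rightarrow> (real \<Rightarrow> 'a \<Rightarrow> real) \<Rightarrow> bool" where
  "linear_brownian_motion M B \<longleftrightarrow>
     prob_space M \<and>
     (\<forall>t\<ge>0. B t \<in> borel_measurable M) \<and>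
     (\<forall>\<omega>\<in>space M. B 0 \<omega> = 0 \<and> continuous_on {0..} (\<lambda>t. B t \<omega>)) \<and>
     (\<forall>s t. 0 \<le> s \<and> s < t \<longrightarrow>
        distributed M lborel (\<lambda>\<omega>. B t \<omega> - B s \<omega>) (normal_density 0 (sqrt (t - s))) \<and>
        indep_rv M
          (PiM {0..s} (\<lambda>_. borel)) (\<lambda>\<omega>. \<lambda>u\<in>{0..s}. B u \<omega>)
          borel (\<lambda>\<omega>. B t \<omega> - B s \<omega>))"

definition planar_brownian_motion :: "'a measure \<Rightarrow> (real \<Rightarrow> 'a \<Rightarrow> complex) \<Rightarrow> bool" where
  "planar_brownian_motion M W \<longleftrightarrow>
     linear_brownian_motion M (\<lambda>t \<omega>. Re (W t \<omega>)) \<and>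
     linear_brownian_motion M (\<lambda>t \<omega>. Im (W t \<omega>)) \<and>
     indep_rv M
       (PiM {0..} (\<lambda>_. borel)) (\<lambda>\<omega>. \<lambda>t\<in>{0..}. Re (W t \<omega>))
       (PiM {0..} (\<lambda>_. borel)) (\<lambda>\<omega>. \<lambda>t\<in>{0..}. Im (W t \<omega>))"

section \<open>Wedges\<close>

definition wedge :: "real \<Rightarrow> real \<Rightarrow> complex set" where
  "wedge \<beta> \<gamma> = {rcis r \<phi> | r \<phi>. 0 \<le> r \<and> \<beta> \<le> \<phi> \<and> \<phi> \<le> \<gamma>}"

text \<open>\<open>Theta \<alpha>\<close> is a maximum over an infinite set, so \<^term>\<open>Max\<close> does not apply.\<close>

definition Theta :: "real \<Rightarrow> real" where
  "Theta \<alpha> = (GREATEST \<theta>. \<theta> \<in> {pi / real k | k :: nat. 1 \<le> k} \<inter> {0<..\<alpha>})"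

definition wedge_order :: "real \<Rightarrow> nat" where
  "wedge_order \<alpha> = (THE m. real m = pi / Theta \<alpha>)"

lemma Theta_is_max:
  assumes "0 < \<alpha>"
  shows "Theta \<alpha> \<in> {pi / real k | k :: nat. 1 \<le> k} \<inter> {0<..\<alpha>}"
    and "\<And>\<theta>. \<theta> \<in> {pi / real k | k :: nat. 1 \<le> k} \<inter> {0<..\<alpha>} \<Longrightarrow> \<theta> \<le> Theta \<alpha>"
proof -
  define S where "S = {pi / real k | k :: nat. 1 \<le> k} \<inter> {0<..\<alpha>}"
  define k where "k = (LEAST k :: nat. 1 \<le> k \<and> pi / real k \<le> \<alpha>)"
  obtain n :: nat where n: "pi / \<alpha> < real n" using reals_Archimedean2 by blast
  have "0 < real n" using n assms by (smt (verit) divide_pos_pos pi_gt_zero)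
  then have "1 \<le> n \<and> pi / real n \<le> \<alpha>" using n assms by (auto simp: field_simps)
  then have k: "1 \<le> k \<and> pi / real k \<le> \<alpha>" unfolding k_def by (rule LeastI)
  then have mem: "pi / real k \<in> S" unfolding S_def by auto
  have max: "\<theta> \<le> pi / real k" if "\<theta> \<in> S" for \<theta>
  proof -
    from that have "\<exists>j :: nat. \<theta> = pi / real j \<and> 1 \<le> j" "\<theta> \<le> \<alpha>"
      unfolding S_def by auto
    then obtain j :: nat where j: "\<theta> = pi / real j" "1 \<le> j" "\<theta> \<le> \<alpha>" by blast
    then have "k \<le> j" unfolding k_def by (intro Least_le) auto
    then show ?thesis using j k by (auto intro!: divide_left_mono)
  qed
  have eq: "Theta \<alpha> = pi / real k"
    unfolding Theta_def S_def[symmetric] by (rule Greatest_equality) (use mem max in auto)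
  show "Theta \<alpha> \<in> {pi / real k | k :: nat. 1 \<le> k} \<inter> {0<..\<alpha>}"
    using mem eq S_def by simp
  show "\<And>\<theta>. \<theta> \<in> {pi / real k | k :: nat. 1 \<le> k} \<inter> {0<..\<alpha>} \<Longrightarrow> \<theta> \<le> Theta \<alpha>"
    using max eq S_def by simp
qed

lemma wedge_order:
  assumes "0 < \<alpha>"
  shows "real (wedge_order \<alpha>) = pi / Theta \<alpha>"
proof -
  obtain k :: nat where "Theta \<alpha> = pi / real k" "1 \<le> k"
    using Theta_is_max(1)[OF assms] by auto
  then have "real k = pi / Theta \<alpha>" by simp
  then show ?thesis unfolding wedge_order_def by (metis (mono_tags, lifting) of_nat_eq_iff theI)
qed

section \<open>The algorithm, path by path\<close>

text \<open>In this section \<open>\<zeta> n\<close> is the trajectory used in the \<open>n\<close>-th iteration, for \<open>n \<ge> 1\<close>.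
  The infimum below is a real number; it is junk for trajectories that never hit the set, which
  is a null event here.\<close>

definition hitting_time :: "complex set \<Rightarrow> (real \<Rightarrow> complex) \<Rightarrow> real" where
  "hitting_time S z = Inf {t. 0 \<le> t \<and> z t \<in> S}"

definition exit_time :: "real \<Rightarrow> real \<Rightarrow> (real \<Rightarrow> complex) \<Rightarrow> real" where
  "exit_time \<alpha> \<theta> z =
     hitting_time (frontier (wedge (\<theta> - Theta \<alpha> / 2) (\<theta> + Theta \<alpha> / 2))) z"

definition exit_point :: "real \<Rightarrow> real \<Rightarrow> (real \<Rightarrow> complex) \<Rightarrow> complex" where
  "exit_point \<alpha> \<theta> z = z (exit_time \<alpha> \<theta> z)"

text \<open>The boundary consists of two rays meeting only at the origin, because
  \<open>0 < Theta \<alpha> \<le> \<pi>\<close>; the exit point lies on one of them.\<close>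

definition exit_angle :: "real \<Rightarrow> real \<Rightarrow> (real \<Rightarrow> complex) \<Rightarrow> real" where
  "exit_angle \<alpha> \<theta> z =
     (let w = exit_point \<alpha> \<theta> z; \<beta> = \<theta> - Theta \<alpha> / 2; \<gamma> = \<theta> + Theta \<alpha> / 2
      in if w = rcis (cmod w) \<beta> then \<beta> else \<gamma>)"

definition reflect_angle :: "real \<Rightarrow> real \<Rightarrow> real" where
  "reflect_angle \<alpha> \<phi> = (if \<phi> < 0 then - \<phi> else if \<phi> > \<alpha> then 2 * \<alpha> - \<phi> else \<phi>)"

text \<open>For \<open>\<alpha> < 2 * \<pi>\<close> and \<open>x0\<close> a nonzero point of \<^term>\<open>wedge 0 \<alpha>\<close>, the unique polar angle of \<open>x0\<close>
  in \<open>[0, \<alpha>]\<close> is \<^term>\<open>Arg2pi x0\<close>, the one in \<open>[0, 2 * \<pi>)\<close>.\<close>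

primrec alg_angle :: "real \<Rightarrow> complex \<Rightarrow> (nat \<Rightarrow> real \<Rightarrow> complex) \<Rightarrow> nat \<Rightarrow> real" where
  "alg_angle \<alpha> x0 \<zeta> 0 = Arg2pi x0"
| "alg_angle \<alpha> x0 \<zeta> (Suc n) = reflect_angle \<alpha> (exit_angle \<alpha> (alg_angle \<alpha> x0 \<zeta> n) (\<zeta> (Suc n)))"

primrec alg_radius :: "real \<Rightarrow> complex \<Rightarrow> (nat \<Rightarrow> real \<Rightarrow> complex) \<Rightarrow> nat \<Rightarrow> real" where
  "alg_radius \<alpha> x0 \<zeta> 0 = cmod x0"
| "alg_radius \<alpha> x0 \<zeta> (Suc n) = cmod (exit_point \<alpha> (alg_angle \<alpha> x0 \<zeta> n) (\<zeta> (Suc n)))"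

definition alg_position :: "real \<Rightarrow> complex \<Rightarrow> (nat \<Rightarrow> real \<Rightarrow> complex) \<Rightarrow> nat \<Rightarrow> complex" where
  "alg_position \<alpha> x0 \<zeta> n = rcis (alg_radius \<alpha> x0 \<zeta> n) (alg_angle \<alpha> x0 \<zeta> n)"

primrec alg_time :: "real \<Rightarrow> complex \<Rightarrow> (nat \<Rightarrow> real \<Rightarrow> complex) \<Rightarrow> nat \<Rightarrow> real" where
  "alg_time \<alpha> x0 \<zeta> 0 = 0"
| "alg_time \<alpha> x0 \<zeta> (Suc n) =
     alg_time \<alpha> x0 \<zeta> n + exit_time \<alpha> (alg_angle \<alpha> x0 \<zeta> n) (\<zeta> (Suc n))"

lemma Arg2pi_wedge:
  assumes "\<alpha> < 2 * pi" "x0 \<in> wedge 0 \<alpha> - {0}"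
  shows "Arg2pi x0 \<in> {0..\<alpha>}" and "alg_position \<alpha> x0 \<zeta> 0 = x0"
proof -
  obtain r \<phi> where x: "x0 = rcis r \<phi>" "0 \<le> r" "0 \<le> \<phi>" "\<phi> \<le> \<alpha>" "x0 \<noteq> 0"
    using assms(2) unfolding wedge_def by auto
  then have "0 < r" by (cases "r = 0") auto
  then have "Arg2pi x0 = \<phi>"
    using x assms(1) by (intro Arg2pi_unique[of r]) (auto simp: rcis_def cis_conv_exp)
  then show "Arg2pi x0 \<in> {0..\<alpha>}" using x by simp
  show "alg_position \<alpha> x0 \<zeta> 0 = x0"
    using Arg2pi_eq[of x0] x(5) by (simp add: alg_position_def rcis_def cis_conv_exp)
qed

section \<open>The number of iterations of the modified algorithm\<close>

text \<open>\<open>alg_cutoff \<alpha> T \<epsilon> x0 \<zeta> n\<close> says that the unmodified algorithm has not stopped by step \<open>n\<close>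
  and that the criterion for sampling the final value directly is met there.\<close>

definition alg_cutoff ::
    "real \<Rightarrow> real \<Rightarrow> real \<Rightarrow> complex \<Rightarrow> (nat \<Rightarrow> real \<Rightarrow> complex) \<Rightarrow> nat \<Rightarrow> bool" where
  "alg_cutoff \<alpha> T \<epsilon> x0 \<zeta> n \<longleftrightarrow>
     (\<forall>k\<le>n. alg_time \<alpha> x0 \<zeta> k \<le> T) \<and> alg_time \<alpha> x0 \<zeta> n < T \<and>
     (alg_radius \<alpha> x0 \<zeta> n)\<^sup>2 / (T - alg_time \<alpha> x0 \<zeta> n) < \<epsilon>"

definition num_iterations ::
    "real \<Rightarrow> real \<Rightarrow> real \<Rightarrow> complex \<Rightarrow> (nat \<Rightarrow> real \<Rightarrow> complex) \<Rightarrow> enat" where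
  "num_iterations \<alpha> T \<epsilon> x0 \<zeta> =
     (if \<exists>n. alg_cutoff \<alpha> T \<epsilon> x0 \<zeta> n then enat ((LEAST n. alg_cutoff \<alpha> T \<epsilon> x0 \<zeta> n) + 1)
      else Inf (enat ` {n. alg_time \<alpha> x0 \<zeta> n > T}))"

definition enat_powr :: "enat \<Rightarrow> real \<Rightarrow> ennreal" where
  "enat_powr N a = (case N of enat n \<Rightarrow> ennreal (real n powr a) | \<infinity> \<Rightarrow> \<infinity>)"

section \<open>Random runs of the algorithm\<close>

text \<open>\<open>Z n t \<omega>\<close> is the position at time \<open>t\<close> of the process used in iteration \<open>n \<ge> 1\<close>. That \<open>Z (n + 1)\<close>
  is, conditionally on \<open>Z 1, \<dots>, Z n\<close>, a Brownian motion started at the current position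
  (a function of these processes) is expressed by subtracting that position: the difference
  is a Brownian motion started at \<open>0\<close> and independent of \<open>Z 1, \<dots>, Z n\<close>.\<close>

definition algorithm_run ::
    "'a measure \<Rightarrow> real \<Rightarrow> complex \<Rightarrow> (nat \<Rightarrow> real \<Rightarrow> 'a \<Rightarrow> complex) \<Rightarrow> bool" where
  "algorithm_run M \<alpha> x0 Z \<longleftrightarrow>
     (\<forall>n. let W = (\<lambda>t \<omega>. Z (Suc n) t \<omega> - alg_position \<alpha> x0 (\<lambda>k s. Z k s \<omega>) n) in
        planar_brownian_motion M W \<and>
        indep_rv M
          (PiM ({1..n} \<times> {0..}) (\<lambda>_. borel)) (\<lambda>\<omega>. \<lambda>i\<in>{1..n} \<times> {0..}. Z (fst i) (snd i) \<omega>)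
          (PiM {0..} (\<lambda>_. borel)) (\<lambda>\<omega>. \<lambda>t\<in>{0..}. W t \<omega>))"

end

theory Submission imports Defs "HOL-Real_Asymp.Real_Asymp" begin

text \<open>In one iteration the radius \<open>r\<close> is replaced by \<open>\<rho>\<close>, the distance from the origin at which a Brownian motion
  started on the bisector leaves a wedge of half-angle \<open>h \<le> pi / 2\<close>. Since \<open>exp (- l * z)\<close> is entire and bounded
  on the half-plane containing the rotated wedge, optional stopping gives \<open>E (Re (exp (- l * z))) = exp (- l * r)\<close>
  at the exit point \<open>z\<close>, and hence by Laplace transform \<open>E (Re (z / (z + b))) = r / (r + b)\<close> for \<open>b > 0\<close>. Integrating
  against \<open>b powr (d - 1)\<close> for \<open>0 < d < 1\<close> yields \<open>E (\<rho> powr d) = \<kappa> * r powr d\<close> with a constant \<open>\<kappa> > 1\<close>.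

  Put \<open>s = r\<^sup>2 / (T - t)\<close> and \<open>V = A - min 1 s powr (d / 2)\<close>. As \<open>V\<close> decreases in \<open>s\<close>, the elapsed time only
  helps. For small \<open>s\<close> the moments with exponents \<open>d\<close> and \<open>q > d\<close> show that \<open>V\<close> drops on average by a
  multiple of \<open>s powr (d / 2)\<close>, which is at least \<open>\<epsilon> powr (d / 2)\<close>. For \<open>s\<close> bounded away from \<open>0\<close> the current step
  exceeds the remaining time with probability bounded below, so \<open>V\<close> drops by \<open>1\<close> when \<open>A\<close> is large.
  Hence the number of iterations has geometric tails with rate of order \<open>\<epsilon> powr (d / 2)\<close>, its second moment is of order
  \<open>\<epsilon> powr (- d)\<close>, and \<open>d = p - 1\<close> gives the claim.\<close>

section \<open>A kernel with explicit moments\<close>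

text \<open>Exponentials are the functions whose martingale property follows directly from
  independent Gaussian increments: \<open>exp_mart\<close> with \<open>b = \<i> * a\<close> carries
  no time term and is the entire function \<open>exp (a * z)\<close>. The harmonic function that one
  would like to stop, \<open>Re (z powr d)\<close>, is singular at the apex. The two superpositions,
  over \<open>l\<close> and over \<open>b\<close>, rebuild it from exponentials; accordingly
  \<kappa> is \<open>1 / cos (d * h)\<close>.

  The drop of \<open>V\<close> must be uniform over all states. The ratio \<open>s\<close> is
  scale-free, so one set of constants serves every radius and horizon. The cap at 1 keeps
  \<open>V\<close> between \<open>A - 1\<close> and \<open>A\<close>, which turns a drop by
  \<open>g * A\<close> into a factor \<open>1 - g\<close>. Its price is that \<open>V\<close> no
  longer follows the moment identity; the exponent \<open>q\<close> pays for this through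
  \<open>min 1 x powr (d / 2) \<ge> x powr (d / 2) - x powr (q / 2)\<close>. Both \<open>d\<close>
  and \<open>q\<close> must lie below 1, where the kernel moments converge, and this is where
  \<open>p < 2\<close> enters.\<close>

definition wedge_kernel :: "real \<Rightarrow> real \<Rightarrow> real" where
  "wedge_kernel c u = (1 + c * exp u) / (1 + 2 * c * exp u + exp u ^ 2)"

lemma Re_divide_add_of_real:
  "Re (z / (z + of_real b)) = ((cmod z)\<^sup>2 + b * Re z) / ((cmod z)\<^sup>2 + 2 * b * Re z + b\<^sup>2)"
  unfolding Re_divide cmod_power2 by (simp add: power2_eq_square algebra_simps)

text \<open>Averaging \<open>1 - exp (- l * z)\<close> over an exponentially distributed
  \<open>l\<close> of rate \<open>b\<close> gives \<open>1 - b / (z + b)\<close>. Subtracting from 1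
  keeps the integrand nonnegative, because \<open>exp (- l * z)\<close> has modulus at most 1 for
  \<open>0 \<le> Re z\<close>; the integral can therefore be exchanged with an expectation by
  Tonelli.\<close>

lemma nn_integral_laplace_resolvent:
  assumes z: "0 \<le> Re z" and b: "0 < b"
  shows "(\<integral>\<^sup>+l. ennreal (b * exp (- l * b) * (1 - Re (exp (- (of_real l * z))))) * indicator {0..} l \<partial>lborel)
    = ennreal (Re (z / (z + of_real b)))"
proof -
  define s where "s = z + of_real b"
  have s: "s \<noteq> 0" "Re s > 0" using z b by (auto simp: s_def complex_eq_iff)
  define G where "G = (\<lambda>l::real. - exp (- l * b) + b * Re (exp (- (of_real l * s)) / s))"
  have D: "(G has_real_derivative b * exp (- l * b) * (1 - Re (exp (- (of_real l * z))))) (at l)" for l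
  proof -
    have "((\<lambda>l::real. exp (- (of_real l * s)) / s) has_vector_derivative (exp (- (of_real l * s)) * (- s) / s)) (at l)"
    proof -
      have "((\<lambda>x. exp (- (x * s)) / s) has_field_derivative (exp (- (of_real l * s)) * (- s) / s)) (at (of_real l))"
        using s by (auto intro!: derivative_eq_intros)
      from has_vector_derivative_real_field[OF this] show ?thesis by simp
    qed
    then have "((\<lambda>l::real. Re (exp (- (of_real l * s)) / s)) has_vector_derivative Re (exp (- (of_real l * s)) * (- s) / s)) (at l)"
      by (rule bounded_linear.has_vector_derivative[OF bounded_linear_Re])
    then have 1: "((\<lambda>l::real. Re (exp (- (of_real l * s)) / s)) has_real_derivative Re (- exp (- (of_real l * s)))) (at l)"
      using s by (simp add: has_real_derivative_iff_has_vector_derivative)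
    have 2: "exp (- (of_real l * s)) = exp (- (of_real l * z)) * of_real (exp (- l * b))"
      by (simp add: s_def exp_add[symmetric] exp_of_real[symmetric] algebra_simps)
    have "(G has_real_derivative (- (exp (- l * b) * (- b)) + b * Re (- exp (- (of_real l * s))))) (at l)"
      unfolding G_def by (intro DERIV_add DERIV_minus DERIV_cmult 1) (auto intro!: derivative_eq_intros)
    moreover have "- (exp (- l * b) * (- b)) + b * Re (- exp (- (of_real l * s)))
      = b * exp (- l * b) * (1 - Re (exp (- (of_real l * z))))"
    proof -
      have "Re (exp (- (of_real l * s))) = Re (exp (- (of_real l * z))) * exp (- l * b)"
        unfolding 2 by simp
      then show ?thesis by (simp add: right_diff_distrib)
    qed
    ultimately show ?thesis by simp
  qed
  have nonneg: "0 \<le> b * exp (- l * b) * (1 - Re (exp (- (of_real l * z))))" if "0 \<le> l" for l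
  proof -
    have "Re (exp (- (of_real l * z))) \<le> cmod (exp (- (of_real l * z)))" by (rule complex_Re_le_cmod)
    also have "\<dots> \<le> 1" using that z by simp
    finally show ?thesis using b by simp
  qed
  have lim: "(G \<longlongrightarrow> 0) at_top"
  proof -
    have e: "((\<lambda>l::real. exp (- l * y)) \<longlongrightarrow> 0) at_top" if "0 < y" for y
      using that by real_asymp
    have "((\<lambda>l. norm (exp (- (of_real l * s)) / s)) \<longlongrightarrow> 0) at_top"
    proof -
      have "norm (exp (- (of_real l * s)) / s) = exp (- l * Re s) / cmod s" for l :: real
        by (simp add: norm_divide)
      then show ?thesis using tendsto_divide_zero[OF e[OF s(2)], of "cmod s"] by presburger
    qed
    then have "((\<lambda>l::real. exp (- (of_real l * s)) / s) \<longlongrightarrow> 0) at_top"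
      by (rule tendsto_norm_zero_cancel)
    then have "((\<lambda>l::real. Re (exp (- (of_real l * s)) / s)) \<longlongrightarrow> 0) at_top"
      using tendsto_Re by fastforce
    then have "((\<lambda>l. - exp (- l * b) + b * Re (exp (- (of_real l * s)) / s)) \<longlongrightarrow> - 0 + b * 0) at_top"
      by (intro tendsto_intros e b)
    then show ?thesis by (simp add: G_def)
  qed
  have "(\<integral>\<^sup>+l. ennreal (b * exp (- l * b) * (1 - Re (exp (- (of_real l * z))))) * indicator {0..} l \<partial>lborel) = ennreal (0 - G 0)"
    by (rule nn_integral_FTC_atLeast[OF _ D nonneg lim]) auto
  also have "0 - G 0 = Re (1 - of_real b / s)" using s by (simp add: G_def Re_divide)
  also have "1 - of_real b / s = z / (z + of_real b)" using s unfolding s_def by (simp add: field_simps)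
  finally show ?thesis .
qed

lemma wedge_kernel_pos: "0 \<le> c \<Longrightarrow> 0 < wedge_kernel c u"
  unfolding wedge_kernel_def by (intro divide_pos_pos add_pos_nonneg) auto

lemma wedge_kernel_measurable [measurable]: "wedge_kernel c \<in> borel_measurable borel"
  unfolding wedge_kernel_def[abs_def] by measurable

text \<open>A Mellin transform in the coordinate \<open>u = ln b\<close>, where
  \<open>b powr (d - 1)\<close> times the element of \<open>b\<close> becomes
  \<open>exp (d * u)\<close> times that of \<open>u\<close>, and scaling becomes translation. For
  \<open>c = cos h\<close> and \<open>0 < d < 1\<close> its value is
  \<open>pi * cos (d * h) / sin (pi * d)\<close>.\<close>

definition wedge_moment :: "real \<Rightarrow> real \<Rightarrow> ennreal" where
  "wedge_moment d c = (\<integral>\<^sup>+u. ennreal (exp (d * u) * wedge_kernel c u) \<partial>lborel)"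

text \<open>The real part of the resolvent depends only on \<open>u - ln (cmod z)\<close> and on
  \<open>c\<close>, the cosine of the angle of \<open>z\<close>. Translating \<open>u\<close> splits
  the factor \<open>cmod z powr d\<close> off the weight.\<close>

lemma nn_integral_resolvent_powr:
  assumes c: "0 \<le> c" and z: "Re z = cmod z * c"
  shows "(\<integral>\<^sup>+u. ennreal (exp (d * u) * Re (z / (z + of_real (exp u)))) \<partial>lborel)
    = ennreal (cmod z powr d) * wedge_moment d c"
proof (cases "z = 0")
  case False
  define \<rho> where "\<rho> = cmod z"
  have \<rho>: "0 < \<rho>" using False by (simp add: \<rho>_def)
  have k: "Re (z / (z + of_real (exp u))) = wedge_kernel c (u - ln \<rho>)" for u
  proof -
    have e: "exp (u - ln \<rho>) = exp u / \<rho>" using \<rho> by (simp add: exp_diff)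
    have "0 < 1 + 2 * c * (exp u / \<rho>) + (exp u / \<rho>)^2"
      using c \<rho> by (intro add_pos_nonneg) auto
    moreover have "0 < \<rho>\<^sup>2 + 2 * exp u * (\<rho> * c) + (exp u)\<^sup>2" using c \<rho> by (intro add_pos_nonneg) auto
    ultimately show ?thesis
      unfolding Re_divide_add_of_real z \<rho>_def[symmetric] wedge_kernel_def e using \<rho>
      by (simp add: divide_simps power2_eq_square) (simp add: algebra_simps)
  qed
  have "(\<integral>\<^sup>+u. ennreal (exp (d * u) * Re (z / (z + of_real (exp u)))) \<partial>lborel)
     = (\<integral>\<^sup>+u. ennreal (exp (d * u) * wedge_kernel c (u - ln \<rho>)) \<partial>lborel)"
    by (simp only: k)
  also have "\<dots> = (\<integral>\<^sup>+u. ennreal (exp (d * (ln \<rho> + 1 * u)) * wedge_kernel c ((ln \<rho> + 1 * u) - ln \<rho>)) \<partial>lborel)"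
    by (subst nn_integral_real_affine[where c=1 and t="ln \<rho>"]) auto
  also have "\<dots> = (\<integral>\<^sup>+u. ennreal (\<rho> powr d) * ennreal (exp (d * u) * wedge_kernel c u) \<partial>lborel)"
    using \<rho> by (intro nn_integral_cong) (simp add: ennreal_mult'[symmetric] powr_def exp_add[symmetric] algebra_simps mult.assoc[symmetric])
  also have "\<dots> = ennreal (\<rho> powr d) * wedge_moment d c"
    unfolding wedge_moment_def by (rule nn_integral_cmult) auto
  finally show ?thesis by (simp add: \<rho>_def)
qed simp

lemma integrable_exp_minus_abs:
  assumes "0 < a"
  shows "integrable lborel (\<lambda>u::real. exp (- a * \<bar>u\<bar>))"
proof -
  have "(\<integral>\<^sup>+u. ennreal (exp (- a * u)) * indicator {0..} u \<partial>lborel) = ennreal (0 - (- exp (- a * 0) / a))"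
  proof (rule nn_integral_FTC_atLeast)
    show "((\<lambda>u. - exp (- a * u) / a) \<longlongrightarrow> 0) at_top" using assms by real_asymp
  qed (use assms in \<open>auto intro!: derivative_eq_intros\<close>)
  then have *: "(\<integral>\<^sup>+u. ennreal (exp (- a * u)) * indicator {0..} u \<partial>lborel) < \<infinity>" by simp
  have "(\<integral>\<^sup>+u. ennreal (exp (- a * u)) * indicator {0..} u \<partial>lborel) =
     (\<integral>\<^sup>+u. ennreal (exp (a * u)) * indicator {..0} u \<partial>lborel)"
    by (subst nn_integral_real_affine[where c="-1" and t=0]) (auto intro!: nn_integral_cong split: split_indicator)
  with * have "(\<integral>\<^sup>+u. ennreal (exp (- a * u)) * indicator {0..} u + ennreal (exp (a * u)) * indicator {..0} u \<partial>lborel) < \<infinity>"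
    by (subst nn_integral_add) (auto simp: ennreal_add_eq_top less_top)
  moreover have "(\<integral>\<^sup>+u. ennreal (norm (exp (- a * \<bar>u\<bar>))) \<partial>lborel) \<le>
     (\<integral>\<^sup>+u. ennreal (exp (- a * u)) * indicator {0..} u + ennreal (exp (a * u)) * indicator {..0} u \<partial>lborel)"
    by (intro nn_integral_mono) (auto split: split_indicator simp: ennreal_plus[symmetric] simp del: ennreal_plus)
  ultimately show ?thesis by (intro integrableI_bounded) auto
qed

text \<open>One bound serves at minus infinity, the other at plus infinity. Against the weight
  \<open>exp (d * u)\<close> they leave the decay rates \<open>d\<close> and \<open>1 - d\<close>,
  which is why moments are taken with \<open>0 < d < 1\<close>.\<close>

lemma wedge_kernel_le:
  assumes "0 \<le> c" "c \<le> 1"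
  shows "wedge_kernel c u \<le> 2" "wedge_kernel c u \<le> 2 * exp (- u)"
proof -
  define b where "b = exp u"
  have b: "b > 0" by (simp add: b_def)
  have cb: "0 \<le> c * b" "c * b \<le> b" "0 < 1 + 2 * c * b + b\<^sup>2"
    using assms b by (auto intro!: add_pos_nonneg simp: mult_left_le_one_le)
  have *: "2 * b \<le> 1 + b\<^sup>2" using sum_squares_bound[of 1 b] by simp
  have "1 + c * b \<le> 2 * (1 + 2 * c * b + b\<^sup>2)"
    using cb(1) zero_le_power2[of b] unfolding mult.assoc distrib_left by linarith
  then show "wedge_kernel c u \<le> 2" using cb unfolding wedge_kernel_def b_def[symmetric]
    by (simp add: pos_divide_le_eq)
  have "(1 + c * b) * b \<le> 2 * (1 + 2 * c * b + b\<^sup>2)"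
  proof -
    have "c * b * b \<le> b\<^sup>2" using cb b by (simp add: power2_eq_square mult_right_mono)
    moreover have 1: "(1 + c * b) * b = b + c * b * b" by (simp add: algebra_simps)
    moreover have 2: "2 * c * b = 2 * (c * b)" by simp
    ultimately show ?thesis using * cb(1) b zero_le_power2[of b] unfolding 1 2 distrib_left by linarith
  qed
  then show "wedge_kernel c u \<le> 2 * exp (- u)" using cb b unfolding wedge_kernel_def exp_minus b_def[symmetric]
    by (simp add: divide_simps)
qed

text \<open>\<open>wedge_kernel 1 - wedge_kernel c\<close> is odd and positive on the positive axis, so the weight
  \<open>exp (d * u)\<close> makes its integral positive.\<close>

lemma wedge_moment_less:
  assumes c: "0 \<le> c" "c < 1" and d: "0 < d" "d < 1"
  obtains k0 k1 where "wedge_moment d 1 = ennreal k0" "wedge_moment d c = ennreal k1" "0 < k1" "k1 < k0"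
proof -
  define g where "g = (\<lambda>c u. exp (d * u) * wedge_kernel c u)"
  have g_pos: "0 < g c u" if "0 \<le> c" for c u using wedge_kernel_pos[OF that] by (simp add: g_def)
  have int: "integrable lborel (g c)" if c: "0 \<le> c" "c \<le> 1" for c
  proof (rule Bochner_Integration.integrable_bound)
    show "integrable lborel (\<lambda>u. 2 * exp (- min d (1 - d) * \<bar>u\<bar>))"
      using d by (intro integrable_mult_right integrable_exp_minus_abs) auto
    show "AE u in lborel. norm (g c u) \<le> norm (2 * exp (- min d (1 - d) * \<bar>u\<bar>))"
    proof (rule AE_I2)
      fix u :: real
      show "norm (g c u) \<le> norm (2 * exp (- min d (1 - d) * \<bar>u\<bar>))"
      proof (cases "u \<ge> 0")
        case True
        have "g c u \<le> exp (d * u) * (2 * exp (- u))" unfolding g_def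
          by (intro mult_left_mono wedge_kernel_le c) auto
        also have "\<dots> = 2 * exp (- (1 - d) * u)" by (simp add: exp_add[symmetric] algebra_simps)
        also have "\<dots> \<le> 2 * exp (- min d (1 - d) * \<bar>u\<bar>)"
          using True mult_right_mono[of "min d (1 - d)" "1 - d" u]
          unfolding abs_of_nonneg[OF True] mult_minus_left by simp
        finally show ?thesis using g_pos[OF c(1), of u] by simp
      next
        case False
        have "g c u \<le> exp (d * u) * 2" unfolding g_def
          by (intro mult_left_mono wedge_kernel_le c) auto
        also have "\<dots> \<le> 2 * exp (- min d (1 - d) * \<bar>u\<bar>)"
          using False mult_right_mono_neg[of "min d (1 - d)" d u] by simp
        finally show ?thesis using g_pos[OF c(1), of u] by simp
      qed
    qed
  qed (simp add: g_def)
  define k where "k = (\<lambda>c. integral\<^sup>L lborel (g c))"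
  have m: "wedge_moment d c = ennreal (k c)" if "0 \<le> c" "c \<le> 1" for c
    unfolding wedge_moment_def k_def using nn_integral_eq_integral[OF int[OF that]] g_pos[OF that(1)]
    by (simp add: g_def less_imp_le)
  have pos: "0 < integral\<^sup>L lborel f" if "integrable lborel f" "\<And>u. 0 \<le> f u" "\<And>u. u \<noteq> 0 \<Longrightarrow> 0 < f u" for f :: "real \<Rightarrow> real"
  proof -
    have "integral\<^sup>L lborel f \<noteq> 0"
    proof
      assume "integral\<^sup>L lborel f = 0"
      then have "AE u in lborel. f u = 0" using that by (subst (asm) integral_nonneg_eq_0_iff_AE) auto
      then have "AE u in lborel. u = (0::real)" by eventually_elim (use that(3) in force)
      moreover have "AE u in lborel. u \<noteq> (0::real)" by (rule AE_lborel_singleton)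
      ultimately have "AE u in (lborel::real measure). False" by eventually_elim simp
      then show False by (simp add: eventually_False ae_filter_eq_bot_iff)
    qed
    moreover have "0 \<le> integral\<^sup>L lborel f" using that by (intro integral_nonneg_AE) auto
    ultimately show ?thesis by simp
  qed
  define D where "D = (\<lambda>u. wedge_kernel 1 u - wedge_kernel c u)"
  have D_eq: "D u = exp u * (1 - c) * (exp u - 1) / ((1 + exp u) * (1 + 2 * c * exp u + (exp u)\<^sup>2))" for u
  proof -
    have 1: "1 + 2 * c * exp u + (exp u)\<^sup>2 > 0" using c by (intro add_pos_nonneg) auto
    have 2: "1 + exp u > 0" by (simp add: add_pos_pos)
    have "wedge_kernel 1 u = 1 / (1 + exp u)"
    proof -
      have "1 + 2 * 1 * exp u + exp u ^ 2 = (1 + exp u) * (1 + exp u)"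
        by (simp add: power2_eq_square algebra_simps)
      then have "wedge_kernel 1 u = (1 + exp u) / ((1 + exp u) * (1 + exp u))"
        unfolding wedge_kernel_def by simp
      then show ?thesis using 2 by simp
    qed
    then have "D u = 1 / (1 + exp u) - (1 + c * exp u) / (1 + 2 * c * exp u + (exp u)\<^sup>2)"
      by (simp add: D_def wedge_kernel_def[of c])
    also have "\<dots> = (1 * (1 + 2 * c * exp u + (exp u)\<^sup>2) - (1 + c * exp u) * (1 + exp u))
      / ((1 + exp u) * (1 + 2 * c * exp u + (exp u)\<^sup>2))"
      using 1 2 by (intro diff_frac_eq) auto
    also have "1 * (1 + 2 * c * exp u + (exp u)\<^sup>2) - (1 + c * exp u) * (1 + exp u) = exp u * (1 - c) * (exp u - 1)"
      by (simp add: algebra_simps power2_eq_square)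
    finally show ?thesis .
  qed
  have D_odd: "D (- u) = - D u" for u
  proof -
    define b where "b = exp u"
    have b: "b > 0" by (simp add: b_def)
    have "1 + 2 * c * b + b\<^sup>2 > 0" "1 + b > 0" "1 + 2 * c * inverse b + (inverse b)\<^sup>2 > 0" "1 + inverse b > 0"
      using c b by (auto intro!: add_pos_nonneg)
    then show ?thesis unfolding D_eq exp_minus b_def[symmetric] using b
      by (simp add: divide_simps power2_eq_square) (simp add: algebra_simps)
  qed
  have D_pos: "0 < D u" if "0 < u" for u
    unfolding D_eq using c that by (intro divide_pos_pos mult_pos_pos add_pos_nonneg) auto
  have iD: "integrable lborel (\<lambda>u. exp (d * u) * D u)"
    using Bochner_Integration.integrable_diff[OF int[of 1] int[of c]] c by (simp add: D_def g_def algebra_simps)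
  have "integral\<^sup>L lborel (\<lambda>u. exp (d * u) * D u) = k 1 - k c"
    unfolding k_def using Bochner_Integration.integral_diff[OF int[of 1] int[of c]] c by (simp add: D_def g_def algebra_simps)
  moreover have iD': "integrable lborel (\<lambda>u. exp (d * (- u)) * D (- u))"
    using lborel_integrable_real_affine[OF iD, of "-1" 0] by simp
  moreover have "integral\<^sup>L lborel (\<lambda>u. exp (d * (- u)) * D (- u)) = integral\<^sup>L lborel (\<lambda>u. exp (d * u) * D u)"
    using lborel_integral_real_affine[of "-1" "\<lambda>u. exp (d * u) * D u" 0] by simp
  \<comment> \<open>Adding the reflected integral pairs \<open>u\<close> with \<open>- u\<close>; by
    \<open>D_odd\<close> the integrand becomes \<open>(exp (d * u) - exp (- d * u)) * D u\<close>,
    positive off 0.\<close>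
  ultimately have "2 * (k 1 - k c) = integral\<^sup>L lborel (\<lambda>u. exp (d * u) * D u + exp (d * (- u)) * D (- u))"
    using iD by simp
  also have "\<dots> > 0"
  proof (rule pos)
    have e: "exp (d * u) * D u + exp (d * (- u)) * D (- u) = (exp (d * u) - exp (d * (- u))) * D u" for u
      by (simp add: D_odd algebra_simps)
    show "0 < exp (d * u) * D u + exp (d * (- u)) * D (- u)" if "u \<noteq> 0" for u
    proof (cases "u > 0")
      case True
      then show ?thesis unfolding e using D_pos d by (intro mult_pos_pos) (auto simp: mult_less_cancel_left intro: order_less_trans)
    next
      case False
      with that have "0 < - u" by simp
      then show ?thesis unfolding e using D_pos[of "- u"] d D_odd[of u]
        by (intro mult_neg_neg) (auto simp: mult_less_0_iff)
    qed
    then show "0 \<le> exp (d * u) * D u + exp (d * (- u)) * D (- u)" for u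
      by (cases "u = 0") (auto simp: D_eq less_imp_le)
    show "integrable lborel (\<lambda>u. exp (d * u) * D u + exp (d * (- u)) * D (- u))"
      using iD iD' by simp
  qed
  finally have "k c < k 1" by simp
  moreover have "0 < k c" unfolding k_def using c int[of c] g_pos[of c] by (intro pos) (auto intro: less_imp_le)
  ultimately show ?thesis using that m c by force
qed

section \<open>Wedges and hitting times\<close>

lemma rcis_mem_wedge: "0 \<le> r \<Longrightarrow> \<beta> \<le> \<phi> \<Longrightarrow> \<phi> \<le> \<gamma> \<Longrightarrow> rcis r \<phi> \<in> wedge \<beta> \<gamma>"
  unfolding wedge_def by blast

lemma wedge_eq_image_cis: "wedge (\<theta> + \<beta>) (\<theta> + \<gamma>) = (\<lambda>z. cis \<theta> * z) ` wedge \<beta> \<gamma>"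
proof (intro set_eqI iffI)
  fix z assume "z \<in> wedge (\<theta> + \<beta>) (\<theta> + \<gamma>)"
  then obtain r \<phi> where z: "z = rcis r \<phi>" "0 \<le> r" "\<theta> + \<beta> \<le> \<phi>" "\<phi> \<le> \<theta> + \<gamma>" by (auto simp: wedge_def)
  then have "z = cis \<theta> * rcis r (\<phi> - \<theta>)" by (simp add: rcis_def cis_mult)
  moreover have "rcis r (\<phi> - \<theta>) \<in> wedge \<beta> \<gamma>" using z by (intro rcis_mem_wedge) auto
  ultimately show "z \<in> (\<lambda>z. cis \<theta> * z) ` wedge \<beta> \<gamma>" by blast
next
  fix z assume "z \<in> (\<lambda>z. cis \<theta> * z) ` wedge \<beta> \<gamma>"
  then obtain r \<phi> where z: "z = cis \<theta> * rcis r \<phi>" "0 \<le> r" "\<beta> \<le> \<phi>" "\<phi> \<le> \<gamma>" by (auto simp: wedge_def)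
  then have "z = rcis r (\<theta> + \<phi>)" by (simp add: rcis_def cis_mult)
  then show "z \<in> wedge (\<theta> + \<beta>) (\<theta> + \<gamma>)" using z by (auto intro!: rcis_mem_wedge)
qed

lemma mem_frontier_wedge_iff:
  "z \<in> frontier (wedge (\<theta> + \<beta>) (\<theta> + \<gamma>)) \<longleftrightarrow> cis (- \<theta>) * z \<in> frontier (wedge \<beta> \<gamma>)"
proof -
  have lin: "linear (\<lambda>z. cis \<theta> * z)"
    by (auto intro!: linearI simp: algebra_simps)
  have inj: "inj (\<lambda>z. cis \<theta> * z)" by (auto intro!: injI)
  have "frontier (wedge (\<theta> + \<beta>) (\<theta> + \<gamma>)) = (\<lambda>z. cis \<theta> * z) ` frontier (wedge \<beta> \<gamma>)"
    unfolding wedge_eq_image_cis frontier_def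
    by (simp add: closure_injective_linear_image[OF lin inj] interior_injective_linear_image[OF lin inj]
        image_set_diff[OF inj])
  moreover have "z = cis \<theta> * (cis (- \<theta>) * z)" "cis (- \<theta>) * (cis \<theta> * w) = w" for w
    by (simp_all add: mult.assoc[symmetric] cis_mult)
  ultimately show ?thesis by (metis imageE imageI)
qed

text \<open>An opening \<open>2 * h\<close> of at most \<open>pi\<close> makes the wedge convex,
  hence the intersection of the half-planes bounded by the lines through its edges. Closedness and
  interior can then be read off from linear inequalities.\<close>

lemma wedge_eq_halfplanes:
  assumes h: "0 < h" "h \<le> pi / 2"
  shows "wedge (- h) h = {z. 0 \<le> Im (cis h * z)} \<inter> {z. Im (cis (- h) * z) \<le> 0}"
proof (intro set_eqI iffI)
  fix z assume "z \<in> wedge (- h) h"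
  then obtain r \<phi> where z: "z = rcis r \<phi>" "0 \<le> r" "- h \<le> \<phi>" "\<phi> \<le> h" by (auto simp: wedge_def)
  have "cis h * z = rcis r (\<phi> + h)" "cis (- h) * z = rcis r (\<phi> - h)"
    using z by (simp_all add: rcis_def cis_mult add.commute)
  moreover have "0 \<le> sin (\<phi> + h)" using z h by (intro sin_ge_zero) auto
  moreover have "sin (\<phi> - h) \<le> 0" using sin_ge_zero[of "h - \<phi>"] z h by (simp add: sin_diff mult.commute)
  ultimately have "0 \<le> Im (cis h * z)" "Im (cis (- h) * z) \<le> 0"
    using z(2) by (simp_all only: Im_rcis mult_nonneg_nonneg mult_nonneg_nonpos)
  then show "z \<in> {z. 0 \<le> Im (cis h * z)} \<inter> {z. Im (cis (- h) * z) \<le> 0}" by blast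
next
  fix z assume z: "z \<in> {z. 0 \<le> Im (cis h * z)} \<inter> {z. Im (cis (- h) * z) \<le> 0}"
  define r \<phi> where "r = cmod z" and "\<phi> = Arg z"
  have zr: "z = rcis r \<phi>" by (simp add: r_def \<phi>_def rcis_cmod_Arg)
  have \<phi>: "- pi < \<phi>" "\<phi> \<le> pi" using Arg_bounded by (auto simp: \<phi>_def)
  have "cis h * z = rcis r (\<phi> + h)" "cis (- h) * z = rcis r (\<phi> - h)"
    unfolding zr by (simp_all add: rcis_def cis_mult add.commute)
  with z have *: "0 \<le> r * sin (\<phi> + h)" "r * sin (\<phi> - h) \<le> 0"
    by (metis Im_rcis IntE mem_Collect_eq)+
  show "z \<in> wedge (- h) h"
  proof (cases "r = 0")
    case True
    then show ?thesis using h by (auto simp: wedge_def zr intro!: exI[of _ 0])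
  next
    case False
    then have "0 < r" by (simp add: r_def)
    with * have s: "0 \<le> sin (\<phi> + h)" "sin (\<phi> - h) \<le> 0" by (auto simp: zero_le_mult_iff mult_le_0_iff)
    have "- h \<le> \<phi>"
    proof (rule ccontr)
      assume "\<not> - h \<le> \<phi>"
      then have "sin (- (\<phi> + h)) > 0" using \<phi> h by (intro sin_gt_zero) auto
      then show False using s sin_minus[of "\<phi> + h"] by linarith
    qed
    moreover have "\<phi> \<le> h"
    proof (rule ccontr)
      assume "\<not> \<phi> \<le> h"
      then have "sin (\<phi> - h) > 0" using \<phi> h by (intro sin_gt_zero) auto
      then show False using s by simp
    qed
    ultimately show ?thesis using \<open>0 < r\<close> by (auto simp: zr intro: rcis_mem_wedge)
  qed
qed

lemma Re_wedge_nonneg: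
  assumes "h \<le> pi / 2" "z \<in> wedge (- h) h"
  shows "0 \<le> Re z"
proof -
  obtain r \<phi> where z: "z = rcis r \<phi>" "0 \<le> r" "- h \<le> \<phi>" "\<phi> \<le> h" using assms by (auto simp: wedge_def)
  then show ?thesis using assms cos_ge_zero[of \<phi>] by auto
qed

text \<open>Where both half-plane inequalities are strict the point is interior, so a frontier point
  lies on one of the two lines; membership in the closed wedge selects the ray.\<close>

lemma frontier_wedge_rays:
  assumes h: "0 < h" "h \<le> pi / 2" and z: "z \<in> frontier (wedge (- h) h)"
  shows "z = rcis (cmod z) h \<or> z = rcis (cmod z) (- h)"
proof -
  let ?H = "{z. 0 \<le> Im (cis h * z)} \<inter> {z. Im (cis (- h) * z) \<le> 0}"
  have "closed ?H"
    by (intro closed_Int closed_Collect_le continuous_intros)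
  then have "z \<in> ?H" using z wedge_eq_halfplanes[OF h] unfolding frontier_def by simp
  have "open ({z. 0 < Im (cis h * z)} \<inter> {z. Im (cis (- h) * z) < 0})"
    by (intro open_Int open_Collect_less continuous_intros)
  then have "{z. 0 < Im (cis h * z)} \<inter> {z. Im (cis (- h) * z) < 0} \<subseteq> interior ?H"
    by (intro interior_maximal) auto
  then have *: "Im (cis h * z) = 0 \<or> Im (cis (- h) * z) = 0"
    using z \<open>z \<in> ?H\<close> wedge_eq_halfplanes[OF h] unfolding frontier_def by force
  have "z \<in> wedge (- h) h" using \<open>z \<in> ?H\<close> wedge_eq_halfplanes[OF h] by simp
  then obtain r \<phi> where zr: "z = rcis r \<phi>" "0 \<le> r" "- h \<le> \<phi>" "\<phi> \<le> h" by (auto simp: wedge_def)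
  have "cis h * z = rcis r (\<phi> + h)" "cis (- h) * z = rcis r (\<phi> - h)"
    using zr by (simp_all add: rcis_def cis_mult add.commute)
  with * have s: "r = 0 \<or> sin (\<phi> + h) = 0 \<or> sin (\<phi> - h) = 0" by auto
  have [simp]: "cmod z = r" using zr by simp
  show ?thesis
  proof (cases "r = 0")
    case False
    then consider "sin (\<phi> + h) = 0" | "sin (h - \<phi>) = 0" using s sin_minus[of "h - \<phi>"] by fastforce
    then show ?thesis
    proof cases
      case 1
      \<comment> \<open>The value \<open>pi\<close> is reached only when \<open>h = pi / 2\<close>,
        where the two lines coincide.\<close>
      then have "\<phi> + h = 0 \<or> \<phi> + h = pi" using sin_gt_zero[of "\<phi> + h"] zr h by force
      then have "\<phi> = - h \<or> \<phi> = h" using zr h by auto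
      then show ?thesis using zr by auto
    next
      case 2
      then have "h - \<phi> = 0 \<or> h - \<phi> = pi" using sin_gt_zero[of "h - \<phi>"] zr h by force
      then have "\<phi> = - h \<or> \<phi> = h" using zr h by auto
      then show ?thesis using zr by auto
    qed
  qed (use zr in simp)
qed

text \<open>The squared distance from \<open>r\<close> to the point at radius \<rho> on an edge is
  \<open>(r * sin h)^2 + (\<rho> - r * cos h)^2\<close>: \<open>r * sin h\<close> is the distance
  from the bisector point to the edge line.\<close>

lemma dist_frontier_wedge:
  assumes h: "0 < h" "h \<le> pi / 2" and r: "0 \<le> r" and z: "z \<in> frontier (wedge (- h) h)"
  shows "r * sin h \<le> cmod (z - of_real r)"
proof -
  define \<rho> where "\<rho> = cmod z"
  have "z = rcis \<rho> h \<or> z = rcis \<rho> (- h)" using frontier_wedge_rays[OF h z] by (simp add: \<rho>_def)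
  then have "(cmod (z - of_real r))\<^sup>2 = (\<rho> * cos h - r)\<^sup>2 + (\<rho> * sin h)\<^sup>2"
    by (auto simp: cmod_power2)
  also have "\<dots> = \<rho>\<^sup>2 * ((cos h)\<^sup>2 + (sin h)\<^sup>2) - 2 * (\<rho> * cos h) * r + r\<^sup>2 * ((cos h)\<^sup>2 + (sin h)\<^sup>2)"
    by (simp only: sin_cos_squared_add2) (simp add: power_mult_distrib power2_diff cos_squared_eq algebra_simps)
  also have "\<dots> = (r * sin h)\<^sup>2 + (\<rho> - r * cos h)\<^sup>2"
    by (simp only: sin_cos_squared_add2) (simp add: power_mult_distrib power2_diff cos_squared_eq algebra_simps)
  finally have "(r * sin h)\<^sup>2 \<le> (cmod (z - of_real r))\<^sup>2" by simp
  then show ?thesis by (rule power2_le_imp_le) simp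
qed

section \<open>Hitting times of closed sets and their measurability\<close>

lemma hitting_time_attained:
  assumes z: "continuous_on {0..} z" and S: "closed S" and hit: "0 \<le> t" "z t \<in> S"
  shows "0 \<le> hitting_time S z" "hitting_time S z \<le> t" "z (hitting_time S z) \<in> S"
proof -
  let ?A = "{t. 0 \<le> t \<and> z t \<in> S}"
  have "closed (z -` S \<inter> {0..})"
    using continuous_on_closed_vimage[of "{0..}" z] z S by auto
  moreover have "?A = z -` S \<inter> {0..}" by auto
  ultimately have "closed ?A" by simp
  moreover have bdd: "bdd_below ?A" by (rule bdd_belowI[of _ 0]) auto
  ultimately have "hitting_time S z \<in> ?A" unfolding hitting_time_def
    using hit by (intro closed_contains_Inf) auto
  then show "0 \<le> hitting_time S z" "z (hitting_time S z) \<in> S" by auto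
  show "hitting_time S z \<le> t" unfolding hitting_time_def using hit bdd by (intro cInf_lower) auto
qed

text \<open>By compactness the distance to \<open>S\<close> attains its minimum on the interval, and
  by continuity its infimum is seen at countably many times. Hitting by time \<open>t\<close> thus
  becomes an event of the path up to \<open>t\<close>, with no enlargement of the past. The end
  point is listed separately because the rational times are taken to the right of the hitting
  time.\<close>

lemma hit_before_iff_infdist:
  fixes z :: "real \<Rightarrow> complex"
  assumes z: "continuous_on {0..} z" and S: "closed S" "S \<noteq> {}" and t: "0 \<le> t"
  shows "(\<exists>u\<in>{0..t}. z u \<in> S) \<longleftrightarrow>
    (\<forall>n::nat. \<exists>q\<in>insert t (\<rat> \<inter> {0..t}). infdist (z q) S < 1 / real (Suc n))"
proof
  define f where "f = (\<lambda>u. infdist (z u) S)"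
  have f: "continuous_on {0..t} f"
    unfolding f_def by (intro continuous_intros continuous_on_subset[OF z]) auto
  {
    assume "\<exists>u\<in>{0..t}. z u \<in> S"
    then obtain u where u: "u \<in> {0..t}" "f u = 0" by (auto simp: f_def)
    show "\<forall>n::nat. \<exists>q\<in>insert t (\<rat> \<inter> {0..t}). infdist (z q) S < 1 / real (Suc n)"
    proof
      fix n :: nat
      show "\<exists>q\<in>insert t (\<rat> \<inter> {0..t}). infdist (z q) S < 1 / real (Suc n)"
      proof (cases "u = t")
        case True
        then show ?thesis using u by (auto simp: f_def)
      next
        case False
        obtain d where d: "d > 0" "\<And>v. v \<in> {0..t} \<Longrightarrow> dist v u < d \<Longrightarrow> dist (f v) (f u) < 1 / real (Suc n)"
          using f u unfolding continuous_on_iff by (metis of_nat_0_less_iff zero_less_Suc zero_less_divide_1_iff)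
        obtain q where q: "q \<in> \<rat>" "u < q" "q < min t (u + d)"
          using Rats_dense_in_real[of u "min t (u + d)"] d u False by auto
        then have "dist (f q) (f u) < 1 / real (Suc n)" using u by (intro d) (auto simp: dist_real_def)
        then show ?thesis using u q by (intro bexI[of _ q]) (auto simp: f_def dist_real_def)
      qed
    qed
  }
  {
    assume *: "\<forall>n::nat. \<exists>q\<in>insert t (\<rat> \<inter> {0..t}). infdist (z q) S < 1 / real (Suc n)"
    obtain u where u: "u \<in> {0..t}" "\<And>v. v \<in> {0..t} \<Longrightarrow> f u \<le> f v"
      using continuous_attains_inf[of "{0..t}" f] f t by auto
    have "f u < 1 / real (Suc n)" for n
      using * u(2) t unfolding f_def by (smt (verit, best) Int_iff atLeastAtMost_iff insert_iff)
    then have "\<not> 0 < f u" using nat_approx_posE[of "f u"] by (metis less_asym)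
    then have "f u = 0" unfolding f_def using infdist_nonneg[of "z u" S] by linarith
    then have "z u \<in> S" unfolding f_def using S in_closed_iff_infdist_zero by blast
    then show "\<exists>u\<in>{0..t}. z u \<in> S" using u by blast
  }
qed

lemma sets_hit_before:
  fixes Z :: "real \<Rightarrow> 'a \<Rightarrow> complex"
  assumes Z: "\<And>u. 0 \<le> u \<Longrightarrow> u \<le> t \<Longrightarrow> Z u \<in> borel_measurable N"
    and cont: "\<And>\<omega>. \<omega> \<in> space N \<Longrightarrow> continuous_on {0..} (\<lambda>u. Z u \<omega>)"
    and S: "closed S"
  shows "{\<omega> \<in> space N. \<exists>u\<in>{0..t}. Z u \<omega> \<in> S} \<in> sets N"
\<comment> \<open>\<open>infdist\<close> to the empty set is 0 by convention, so the criterion would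
  wrongly report a hit for empty \<open>S\<close>.\<close>
proof (cases "S = {} \<or> t < 0")
  case True
  then have "{\<omega> \<in> space N. \<exists>u\<in>{0..t}. Z u \<omega> \<in> S} = {}" by auto
  then show ?thesis by (metis sets.empty_sets)
next
  case False
  let ?D = "insert t (\<rat> \<inter> {0..t})"
  have D: "countable ?D" using countable_rat by auto
  have "{\<omega> \<in> space N. \<exists>u\<in>{0..t}. Z u \<omega> \<in> S} =
      {\<omega> \<in> space N. \<forall>n::nat. \<exists>q\<in>?D. infdist (Z q \<omega>) S < 1 / real (Suc n)}"
    using hit_before_iff_infdist[OF cont S] False by (intro Collect_cong conj_cong refl) auto
  also have "\<dots> \<in> sets N"
  proof (rule sets.sets_Collect_countable_All)
    fix n :: nat
    have *: "{\<omega> \<in> space N. infdist (Z q \<omega>) S < 1 / real (Suc n)} \<in> sets N" if "q \<in> ?D" for q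
    proof -
      have [measurable]: "Z q \<in> borel_measurable N" using Z False that by auto
      have "(\<lambda>x. infdist x S) \<in> borel_measurable borel"
        by (intro borel_measurable_continuous_onI continuous_intros)
      then have [measurable]: "(\<lambda>\<omega>. infdist (Z q \<omega>) S) \<in> borel_measurable N"
        by (rule measurable_compose[rotated]) measurable
      show ?thesis by measurable
    qed
    have "{\<omega> \<in> space N. \<exists>q\<in>?D. infdist (Z q \<omega>) S < 1 / real (Suc n)}
      = (\<Union>q\<in>?D. {\<omega> \<in> space N. infdist (Z q \<omega>) S < 1 / real (Suc n)})" by blast
    also have "\<dots> \<in> sets N" using * by (intro sets.countable_UN'' D)
    finally show "{\<omega> \<in> space N. \<exists>q\<in>?D. infdist (Z q \<omega>) S < 1 / real (Suc n)} \<in> sets N" .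
  qed
  finally show ?thesis .
qed

lemma sets_hit:
  fixes Z :: "real \<Rightarrow> 'a \<Rightarrow> complex"
  assumes Z: "\<And>u. 0 \<le> u \<Longrightarrow> Z u \<in> borel_measurable N"
    and cont: "\<And>\<omega>. \<omega> \<in> space N \<Longrightarrow> continuous_on {0..} (\<lambda>u. Z u \<omega>)"
    and S: "closed S"
  shows "{\<omega> \<in> space N. \<exists>u\<ge>0. Z u \<omega> \<in> S} \<in> sets N"
proof -
  have "(\<exists>u\<ge>0. Z u \<omega> \<in> S) \<longleftrightarrow> (\<exists>n::nat. \<exists>u\<in>{0..real n}. Z u \<omega> \<in> S)" for \<omega>
    by (meson atLeastAtMost_iff real_arch_simple)
  then have "{\<omega> \<in> space N. \<exists>u\<ge>0. Z u \<omega> \<in> S} = (\<Union>n::nat. {\<omega> \<in> space N. \<exists>u\<in>{0..real n}. Z u \<omega> \<in> S})"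
    by auto
  also have "\<dots> \<in> sets N" by (intro sets.countable_UN) (use sets_hit_before[OF Z cont S] in auto)
  finally show ?thesis .
qed

lemma borel_measurable_hitting_time:
  fixes Z :: "real \<Rightarrow> 'a \<Rightarrow> complex"
  assumes Z: "\<And>u. 0 \<le> u \<Longrightarrow> Z u \<in> borel_measurable N"
    and cont: "\<And>\<omega>. \<omega> \<in> space N \<Longrightarrow> continuous_on {0..} (\<lambda>u. Z u \<omega>)"
    and S: "closed S"
  shows "(\<lambda>\<omega>. hitting_time S (\<lambda>u. Z u \<omega>)) \<in> borel_measurable N"
  unfolding borel_measurable_iff_le
proof
  fix a :: real
  \<comment> \<open>On paths that never hit, the hitting time is the constant \<open>Inf {}\<close>;
    that whole event belongs to the sublevel set or is disjoint from it, according to the sign of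
    \<open>a - Inf {}\<close>.\<close>
  have "hitting_time S (\<lambda>u. Z u \<omega>) \<le> a \<longleftrightarrow>
      (\<exists>u\<in>{0..a}. Z u \<omega> \<in> S) \<or> (\<not> (\<exists>u\<ge>0. Z u \<omega> \<in> S) \<and> Inf {} \<le> a)" if "\<omega> \<in> space N" for \<omega>
  proof (cases "\<exists>u\<ge>0. Z u \<omega> \<in> S")
    case True
    then obtain u where "0 \<le> u" "Z u \<omega> \<in> S" by blast
    from hitting_time_attained[OF cont[OF that] S this]
    show ?thesis using hitting_time_attained[OF cont[OF that] S] by fastforce
  next
    case False
    then have e: "{t. 0 \<le> t \<and> Z t \<omega> \<in> S} = {}" by auto
    show ?thesis using False unfolding hitting_time_def e by auto
  qed
  then have "{\<omega> \<in> space N. hitting_time S (\<lambda>u. Z u \<omega>) \<le> a} =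
    {\<omega> \<in> space N. \<exists>u\<in>{0..a}. Z u \<omega> \<in> S} \<union> (if Inf {} \<le> a then space N - {\<omega> \<in> space N. \<exists>u\<ge>0. Z u \<omega> \<in> S} else {})"
    by auto
  also have "\<dots> \<in> sets N"
    using sets_hit_before[OF Z cont S, of a] sets_hit[OF Z cont S] by auto
  finally show "{\<omega> \<in> space N. hitting_time S (\<lambda>u. Z u \<omega>) \<le> a} \<in> sets N" .
qed

text \<open>Rounding \<tau> up to a multiple of \<open>1 / Suc n\<close> leaves countably many
  values, hence a measurable evaluation; continuity of the path gives the limit.\<close>

lemma borel_measurable_at_random_time:
  fixes Z :: "real \<Rightarrow> 'a \<Rightarrow> complex"
  assumes Z: "\<And>u. 0 \<le> u \<Longrightarrow> Z u \<in> borel_measurable N"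
    and cont: "\<And>\<omega>. \<omega> \<in> space N \<Longrightarrow> continuous_on {0..} (\<lambda>u. Z u \<omega>)"
    and \<tau>: "\<tau> \<in> borel_measurable N" "\<And>\<omega>. \<omega> \<in> space N \<Longrightarrow> 0 \<le> \<tau> \<omega>"
  shows "(\<lambda>\<omega>. Z (\<tau> \<omega>) \<omega>) \<in> borel_measurable N"
proof (rule borel_measurable_LIMSEQ_metric)
  define k where "k = (\<lambda>(n::nat) \<omega>. nat \<lceil>real (Suc n) * \<tau> \<omega>\<rceil>)"
  have [measurable]: "k n \<in> measurable N (count_space UNIV)" for n
    unfolding k_def using \<tau>(1) by measurable
  show "(\<lambda>\<omega>. Z (real (k n \<omega>) / real (Suc n)) \<omega>) \<in> borel_measurable N" for n
    by (rule measurable_compose_countable[where g="k n"]) (use Z in auto)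
  fix \<omega> assume \<omega>: "\<omega> \<in> space N"
  have lim: "(\<lambda>n. real (k n \<omega>) / real (Suc n)) \<longlonglongrightarrow> \<tau> \<omega>"
  proof (rule tendsto_sandwich[where f="\<lambda>_. \<tau> \<omega>" and h="\<lambda>n. \<tau> \<omega> + 1 / real (Suc n)"])
    have k: "real (Suc n) * \<tau> \<omega> \<le> real (k n \<omega>)" "real (k n \<omega>) \<le> real (Suc n) * \<tau> \<omega> + 1" for n
    proof -
      have "0 \<le> real (Suc n) * \<tau> \<omega>" using \<tau>(2)[OF \<omega>] by (intro mult_nonneg_nonneg) auto
      then have "real (k n \<omega>) = real_of_int \<lceil>real (Suc n) * \<tau> \<omega>\<rceil>" by (simp add: k_def)
      then show "real (Suc n) * \<tau> \<omega> \<le> real (k n \<omega>)" "real (k n \<omega>) \<le> real (Suc n) * \<tau> \<omega> + 1" by linarith+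
    qed
    show "\<forall>\<^sub>F n in sequentially. \<tau> \<omega> \<le> real (k n \<omega>) / real (Suc n)"
      using k(1) by (simp add: pos_le_divide_eq mult.commute)
    show "\<forall>\<^sub>F n in sequentially. real (k n \<omega>) / real (Suc n) \<le> \<tau> \<omega> + 1 / real (Suc n)"
      using k(2) by (simp add: divide_simps mult.commute)
    show "(\<lambda>n. \<tau> \<omega> + 1 / real (Suc n)) \<longlonglongrightarrow> \<tau> \<omega>"
      using tendsto_add[OF tendsto_const LIMSEQ_Suc[OF lim_1_over_n]] by fastforce
  qed simp
  show "(\<lambda>n. Z (real (k n \<omega>) / real (Suc n)) \<omega>) \<longlonglongrightarrow> Z (\<tau> \<omega>) \<omega>"
    by (rule continuous_on_tendsto_compose[OF cont[OF \<omega>] lim]) (use \<tau>(2)[OF \<omega>] in auto)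
qed

section \<open>Gaussian exponentials and limits in mean\<close>

lemma std_normal_iexp:
  "integrable lborel (\<lambda>x. std_normal_density x *\<^sub>R iexp (t * x))"
  "(\<integral>x. std_normal_density x *\<^sub>R iexp (t * x) \<partial>lborel) = complex_of_real (exp (- t\<^sup>2 / 2))"
proof -
  interpret real_distribution std_normal_distribution by (rule real_dist_normal_dist)
  have "integrable std_normal_distribution (\<lambda>x. iexp (t * x))"
    by (rule integrable_iexp) auto
  then show "integrable lborel (\<lambda>x. std_normal_density x *\<^sub>R iexp (t * x))"
    by (subst (asm) integrable_density) auto
  show "(\<integral>x. std_normal_density x *\<^sub>R iexp (t * x) \<partial>lborel) = complex_of_real (exp (- t\<^sup>2 / 2))"
    using fun_cong[OF char_std_normal_distribution, of t] unfolding char_def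
    by (subst (asm) integral_density) auto
qed

text \<open>Completing the square: shifting the mean by \<open>Re a * \<sigma>^2\<close> moves the
  real part of the exponent into the density and leaves a purely imaginary exponential, which the
  characteristic function of the normal law integrates.\<close>

lemma exp_normal_density_affine:
  assumes "0 < \<sigma>"
  shows "\<sigma> *\<^sub>R (normal_density 0 \<sigma> (Re a * \<sigma>\<^sup>2 + \<sigma> * y) *\<^sub>R exp (a * of_real (Re a * \<sigma>\<^sup>2 + \<sigma> * y)))
    = exp (a\<^sup>2 * of_real (\<sigma>\<^sup>2) / 2 + of_real ((Im a * \<sigma>)\<^sup>2 / 2)) * (std_normal_density y *\<^sub>R iexp (Im a * \<sigma> * y))"
proof -
  define p q where "p = Re a" and "q = Im a"
  have a: "a = of_real p + \<i> * of_real q" by (simp add: p_def q_def complex_eq_iff)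
  have 1: "\<sigma> * normal_density 0 \<sigma> (p * \<sigma>\<^sup>2 + \<sigma> * y) = std_normal_density y * exp (- p\<^sup>2 * \<sigma>\<^sup>2 / 2 - p * \<sigma> * y)"
  proof -
    have "- (p * \<sigma>\<^sup>2 + \<sigma> * y)\<^sup>2 / (2 * \<sigma>\<^sup>2) = - y\<^sup>2 / 2 + (- p\<^sup>2 * \<sigma>\<^sup>2 / 2 - p * \<sigma> * y)"
      using assms by (simp add: field_simps power2_eq_square)
    then show ?thesis using assms
      by (simp add: normal_density_def real_sqrt_mult exp_add[symmetric])
  qed
  have 2: "of_real (- p\<^sup>2 * \<sigma>\<^sup>2 / 2 - p * \<sigma> * y) + a * of_real (p * \<sigma>\<^sup>2 + \<sigma> * y)
    = (a\<^sup>2 * of_real (\<sigma>\<^sup>2) / 2 + of_real ((q * \<sigma>)\<^sup>2 / 2)) + \<i> * of_real (q * \<sigma> * y)"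
    unfolding a by (simp add: power2_eq_square algebra_simps add_divide_distrib diff_divide_distrib)
  have "\<sigma> *\<^sub>R (normal_density 0 \<sigma> (p * \<sigma>\<^sup>2 + \<sigma> * y) *\<^sub>R exp (a * of_real (p * \<sigma>\<^sup>2 + \<sigma> * y)))
    = std_normal_density y *\<^sub>R exp (of_real (- p\<^sup>2 * \<sigma>\<^sup>2 / 2 - p * \<sigma> * y) + a * of_real (p * \<sigma>\<^sup>2 + \<sigma> * y))"
    unfolding scaleR_scaleR 1 by (simp only: exp_add exp_of_real scaleR_conv_of_real of_real_mult mult.assoc)
  also have "\<dots> = exp (a\<^sup>2 * of_real (\<sigma>\<^sup>2) / 2 + of_real ((q * \<sigma>)\<^sup>2 / 2)) * (std_normal_density y *\<^sub>R iexp (q * \<sigma> * y))"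
    unfolding 2 exp_add by (simp add: scaleR_conv_of_real)
  finally show ?thesis unfolding p_def q_def .
qed

lemma (in prob_space) normal_exp:
  fixes a :: complex
  assumes X: "distributed M lborel X (normal_density 0 \<sigma>)" and \<sigma>: "0 < \<sigma>"
  shows "integrable M (\<lambda>\<omega>. exp (a * of_real (X \<omega>)))"
    and "(\<integral>\<omega>. exp (a * of_real (X \<omega>)) \<partial>M) = exp (a\<^sup>2 * of_real (\<sigma>\<^sup>2) / 2)"
proof -
  let ?g = "\<lambda>x. exp (a * of_real x)" and ?f = "\<lambda>x. normal_density 0 \<sigma> x *\<^sub>R exp (a * of_real x)"
  let ?c = "exp (a\<^sup>2 * of_real (\<sigma>\<^sup>2) / 2 + of_real ((Im a * \<sigma>)\<^sup>2 / 2))"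
  have Xm [measurable]: "X \<in> borel_measurable M" using X by (auto simp: distributed_def)
  have d: "distr M lborel X = density lborel (normal_density 0 \<sigma>)" using X by (simp add: distributed_def)
  have int: "integrable lborel (\<lambda>y. \<sigma> *\<^sub>R ?f (Re a * \<sigma>\<^sup>2 + \<sigma> * y))"
    unfolding exp_normal_density_affine[OF \<sigma>] by (intro integrable_mult_right std_normal_iexp)
  then have "integrable lborel (\<lambda>y. ?f (Re a * \<sigma>\<^sup>2 + \<sigma> * y))"
  proof -
    have "inverse \<sigma> *\<^sub>R (\<sigma> *\<^sub>R w) = w" for w :: complex using \<sigma> by simp
    then show ?thesis using integrable_scaleR_right[OF int, of "inverse \<sigma>"] by (simp only:)
  qed
  with \<sigma> have "integrable lborel ?f"
    using \<sigma> by (subst (asm) lborel_integrable_real_affine_iff) auto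
  then have "integrable (distr M lborel X) ?g"
    unfolding d by (subst integrable_density) auto
  then show "integrable M (\<lambda>\<omega>. ?g (X \<omega>))" by (subst (asm) integrable_distr_eq) auto
  have "(\<integral>\<omega>. ?g (X \<omega>) \<partial>M) = (\<integral>x. ?g x \<partial>distr M lborel X)" by (subst integral_distr) auto
  also have "\<dots> = (\<integral>x. ?f x \<partial>lborel)" unfolding d by (subst integral_density) auto
  also have "\<dots> = \<sigma> *\<^sub>R (\<integral>y. ?f (Re a * \<sigma>\<^sup>2 + \<sigma> * y) \<partial>lborel)"
    using \<sigma> by (subst lborel_integral_real_affine[where c=\<sigma> and t="Re a * \<sigma>\<^sup>2"]) auto
  also have "\<dots> = (\<integral>y. \<sigma> *\<^sub>R ?f (Re a * \<sigma>\<^sup>2 + \<sigma> * y) \<partial>lborel)"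
    by (rule integral_scaleR_right[symmetric])
  also have "\<dots> = ?c * complex_of_real (exp (- (Im a * \<sigma>)\<^sup>2 / 2))"
    unfolding exp_normal_density_affine[OF \<sigma>] by (simp only: integral_mult_right_zero std_normal_iexp)
  also have "\<dots> = exp (a\<^sup>2 * of_real (\<sigma>\<^sup>2) / 2)"
    unfolding exp_of_real[symmetric] exp_add[symmetric] by simp
  finally show "(\<integral>\<omega>. ?g (X \<omega>) \<partial>M) = exp (a\<^sup>2 * of_real (\<sigma>\<^sup>2) / 2)" .
qed

lemma norm_diff_le_via:
  fixes x y x' y' :: "'a::real_normed_vector"
  assumes "norm (x - x') \<le> d" "norm (y - y') \<le> d"
  shows "norm (x - y) \<le> d + norm (x' - y') + d"
proof -
  have "norm (x - y) = norm ((x - x') + (x' - y') - (y - y'))" by simp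
  also have "\<dots> \<le> norm (x - x') + norm (x' - y') + norm (y - y')"
    by (rule order_trans[OF norm_triangle_ineq4 add_right_mono[OF norm_triangle_ineq]])
  also have "\<dots> \<le> d + norm (x' - y') + d" using assms by simp
  finally show ?thesis .
qed

text \<open>An L2 bound implies uniform integrability. Concretely, truncation at level
  \<open>L\<close> changes each mean by at most \<open>D / L\<close>, uniformly in \<open>n\<close>,
  Fatou gives the same for the limit, and truncated means converge by dominated convergence.\<close>

lemma integral_tendsto_of_L2_bounded:
  fixes f :: "nat \<Rightarrow> 'a \<Rightarrow> complex"
  assumes M: "prob_space M"
    and f [measurable]: "\<And>n. f n \<in> borel_measurable M"
    and lim: "\<And>\<omega>. \<omega> \<in> space M \<Longrightarrow> (\<lambda>n. f n \<omega>) \<longlonglongrightarrow> g \<omega>"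
    and bound: "\<And>n. (\<integral>\<^sup>+\<omega>. ennreal ((cmod (f n \<omega>))\<^sup>2) \<partial>M) \<le> ennreal C"
  shows "integrable M g" "(\<lambda>n. integral\<^sup>L M (f n)) \<longlonglongrightarrow> integral\<^sup>L M g"
proof -
  interpret prob_space M by fact
  have g [measurable]: "g \<in> borel_measurable M" by (rule borel_measurable_LIMSEQ_metric[OF f lim])
  have gb: "(\<integral>\<^sup>+\<omega>. ennreal ((cmod (g \<omega>))\<^sup>2) \<partial>M) \<le> ennreal C"
  proof -
    have "(\<integral>\<^sup>+\<omega>. ennreal ((cmod (g \<omega>))\<^sup>2) \<partial>M) = (\<integral>\<^sup>+\<omega>. liminf (\<lambda>n. ennreal ((cmod (f n \<omega>))\<^sup>2)) \<partial>M)"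
    proof (rule nn_integral_cong)
      fix \<omega> assume "\<omega> \<in> space M"
      from lim[OF this] have "(\<lambda>n. ennreal ((cmod (f n \<omega>))\<^sup>2)) \<longlonglongrightarrow> ennreal ((cmod (g \<omega>))\<^sup>2)"
        by (intro tendsto_intros tendsto_ennrealI)
      then show "ennreal ((cmod (g \<omega>))\<^sup>2) = liminf (\<lambda>n. ennreal ((cmod (f n \<omega>))\<^sup>2))"
        by (rule lim_imp_Liminf[OF sequentially_bot, symmetric])
    qed
    also have "\<dots> \<le> liminf (\<lambda>n. \<integral>\<^sup>+\<omega>. ennreal ((cmod (f n \<omega>))\<^sup>2) \<partial>M)"
      by (rule nn_integral_liminf) auto
    also have "\<dots> \<le> liminf (\<lambda>n::nat. ennreal C)" by (intro Liminf_mono always_eventually allI bound)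
    finally show ?thesis by (simp add: Liminf_const)
  qed
  have L2: "integrable M u \<and> integrable M (\<lambda>\<omega>. (cmod (u \<omega>))\<^sup>2) \<and> (\<integral>\<omega>. (cmod (u \<omega>))\<^sup>2 \<partial>M) \<le> max 0 C"
    if [measurable]: "u \<in> borel_measurable M" and b: "(\<integral>\<^sup>+\<omega>. ennreal ((cmod (u \<omega>))\<^sup>2) \<partial>M) \<le> ennreal C" for u :: "'a \<Rightarrow> complex"
  proof -
    have i2: "integrable M (\<lambda>\<omega>. (cmod (u \<omega>))\<^sup>2)"
      using b by (intro integrableI_bounded) (auto simp: less_top[symmetric] top_unique intro: le_less_trans)
    moreover have "integrable M u"
    proof (rule Bochner_Integration.integrable_bound)
      show "integrable M (\<lambda>\<omega>. 1 + (cmod (u \<omega>))\<^sup>2)" using i2 by simp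
      show "AE \<omega> in M. norm (u \<omega>) \<le> norm (1 + (cmod (u \<omega>))\<^sup>2)"
      proof (rule AE_I2)
        fix \<omega>
        have "2 * 1 * cmod (u \<omega>) \<le> 1\<^sup>2 + (cmod (u \<omega>))\<^sup>2" by (rule sum_squares_bound)
        then have "cmod (u \<omega>) \<le> 1 + (cmod (u \<omega>))\<^sup>2" using norm_ge_zero[of "u \<omega>"]
          unfolding one_power2 mult_1_right by linarith
        then show "norm (u \<omega>) \<le> norm (1 + (cmod (u \<omega>))\<^sup>2)" by simp
      qed
    qed simp
    moreover have "(\<integral>\<omega>. (cmod (u \<omega>))\<^sup>2 \<partial>M) \<le> max 0 C"
    proof -
      have "ennreal (\<integral>\<omega>. (cmod (u \<omega>))\<^sup>2 \<partial>M) \<le> ennreal (max 0 C)"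
        using b nn_integral_eq_integral[OF i2] by (simp add: ennreal_max_0' max.commute)
      then show ?thesis by (subst (asm) ennreal_le_iff) auto
    qed
    ultimately show ?thesis by blast
  qed
  note Lf = L2[OF f bound] and Lg = L2[OF g gb]
  show "integrable M g" using Lg by blast
  define D where "D = max 0 C"
  \<comment> \<open>Radial retraction onto the disk of radius \<open>L\<close>; unlike a cut-off by
    an indicator it is continuous, so it commutes with the pointwise limit.\<close>
  define h where "h = (\<lambda>L (z::complex). z /\<^sub>R max 1 (cmod z / L))"
  have h: "cmod (h L z) \<le> L" "cmod (z - h L z) \<le> (cmod z)\<^sup>2 / L" if "0 < L" for L z
  proof -
    show "cmod (h L z) \<le> L"
      using that by (cases "cmod z \<le> L") (auto simp: h_def max_def divide_simps)
    have "z - h L z = (1 - 1 / max 1 (cmod z / L)) *\<^sub>R z" by (simp add: h_def algebra_simps divide_inverse)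
    moreover have "0 \<le> 1 - 1 / max 1 (cmod z / L)" by (simp add: max_def divide_simps)
    ultimately have n: "cmod (z - h L z) = (1 - 1 / max 1 (cmod z / L)) * cmod z" by simp
    show "cmod (z - h L z) \<le> (cmod z)\<^sup>2 / L"
    proof (cases "cmod z / L \<le> 1")
      case True
      then have "max 1 (cmod z / L) = 1" by simp
      then show ?thesis unfolding n using that by simp
    next
      case False
      have "(1 - 1 / max 1 (cmod z / L)) * cmod z \<le> 1 * cmod z"
        by (intro mult_right_mono) (auto simp: max_def)
      also have "\<dots> \<le> (cmod z / L) * cmod z" using False by (intro mult_right_mono) auto
      finally show ?thesis unfolding n by (simp add: power2_eq_square)
    qed
  qed
  have hm [measurable]: "h L \<in> borel_measurable borel" for L unfolding h_def by measurable
  have ih: "integrable M (\<lambda>\<omega>. h L (u \<omega>))" if "0 < L" "u \<in> borel_measurable M" for L u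
    using h(1)[OF that(1)] that(2) by (intro integrable_const_bound[where B=L]) auto
  have diff: "cmod (integral\<^sup>L M u - (\<integral>\<omega>. h L (u \<omega>) \<partial>M)) \<le> D / L"
    if L: "0 < L" and u: "integrable M u" "integrable M (\<lambda>\<omega>. (cmod (u \<omega>))\<^sup>2)" "(\<integral>\<omega>. (cmod (u \<omega>))\<^sup>2 \<partial>M) \<le> D" for L u
  proof -
    have "integral\<^sup>L M u - (\<integral>\<omega>. h L (u \<omega>) \<partial>M) = (\<integral>\<omega>. u \<omega> - h L (u \<omega>) \<partial>M)"
      using u L ih by (intro Bochner_Integration.integral_diff[symmetric]) auto
    also have "cmod \<dots> \<le> (\<integral>\<omega>. cmod (u \<omega> - h L (u \<omega>)) \<partial>M)" by (rule integral_norm_bound)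
    also have "\<dots> \<le> (\<integral>\<omega>. (cmod (u \<omega>))\<^sup>2 / L \<partial>M)"
      using u L ih h(2) by (intro integral_mono) auto
    also have "\<dots> \<le> D / L" using u L by (simp add: divide_right_mono)
    finally show ?thesis .
  qed
  have hconv: "(\<lambda>n. \<integral>\<omega>. h L (f n \<omega>) \<partial>M) \<longlonglongrightarrow> (\<integral>\<omega>. h L (g \<omega>) \<partial>M)" if "0 < L" for L
  proof (rule integral_dominated_convergence[where w="\<lambda>_. L"])
    have c: "continuous_on UNIV (h L)" unfolding h_def
      using that by (intro continuous_intros) (auto simp: max_def)
    show "AE \<omega> in M. (\<lambda>n. h L (f n \<omega>)) \<longlonglongrightarrow> h L (g \<omega>)"
      by (rule AE_I2) (rule continuous_on_tendsto_compose[OF c lim], auto)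
  qed (use h(1)[OF that] in auto)
  show "(\<lambda>n. integral\<^sup>L M (f n)) \<longlonglongrightarrow> integral\<^sup>L M g"
  proof (rule LIMSEQ_I)
    fix e :: real assume e: "0 < e"
    define L where "L = 4 * (D + 1) / e"
    have D: "0 \<le> D" by (simp add: D_def)
    have L: "0 < L" "D / L < e / 3" using e D by (auto simp: L_def field_simps intro!: add_nonneg_pos)
    obtain n0 where n0: "\<And>n. n \<ge> n0 \<Longrightarrow> norm ((\<integral>\<omega>. h L (f n \<omega>) \<partial>M) - (\<integral>\<omega>. h L (g \<omega>) \<partial>M)) < e / 3"
      using LIMSEQ_D[OF hconv[OF L(1)], of "e / 3"] e by auto
    show "\<exists>no. \<forall>n\<ge>no. norm (integral\<^sup>L M (f n) - integral\<^sup>L M g) < e"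
    proof (intro exI[of _ n0] allI impI)
      fix n assume "n \<ge> n0"
      have "cmod (integral\<^sup>L M (f n) - (\<integral>\<omega>. h L (f n \<omega>) \<partial>M)) \<le> D / L"
        "cmod (integral\<^sup>L M g - (\<integral>\<omega>. h L (g \<omega>) \<partial>M)) \<le> D / L"
        using diff[OF L(1), of "f n"] diff[OF L(1), of g] Lf[of n] Lg unfolding D_def by blast+
      then have "norm (integral\<^sup>L M (f n) - integral\<^sup>L M g) \<le>
          D / L + norm ((\<integral>\<omega>. h L (f n \<omega>) \<partial>M) - (\<integral>\<omega>. h L (g \<omega>) \<partial>M)) + D / L"
        by (rule norm_diff_le_via)
      then show "norm (integral\<^sup>L M (f n) - integral\<^sup>L M g) < e"
        using n0[OF \<open>n \<ge> n0\<close>] L(2) by linarith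
    qed
  qed
qed

section \<open>Independence of the increments of planar Brownian motion\<close>

lemma indep_rv_imp_indep_vimage:
  assumes "indep_rv M N X N' Y"
  shows "prob_space.indep_set M (sets (vimage_algebra (space M) X N)) (sets (vimage_algebra (space M) Y N'))"
proof -
  have "X \<in> space M \<rightarrow> space N" "Y \<in> space M \<rightarrow> space N'"
    using assms by (auto simp: indep_rv_def dest: measurable_space)
  then show ?thesis using assms by (simp add: indep_rv_def sets_vimage_algebra2)
qed

text \<open>Generated on the sample space itself, where all paths are continuous. On the uncountable
  product space of paths, hitting times would not be measurable.\<close>

abbreviation path_algebra :: "'a measure \<Rightarrow> 'i set \<Rightarrow> ('i \<Rightarrow> 'a \<Rightarrow> 'b::topological_space) \<Rightarrow> 'a measure" where
  "path_algebra M I X \<equiv> vimage_algebra (space M) (\<lambda>\<omega>. \<lambda>t\<in>I. X t \<omega>) (PiM I (\<lambda>_. borel))"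

lemma path_algebra_component:
  assumes "t \<in> I"
  shows "X t \<in> borel_measurable (path_algebra M I X)"
proof -
  have "(\<lambda>\<omega>. (\<lambda>t\<in>I. X t \<omega>) t) \<in> borel_measurable (path_algebra M I X)"
    by (rule measurable_compose[OF measurable_vimage_algebra1 measurable_component_singleton[OF assms]]) (auto simp: space_PiM)
  then show ?thesis using assms by simp
qed

lemma sets_path_algebra_le:
  assumes "\<And>t. t \<in> I \<Longrightarrow> X t \<in> borel_measurable N" "space N = space M"
  shows "sets (path_algebra M I X) \<subseteq> sets N"
proof -
  have m: "(\<lambda>\<omega>. \<lambda>t\<in>I. X t \<omega>) \<in> measurable N (PiM I (\<lambda>_. borel))"
    using assms by (intro measurable_restrict) auto
  then show ?thesis using assms(2) measurable_space[OF m]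
    by (subst sets_vimage_algebra2) (auto dest: measurable_sets)
qed

lemma (in prob_space) indep_set_mono:
  "indep_set A B \<Longrightarrow> A' \<subseteq> A \<Longrightarrow> B' \<subseteq> B \<Longrightarrow> indep_set A' B'"
  unfolding indep_sets2_eq by (meson subset_trans subsetD)

abbreviation (input) "re_path W \<equiv> \<lambda>t \<omega>. Re (W t \<omega>)"
abbreviation (input) "im_path W \<equiv> \<lambda>t \<omega>. Im (W t \<omega>)"

text \<open>Brownian motion is given coordinate by coordinate. These rectangles are an
  intersection-stable generator of the joint past on which probabilities factor.\<close>

definition past_rectangles :: "'a measure \<Rightarrow> (real \<Rightarrow> 'a \<Rightarrow> complex) \<Rightarrow> real \<Rightarrow> 'a set set" where
  "past_rectangles M W s = {A \<inter> B | A B. A \<in> sets (path_algebra M {0..s} (re_path W)) \<and>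
     B \<in> sets (path_algebra M {0..s} (im_path W))}"

definition past :: "'a measure \<Rightarrow> (real \<Rightarrow> 'a \<Rightarrow> complex) \<Rightarrow> real \<Rightarrow> 'a measure" where
  "past M W s = sigma (space M) (past_rectangles M W s)"

lemma past_rectangles_subset: "past_rectangles M W s \<subseteq> Pow (space M)"
  unfolding past_rectangles_def by (auto dest!: sets.sets_into_space)

lemma space_past [simp]: "space (past M W s) = space M"
  by (simp add: past_def past_rectangles_subset)

lemma sets_past: "sets (past M W s) = sigma_sets (space M) (past_rectangles M W s)"
  by (simp add: past_def past_rectangles_subset)

lemma sets_subset_rectangles:
  assumes "space N1 = space N2"
  shows "sets N1 \<subseteq> {A \<inter> B | A B. A \<in> sets N1 \<and> B \<in> sets N2}" "sets N2 \<subseteq> {A \<inter> B | A B. A \<in> sets N1 \<and> B \<in> sets N2}"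
proof safe
  fix A assume A: "A \<in> sets N1"
  then have "A = A \<inter> space N2" using sets.sets_into_space[OF A] assms by auto
  then show "\<exists>B C. A = B \<inter> C \<and> B \<in> sets N1 \<and> C \<in> sets N2" using A by blast
next
  fix A assume A: "A \<in> sets N2"
  then have "A = space N1 \<inter> A" using sets.sets_into_space[OF A] assms by auto
  then show "\<exists>B C. A = B \<inter> C \<and> B \<in> sets N1 \<and> C \<in> sets N2" using A by blast
qed

lemma Int_stable_rectangles:
  "Int_stable {A \<inter> B | A B. A \<in> sets N1 \<and> B \<in> sets N2}"
proof (rule Int_stableI)
  fix a b assume "a \<in> {A \<inter> B | A B. A \<in> sets N1 \<and> B \<in> sets N2}" "b \<in> {A \<inter> B | A B. A \<in> sets N1 \<and> B \<in> sets N2}"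
  then obtain A B A' B' where "a = A \<inter> B" "b = A' \<inter> B'" "A \<in> sets N1" "B \<in> sets N2" "A' \<in> sets N1" "B' \<in> sets N2"
    by blast
  then have "a \<inter> b = (A \<inter> A') \<inter> (B \<inter> B')" "A \<inter> A' \<in> sets N1" "B \<inter> B' \<in> sets N2" by auto
  then show "a \<inter> b \<in> {A \<inter> B | A B. A \<in> sets N1 \<and> B \<in> sets N2}" by blast
qed

lemma measurable_past:
  assumes "0 \<le> u" "u \<le> s"
  shows "W u \<in> borel_measurable (past M W s)"
proof -
  have sub: "sets (path_algebra M {0..s} (re_path W)) \<subseteq> sets (past M W s)"
    "sets (path_algebra M {0..s} (im_path W)) \<subseteq> sets (past M W s)"
    using sets_subset_rectangles[of "path_algebra M {0..s} (re_path W)" "path_algebra M {0..s} (im_path W)"]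
    unfolding sets_past past_rectangles_def by (auto intro: sigma_sets.Basic)
  have "(\<lambda>\<omega>. Re (W u \<omega>)) \<in> borel_measurable (past M W s)"
    using measurable_from_subalg[OF _ path_algebra_component[of u "{0..s}" "re_path W" M]] assms sub(1)
    by (auto simp: subalgebra_def)
  moreover have "(\<lambda>\<omega>. Im (W u \<omega>)) \<in> borel_measurable (past M W s)"
    using measurable_from_subalg[OF _ path_algebra_component[of u "{0..s}" "im_path W" M]] assms sub(2)
    by (auto simp: subalgebra_def)
  ultimately show ?thesis by (simp add: borel_measurable_complex_iff)
qed

abbreviation (input) "exp_incr W a b s t \<omega> \<equiv> exp (a * complex_of_real (Re (W t \<omega>) - Re (W s \<omega>))) * exp (b * complex_of_real (Im (W t \<omega>) - Im (W s \<omega>)))"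

context
  fixes M :: "'a measure" and W :: "real \<Rightarrow> 'a \<Rightarrow> complex"
  assumes W: "planar_brownian_motion M W"
begin

lemma planar_prob_space: "prob_space M"
  using W by (simp add: planar_brownian_motion_def linear_brownian_motion_def)

interpretation prob_space M by (rule planar_prob_space)

lemma planar_measurable:
  assumes "0 \<le> t"
  shows "W t \<in> borel_measurable M"
  using W assms by (simp add: planar_brownian_motion_def linear_brownian_motion_def borel_measurable_complex_iff)

lemma planar_0: "\<omega> \<in> space M \<Longrightarrow> W 0 \<omega> = 0"
  using W by (simp add: planar_brownian_motion_def linear_brownian_motion_def complex_eq_iff)

lemma planar_continuous:
  assumes "\<omega> \<in> space M"
  shows "continuous_on {0..} (\<lambda>t. W t \<omega>)"
proof -
  have "continuous_on {0..} (\<lambda>t. Re (W t \<omega>))" "continuous_on {0..} (\<lambda>t. Im (W t \<omega>))"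
    using W assms unfolding planar_brownian_motion_def linear_brownian_motion_def by blast+
  then have "continuous_on {0..} (\<lambda>t. of_real (Re (W t \<omega>)) + \<i> * of_real (Im (W t \<omega>)))"
    by (intro continuous_on_add continuous_on_mult continuous_on_const continuous_on_of_real)
  then show ?thesis by (simp only: complex_eq[symmetric])
qed

lemma sets_past_le: "sets (past M W s) \<subseteq> sets M"
proof -
  have "sets (path_algebra M {0..s} (re_path W)) \<subseteq> sets M"
    "sets (path_algebra M {0..s} (im_path W)) \<subseteq> sets M"
    using planar_measurable by (intro sets_path_algebra_le; simp)+
  then show ?thesis unfolding sets_past past_rectangles_def by (intro sets.sigma_sets_subset) auto
qed

text \<open>Each coordinate contributes a past event and an increment event. Independence of the
  coordinates separates the two coordinates, independence of increments separates past from
  increment within each, and the four factors are regrouped. The pi-system argument extends this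
  from rectangles to the generated algebras.\<close>

lemma indep_past_increment:
  assumes st: "0 \<le> s" "s < t"
  shows "indep_set (sets (past M W s))
    (sigma_sets (space M) {A \<inter> B | A B.
      A \<in> sets (vimage_algebra (space M) (\<lambda>\<omega>. Re (W t \<omega>) - Re (W s \<omega>)) borel) \<and>
      B \<in> sets (vimage_algebra (space M) (\<lambda>\<omega>. Im (W t \<omega>) - Im (W s \<omega>)) borel)})"
    (is "indep_set _ (sigma_sets _ ?G)")
proof -
  let ?X = "re_path W" and ?Y = "im_path W"
  let ?PX = "path_algebra M {0..} ?X" and ?PY = "path_algebra M {0..} ?Y"
  let ?QX = "path_algebra M {0..s} ?X" and ?QY = "path_algebra M {0..s} ?Y"
  let ?DX = "vimage_algebra (space M) (\<lambda>\<omega>. Re (W t \<omega>) - Re (W s \<omega>)) borel"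
  let ?DY = "vimage_algebra (space M) (\<lambda>\<omega>. Im (W t \<omega>) - Im (W s \<omega>)) borel"
  have XY: "indep_set (sets ?PX) (sets ?PY)"
    using W by (intro indep_rv_imp_indep_vimage) (simp add: planar_brownian_motion_def)
  have X: "indep_set (sets ?QX) (sets ?DX)" and Y: "indep_set (sets ?QY) (sets ?DY)"
    using W st by (intro indep_rv_imp_indep_vimage; simp add: planar_brownian_motion_def linear_brownian_motion_def)+
  have QX: "sets ?QX \<subseteq> sets ?PX" and QY: "sets ?QY \<subseteq> sets ?PY"
  proof -
    show "sets ?QX \<subseteq> sets ?PX"
      by (rule sets_path_algebra_le[OF path_algebra_component]) auto
    show "sets ?QY \<subseteq> sets ?PY"
      by (rule sets_path_algebra_le[OF path_algebra_component]) auto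
  qed
  have dvim: "sets (vimage_algebra (space M) f borel) \<subseteq> sets N"
    if "f \<in> borel_measurable N" "space N = space M" for f :: "'a \<Rightarrow> real" and N
    using that by (subst sets_vimage_algebra2) (auto dest: measurable_sets)
  have DX: "sets ?DX \<subseteq> sets ?PX"
    using path_algebra_component[of t "{0..}" ?X M] path_algebra_component[of s "{0..}" ?X M] st
    by (intro dvim) auto
  have DY: "sets ?DY \<subseteq> sets ?PY"
    using path_algebra_component[of t "{0..}" ?Y M] path_algebra_component[of s "{0..}" ?Y M] st
    by (intro dvim) auto
  have sub: "sets ?PX \<subseteq> events" "sets ?PY \<subseteq> events" using XY by (auto simp: indep_sets2_eq)
  have G1: "past_rectangles M W s = {A \<inter> B | A B. A \<in> sets ?QX \<and> B \<in> sets ?QY}"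
    by (simp add: past_rectangles_def)
  have "indep_set (past_rectangles M W s) ?G"
    unfolding indep_sets2_eq
  proof (intro conjI ballI)
    show "past_rectangles M W s \<subseteq> events" unfolding G1 using QX QY sub by blast
    show "?G \<subseteq> events" using DX DY sub by blast
    fix a b assume "a \<in> past_rectangles M W s" "b \<in> ?G"
    then obtain A B D E where ab: "a = A \<inter> B" "b = D \<inter> E" and
      m: "A \<in> sets ?QX" "B \<in> sets ?QY" "D \<in> sets ?DX" "E \<in> sets ?DY" unfolding G1 by blast
    have m': "A \<in> sets ?PX" "B \<in> sets ?PY" "D \<in> sets ?PX" "E \<in> sets ?PY"
      using m QX QY DX DY by blast+
    have "prob (a \<inter> b) = prob ((A \<inter> D) \<inter> (B \<inter> E))" unfolding ab by (rule arg_cong[where f=prob]) blast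
    also have "\<dots> = prob (A \<inter> D) * prob (B \<inter> E)"
      using m' by (intro indep_setD[OF XY] sets.Int)
    also have "\<dots> = (prob A * prob B) * (prob D * prob E)"
      using indep_setD[OF X m(1,3)] indep_setD[OF Y m(2,4)] by simp
    also have "\<dots> = prob a * prob b"
      unfolding ab using indep_setD[OF XY m'(1,2)] indep_setD[OF XY m'(3,4)] by simp
    finally show "prob (a \<inter> b) = prob a * prob b" .
  qed
  then show ?thesis unfolding sets_past
    by (rule indep_set_sigma_sets) (auto simp: G1 intro: Int_stable_rectangles)
qed

lemma indep_var_of_indep_set:
  assumes AB: "indep_set (sets A) (sets B)" and sp: "space A = space M" "space B = space M"
    and f: "f \<in> measurable A N" and g: "g \<in> measurable B N'"
  shows "indep_var N f N' g"
proof -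
  have sub: "sets A \<subseteq> events" "sets B \<subseteq> events" using AB by (auto simp: indep_sets2_eq)
  have "f \<in> measurable M N" "g \<in> measurable M N'"
    using f g sub sp by (auto simp: measurable_def)
  moreover have "sigma_sets (space M) {f -` C \<inter> space M |C. C \<in> sets N} \<subseteq> sets A"
    unfolding sp(1)[symmetric] by (rule sets.sigma_sets_subset) (use measurable_sets[OF f] in auto)
  moreover have "sigma_sets (space M) {g -` C \<inter> space M |C. C \<in> sets N'} \<subseteq> sets B"
    unfolding sp(2)[symmetric] by (rule sets.sigma_sets_subset) (use measurable_sets[OF g] in auto)
  ultimately show ?thesis unfolding indep_var_eq using indep_set_mono[OF AB] by blast
qed

text \<open>The past factor and the two coordinate increments are independent, so the mean is a
  product with two Gaussian exponential moments. This is the martingale property in integrated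
  form.\<close>

lemma expectation_times_exp_increment:
  fixes \<phi> :: "'a \<Rightarrow> complex"
  assumes st: "0 \<le> s" "s < t"
    and \<phi>: "\<phi> \<in> borel_measurable (past M W s)" "integrable M \<phi>"
  shows "integrable M (\<lambda>\<omega>. \<phi> \<omega> * exp_incr W a b s t \<omega>)"
    and "(\<integral>\<omega>. \<phi> \<omega> * exp_incr W a b s t \<omega> \<partial>M)
      = (\<integral>\<omega>. \<phi> \<omega> \<partial>M) * exp ((a\<^sup>2 + b\<^sup>2) * of_real (t - s) / 2)"
proof -
  let ?U = "\<lambda>\<omega>. Re (W t \<omega>) - Re (W s \<omega>)" and ?V = "\<lambda>\<omega>. Im (W t \<omega>) - Im (W s \<omega>)"
  let ?DX = "vimage_algebra (space M) ?U borel" and ?DY = "vimage_algebra (space M) ?V borel"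
  let ?G = "{A \<inter> B | A B. A \<in> sets ?DX \<and> B \<in> sets ?DY}"
  let ?B = "sigma (space M) ?G"
  have G: "?G \<subseteq> Pow (space M)" by (auto dest!: sets.sets_into_space)
  have UVd: "distributed M lborel ?U (normal_density 0 (sqrt (t - s)))" "distributed M lborel ?V (normal_density 0 (sqrt (t - s)))"
    using W st by (simp_all add: planar_brownian_motion_def linear_brownian_motion_def)
  have s: "0 < sqrt (t - s)" using st by simp
  have U: "?U \<in> borel_measurable ?DX" "?V \<in> borel_measurable ?DY"
    by (intro measurable_vimage_algebra1; simp)+
  have subB: "sets ?DX \<subseteq> sets ?B" "sets ?DY \<subseteq> sets ?B"
    using sets_subset_rectangles[of ?DX ?DY] G by (auto intro: sigma_sets.Basic)
  have UB: "?U \<in> borel_measurable ?B" "?V \<in> borel_measurable ?B"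
    using measurable_from_subalg[OF _ U(1)] measurable_from_subalg[OF _ U(2)] subB G
    by (auto simp: subalgebra_def)
  have "(\<lambda>\<omega>. exp (a * of_real (f \<omega>)) * exp (b * of_real (g \<omega>))) \<in> borel_measurable N"
    if "f \<in> borel_measurable N" "g \<in> borel_measurable N" for f g and N :: "'a measure"
    using that by measurable
  from this[OF UB] have \<psi>: "(\<lambda>\<omega>. exp (a * of_real (?U \<omega>)) * exp (b * of_real (?V \<omega>))) \<in> borel_measurable ?B" .
  have 1: "indep_var borel \<phi> borel (\<lambda>\<omega>. exp (a * of_real (?U \<omega>)) * exp (b * of_real (?V \<omega>)))"
    using indep_past_increment[OF st] G by (intro indep_var_of_indep_set[OF _ _ _ \<phi>(1) \<psi>]) simp_all
  have XY: "indep_set (sets (path_algebra M {0..} (re_path W))) (sets (path_algebra M {0..} (im_path W)))"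
    using W by (intro indep_rv_imp_indep_vimage) (simp add: planar_brownian_motion_def)
  have XYm: "(\<lambda>\<omega>. Re (W t \<omega>)) \<in> borel_measurable (path_algebra M {0..} (re_path W))"
    "(\<lambda>\<omega>. Im (W t \<omega>)) \<in> borel_measurable (path_algebra M {0..} (im_path W))" if "0 \<le> t" for t
    using path_algebra_component[of t "{0..}" "re_path W" M]
      path_algebra_component[of t "{0..}" "im_path W" M] that by auto
  note [measurable] = XYm[of s] XYm[of t]
  have 2: "indep_var borel (\<lambda>\<omega>. exp (a * of_real (?U \<omega>))) borel (\<lambda>\<omega>. exp (b * of_real (?V \<omega>)))"
    using st by (intro indep_var_of_indep_set[OF XY]) simp_all
  note n1 = normal_exp[OF UVd(1) s, of a] and n2 = normal_exp[OF UVd(2) s, of b]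
  have i: "integrable M (\<lambda>\<omega>. exp (a * of_real (?U \<omega>)) * exp (b * of_real (?V \<omega>)))"
    by (rule indep_var_integrable[OF 2 n1(1) n2(1)])
  show "integrable M (\<lambda>\<omega>. \<phi> \<omega> * (exp (a * of_real (?U \<omega>)) * exp (b * of_real (?V \<omega>))))"
    by (rule indep_var_integrable[OF 1 \<phi>(2) i])
  have "(\<integral>\<omega>. \<phi> \<omega> * (exp (a * of_real (?U \<omega>)) * exp (b * of_real (?V \<omega>))) \<partial>M) =
     (\<integral>\<omega>. \<phi> \<omega> \<partial>M) * ((\<integral>\<omega>. exp (a * of_real (?U \<omega>)) \<partial>M) * (\<integral>\<omega>. exp (b * of_real (?V \<omega>)) \<partial>M))"
    unfolding indep_var_lebesgue_integral[OF 1 \<phi>(2) i] indep_var_lebesgue_integral[OF 2 n1(1) n2(1)] ..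
  also have "\<dots> = (\<integral>\<omega>. \<phi> \<omega> \<partial>M) * exp ((a\<^sup>2 + b\<^sup>2) * of_real (t - s) / 2)"
  proof -
    have "(complex_of_real (sqrt (t - s)))\<^sup>2 = of_real (t - s)" using st by (simp flip: of_real_power)
    then show ?thesis unfolding n1(2) n2(2) exp_add[symmetric]
      by (simp add: add_divide_distrib distrib_right)
  qed
  finally show "(\<integral>\<omega>. \<phi> \<omega> * (exp (a * of_real (?U \<omega>)) * exp (b * of_real (?V \<omega>))) \<partial>M)
      = (\<integral>\<omega>. \<phi> \<omega> \<partial>M) * exp ((a\<^sup>2 + b\<^sup>2) * of_real (t - s) / 2)" .
qed

end

section \<open>Exponential martingales stopped at a hitting time\<close>

text \<open>The hitting time capped at \<open>K\<close>. The case distinction, in place of a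
  minimum, keeps the default value of \<open>hitting_time\<close> on paths that never hit from
  intervening.\<close>

definition stop_time :: "complex set \<Rightarrow> real \<Rightarrow> (real \<Rightarrow> complex) \<Rightarrow> real" where
  "stop_time S K z = (if \<exists>u\<in>{0..K}. z u \<in> S then hitting_time S z else K)"

lemma stop_time_bounds:
  assumes "continuous_on {0..} z" "closed S" "0 \<le> K"
  shows "0 \<le> stop_time S K z" "stop_time S K z \<le> K"
  using hitting_time_attained[OF assms(1,2)] assms(3) by (force simp: stop_time_def)+

lemma less_stop_time_iff:
  assumes "continuous_on {0..} z" "closed S" "0 \<le> t" "t < K"
  shows "t < stop_time S K z \<longleftrightarrow> \<not> (\<exists>u\<in>{0..t}. z u \<in> S)"
proof
  assume l: "t < stop_time S K z"
  show "\<not> (\<exists>u\<in>{0..t}. z u \<in> S)"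
  proof
    assume "\<exists>u\<in>{0..t}. z u \<in> S"
    then obtain u where u: "0 \<le> u" "u \<le> t" "z u \<in> S" by auto
    then have "stop_time S K z = hitting_time S z" using assms by (auto simp: stop_time_def)
    then show False using hitting_time_attained(2)[OF assms(1,2) u(1,3)] u l by simp
  qed
next
  assume n: "\<not> (\<exists>u\<in>{0..t}. z u \<in> S)"
  show "t < stop_time S K z"
  proof (cases "\<exists>u\<in>{0..K}. z u \<in> S")
    case True
    then obtain u where u: "0 \<le> u" "z u \<in> S" by auto
    from hitting_time_attained[OF assms(1,2) this] n True show ?thesis
      by (force simp: stop_time_def not_le)
  qed (use assms in \<open>simp add: stop_time_def\<close>)
qed

text \<open>Two complex parameters cover all uses: \<open>b = \<i> * a\<close> gives an entire
  function of the position, real parameters give the decay in time that forces a hit, and imaginary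
  ones give cosines growing in time.\<close>

definition exp_mart :: "(real \<Rightarrow> 'a \<Rightarrow> complex) \<Rightarrow> complex \<Rightarrow> complex \<Rightarrow> real \<Rightarrow> 'a \<Rightarrow> complex" where
  "exp_mart W a b t \<omega> = exp (a * of_real (Re (W t \<omega>)) + b * of_real (Im (W t \<omega>)) - (a\<^sup>2 + b\<^sup>2) * of_real t / 2)"

context
  fixes M :: "'a measure" and W :: "real \<Rightarrow> 'a \<Rightarrow> complex"
  assumes W: "planar_brownian_motion M W"
begin

interpretation prob_space M by (rule planar_prob_space[OF W])

lemma exp_mart_measurable:
  assumes "W t \<in> borel_measurable N"
  shows "exp_mart W a b t \<in> borel_measurable N"
  unfolding exp_mart_def[abs_def] using assms by measurable

lemma exp_mart_increment:
  "exp_mart W a b t \<omega> = exp_mart W a b s \<omega> * exp_incr W a b s t \<omega>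
     * exp (- ((a\<^sup>2 + b\<^sup>2) * of_real (t - s) / 2))"
  unfolding exp_mart_def exp_add[symmetric]
  by (rule arg_cong[where f=exp]) (simp add: algebra_simps diff_divide_distrib add_divide_distrib)

lemma exp_mart_0: "\<omega> \<in> space M \<Longrightarrow> exp_mart W a b 0 \<omega> = 1"
  by (simp add: exp_mart_def planar_0[OF W])

lemma exp_mart_integrable:
  assumes "0 \<le> t"
  shows "integrable M (exp_mart W a b t)"
proof (cases "t = 0")
  case True
  then show ?thesis using exp_mart_0 by (subst Bochner_Integration.integrable_cong[where g="\<lambda>_. 1"]) auto
next
  case False
  have "integrable M (\<lambda>\<omega>. 1 * exp_incr W a b 0 t \<omega>)"
    by (rule expectation_times_exp_increment(1)[OF W]) (use False assms in auto)
  then have "integrable M (\<lambda>\<omega>. 1 * exp_incr W a b 0 t \<omega>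
     * exp (- ((a\<^sup>2 + b\<^sup>2) * of_real (t - 0) / 2)))"
    by (rule integrable_mult_left)
  then show ?thesis
    by (subst Bochner_Integration.integrable_cong[OF refl]) (subst exp_mart_increment[of a b t _ 0], simp only: exp_mart_0, assumption)
qed

lemma exp_mart_indicator:
  assumes st: "0 \<le> s" "s \<le> t" and A: "A \<in> sets (past M W s)"
  shows "(\<integral>\<omega>. indicator A \<omega> * exp_mart W a b t \<omega> \<partial>M) = (\<integral>\<omega>. indicator A \<omega> * exp_mart W a b s \<omega> \<partial>M)"
proof (cases "s = t")
  case False
  have AM: "A \<in> sets M" using A sets_past_le[OF W] by blast
  define c where "c = (a\<^sup>2 + b\<^sup>2) * of_real (t - s) / 2"
  let ?\<phi> = "\<lambda>\<omega>. indicator A \<omega> * exp_mart W a b s \<omega>"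
  let ?E = "\<lambda>\<omega>. exp_incr W a b s t \<omega>"
  have i: "integrable M ?\<phi>"
    using integrable_real_mult_indicator[OF AM] exp_mart_integrable[OF st(1), of a b] AM
    by (intro Bochner_Integration.integrable_bound[OF exp_mart_integrable[OF st(1), of a b]])
      (auto split: split_indicator intro: borel_measurable_integrable)
  have m: "?\<phi> \<in> borel_measurable (past M W s)"
    using A exp_mart_measurable[OF measurable_past[of s s W M], of a b] st by simp
  have "(\<integral>\<omega>. indicator A \<omega> * exp_mart W a b t \<omega> \<partial>M) = (\<integral>\<omega>. (?\<phi> \<omega> * ?E \<omega>) * exp (- c) \<partial>M)"
    by (rule Bochner_Integration.integral_cong[OF refl]) (subst exp_mart_increment[of a b t _ s], simp add: c_def mult.assoc)
  also have "\<dots> = (\<integral>\<omega>. ?\<phi> \<omega> * ?E \<omega> \<partial>M) * exp (- c)" by (rule integral_mult_left_zero)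
  also have "\<dots> = (\<integral>\<omega>. ?\<phi> \<omega> \<partial>M) * exp c * exp (- c)"
    using st False by (subst expectation_times_exp_increment(2)[OF W _ _ m i]) (auto simp: c_def)
  also have "\<dots> = (\<integral>\<omega>. ?\<phi> \<omega> \<partial>M)" by (simp add: exp_minus)
  finally show ?thesis .
qed simp

text \<open>Optional stopping on a grid by telescoping: the stopped value is 1 plus the sum of the
  increments with \<open>k < j\<close>. The event \<open>k < j\<close> is decided by the path up to
  the grid time \<open>t k\<close>, so every summand has mean 0.\<close>

lemma exp_mart_grid_stopped:
  assumes S: "closed S" and K: "0 < K" and n: "0 < n"
  defines "j \<equiv> \<lambda>\<omega>. nat \<lceil>stop_time S K (\<lambda>u. W u \<omega>) * real n / K\<rceil>"
  shows "integrable M (\<lambda>\<omega>. exp_mart W a b (real (j \<omega>) * K / real n) \<omega>)"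
    and "(\<integral>\<omega>. exp_mart W a b (real (j \<omega>) * K / real n) \<omega> \<partial>M) = 1"
proof -
  define t where "t = (\<lambda>k::nat. real k * K / real n)"
  define D where "D = (\<lambda>k. {\<omega> \<in> space M. \<not> (\<exists>u\<in>{0..t k}. W u \<omega> \<in> S)})"
  have t0: "0 \<le> t k" for k using K by (simp add: t_def)
  have tmono: "t k \<le> t (Suc k)" for k using K n by (simp add: t_def divide_right_mono mult_right_mono)
  have D: "D k \<in> sets (past M W (t k))" for k
  proof -
    have "{\<omega> \<in> space (past M W (t k)). \<exists>u\<in>{0..t k}. W u \<omega> \<in> S} \<in> sets (past M W (t k))"
      by (rule sets_hit_before[OF measurable_past]) (use S planar_continuous[OF W] in auto)
    then have "space (past M W (t k)) - {\<omega> \<in> space (past M W (t k)). \<exists>u\<in>{0..t k}. W u \<omega> \<in> S} \<in> sets (past M W (t k))"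
      by blast
    also have "space (past M W (t k)) - {\<omega> \<in> space (past M W (t k)). \<exists>u\<in>{0..t k}. W u \<omega> \<in> S} = D k"
      by (auto simp: D_def)
    finally show ?thesis .
  qed
  then have DM: "D k \<in> sets M" for k using sets_past_le[OF W] by blast
  let ?G = "\<lambda>k \<omega>. exp_mart W a b (t k) \<omega>"
  have intG: "integrable M (\<lambda>\<omega>. indicator (D k) \<omega> * ?G l \<omega>)" for k l
  proof (rule Bochner_Integration.integrable_bound[OF exp_mart_integrable[OF t0[of l], of a b]])
    show "(\<lambda>\<omega>. indicator (D k) \<omega> * ?G l \<omega>) \<in> borel_measurable M"
      using DM borel_measurable_integrable[OF exp_mart_integrable[OF t0[of l], of a b]] by measurable
  qed (auto split: split_indicator)
  \<comment> \<open>Rounding up is essential here: it makes \<open>k < j\<close> mean that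
    \<open>S\<close> is not hit up to \<open>t k\<close>, an event of the past at
    \<open>t k\<close>.\<close>
  have jD: "k < j \<omega> \<longleftrightarrow> \<omega> \<in> D k" if "\<omega> \<in> space M" "k < n" for k \<omega>
  proof -
    have "t k < K" using that K n by (simp add: t_def divide_simps)
    from less_stop_time_iff[OF planar_continuous[OF W that(1)] S t0 this]
    have 1: "\<omega> \<in> D k \<longleftrightarrow> t k < stop_time S K (\<lambda>u. W u \<omega>)" using that by (simp add: D_def)
    have "t k < stop_time S K (\<lambda>u. W u \<omega>) \<longleftrightarrow> real k < stop_time S K (\<lambda>u. W u \<omega>) * real n / K"
      using K n by (simp add: t_def field_simps)
    also have "\<dots> \<longleftrightarrow> int k < \<lceil>stop_time S K (\<lambda>u. W u \<omega>) * real n / K\<rceil>"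
      by (simp add: less_ceiling_iff)
    also have "\<dots> \<longleftrightarrow> k < j \<omega>" unfolding j_def by auto
    finally show ?thesis using 1 by simp
  qed
  have jn: "j \<omega> \<le> n" if "\<omega> \<in> space M" for \<omega>
  proof -
    have "stop_time S K (\<lambda>u. W u \<omega>) * real n / K \<le> real n"
      using stop_time_bounds(2)[OF planar_continuous[OF W that] S, of K] K n
      by (simp add: pos_divide_le_eq mult.commute mult_right_mono)
    then show ?thesis unfolding j_def by (simp add: ceiling_le_iff nat_le_iff)
  qed
  have tel: "?G (j \<omega>) \<omega> = 1 + (\<Sum>k<n. indicator (D k) \<omega> * ?G (Suc k) \<omega> - indicator (D k) \<omega> * ?G k \<omega>)" if \<omega>: "\<omega> \<in> space M" for \<omega>
  proof -
    have "(\<Sum>k<n. indicator (D k) \<omega> * ?G (Suc k) \<omega> - indicator (D k) \<omega> * ?G k \<omega>)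
      = (\<Sum>k\<in>{..<n}. if k < j \<omega> then ?G (Suc k) \<omega> - ?G k \<omega> else 0)"
      using jD[OF \<omega>] by (intro sum.cong refl) (auto split: split_indicator)
    also have "\<dots> = (\<Sum>k<j \<omega>. ?G (Suc k) \<omega> - ?G k \<omega>)"
      using jn[OF \<omega>] by (subst sum.inter_filter[symmetric]) (auto intro!: sum.cong)
    also have "\<dots> = ?G (j \<omega>) \<omega> - ?G 0 \<omega>" by (rule sum_lessThan_telescope)
    finally show ?thesis using exp_mart_0[OF \<omega>] by (simp add: t_def)
  qed
  have "integrable M (\<lambda>\<omega>. 1 + (\<Sum>k<n. indicator (D k) \<omega> * ?G (Suc k) \<omega> - indicator (D k) \<omega> * ?G k \<omega>))"
    using intG by (intro Bochner_Integration.integrable_add Bochner_Integration.integrable_sum Bochner_Integration.integrable_diff) auto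
  then have "integrable M (\<lambda>\<omega>. ?G (j \<omega>) \<omega>)"
    using tel by (subst Bochner_Integration.integrable_cong[OF refl]) auto
  then show "integrable M (\<lambda>\<omega>. exp_mart W a b (real (j \<omega>) * K / real n) \<omega>)" by (simp add: t_def)
  have "(\<integral>\<omega>. ?G (j \<omega>) \<omega> \<partial>M) = (\<integral>\<omega>. 1 + (\<Sum>k<n. indicator (D k) \<omega> * ?G (Suc k) \<omega> - indicator (D k) \<omega> * ?G k \<omega>) \<partial>M)"
    by (rule Bochner_Integration.integral_cong[OF refl tel])
  also have "\<dots> = 1 + (\<Sum>k<n. (\<integral>\<omega>. indicator (D k) \<omega> * ?G (Suc k) \<omega> \<partial>M) - (\<integral>\<omega>. indicator (D k) \<omega> * ?G k \<omega> \<partial>M))"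
    using intG by (simp add: Bochner_Integration.integral_sum Bochner_Integration.integral_diff Bochner_Integration.integrable_sum
      Bochner_Integration.integrable_diff Bochner_Integration.integral_add prob_space)
  also have "\<dots> = 1"
    using exp_mart_indicator[OF t0 tmono D] by simp
  finally show "(\<integral>\<omega>. exp_mart W a b (real (j \<omega>) * K / real n) \<omega> \<partial>M) = 1" by (simp add: t_def)
qed

text \<open>The squared modulus is, up to a deterministic factor, the exponential martingale with
  doubled real parts, whose stopped mean is again 1. This supplies the L2 bound for the passage from
  grid times to the stopping time.\<close>

lemma cmod_exp_mart_square_le:
  assumes "0 \<le> t" "t \<le> K"
  shows "(cmod (exp_mart W a b t \<omega>))\<^sup>2 \<le> exp (((cmod a)\<^sup>2 + (cmod b)\<^sup>2) * K) * Re (exp_mart W (of_real (2 * Re a)) (of_real (2 * Re b)) t \<omega>)"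
proof -
  let ?x = "Re (W t \<omega>)" and ?y = "Im (W t \<omega>)"
  let ?e = "2 * Re a * ?x + 2 * Re b * ?y"
  have "(cmod (exp_mart W a b t \<omega>))\<^sup>2 = exp (?e - ((Re a)\<^sup>2 - (Im a)\<^sup>2 + (Re b)\<^sup>2 - (Im b)\<^sup>2) * t)"
    unfolding exp_mart_def norm_exp_eq_Re exp_double[symmetric]
    by (intro arg_cong[where f=exp]) (simp add: Re_power2 algebra_simps add_divide_distrib diff_divide_distrib)
  also have "\<dots> = exp (((cmod a)\<^sup>2 + (cmod b)\<^sup>2) * t) * exp (?e - ((2 * Re a)\<^sup>2 + (2 * Re b)\<^sup>2) * t / 2)"
    unfolding exp_add[symmetric] cmod_power2 by (intro arg_cong[where f=exp]) (simp add: algebra_simps power2_eq_square)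
  also have "exp (?e - ((2 * Re a)\<^sup>2 + (2 * Re b)\<^sup>2) * t / 2) = Re (exp_mart W (of_real (2 * Re a)) (of_real (2 * Re b)) t \<omega>)"
  proof -
    have "exp_mart W (of_real (2 * Re a)) (of_real (2 * Re b)) t \<omega> = exp (of_real (?e - ((2 * Re a)\<^sup>2 + (2 * Re b)\<^sup>2) * t / 2))"
      unfolding exp_mart_def by (intro arg_cong[where f=exp]) simp
    then show ?thesis by (simp only: exp_of_real Re_complex_of_real)
  qed
  finally have "(cmod (exp_mart W a b t \<omega>))\<^sup>2 = exp (((cmod a)\<^sup>2 + (cmod b)\<^sup>2) * t) * Re (exp_mart W (of_real (2 * Re a)) (of_real (2 * Re b)) t \<omega>)" .
  moreover have "0 \<le> Re (exp_mart W (of_real (2 * Re a)) (of_real (2 * Re b)) t \<omega>)"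
    using \<open>exp (?e - ((2 * Re a)\<^sup>2 + (2 * Re b)\<^sup>2) * t / 2) = Re (exp_mart W (of_real (2 * Re a)) (of_real (2 * Re b)) t \<omega>)\<close>
    by (metis exp_ge_zero)
  ultimately show ?thesis using assms by (auto intro!: mult_right_mono mult_left_mono)
qed

text \<open>As the grid is refined, the rounded times approach \<sigma> from above within
  \<open>K / Suc n\<close>; path continuity gives pointwise convergence, and the uniform L2 bound
  carries the mean 1 to the limit.\<close>

lemma exp_mart_stopped:
  assumes S: "closed S" and K: "0 < K"
  defines "\<sigma> \<equiv> \<lambda>\<omega>. stop_time S K (\<lambda>u. W u \<omega>)"
  shows "integrable M (\<lambda>\<omega>. exp_mart W a b (\<sigma> \<omega>) \<omega>)" "(\<integral>\<omega>. exp_mart W a b (\<sigma> \<omega>) \<omega> \<partial>M) = 1"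
proof -
  define s where "s = (\<lambda>n \<omega>. real (nat \<lceil>\<sigma> \<omega> * real (Suc n) / K\<rceil>) * K / real (Suc n))"
  have bounds: "0 \<le> \<sigma> \<omega>" "\<sigma> \<omega> \<le> K" if "\<omega> \<in> space M" for \<omega>
    unfolding \<sigma>_def using stop_time_bounds[OF planar_continuous[OF W that] S] K by auto
  have s: "0 \<le> s n \<omega>" "s n \<omega> \<le> K" "\<sigma> \<omega> \<le> s n \<omega>" "s n \<omega> \<le> \<sigma> \<omega> + K / real (Suc n)" if \<omega>: "\<omega> \<in> space M" for n \<omega>
  proof -
    let ?x = "\<sigma> \<omega> * real (Suc n) / K"
    have x: "0 \<le> ?x" "?x \<le> real (Suc n)" using bounds[OF \<omega>] K by (auto simp: pos_divide_le_eq mult.commute mult_right_mono)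
    then have c: "real (nat \<lceil>?x\<rceil>) = real_of_int \<lceil>?x\<rceil>" by simp
    have "?x \<le> real_of_int \<lceil>?x\<rceil>" "real_of_int \<lceil>?x\<rceil> \<le> ?x + 1" by linarith+
    moreover have "real_of_int \<lceil>?x\<rceil> \<le> real (Suc n)" using x(2) by (metis ceiling_le_iff of_int_le_iff of_int_of_nat_eq)
    moreover have "x * K / real (Suc n) \<le> y * K / real (Suc n)" if "x \<le> y" for x y
      using that K by (intro divide_right_mono mult_right_mono) auto
    ultimately have "?x * K / real (Suc n) \<le> s n \<omega>" "s n \<omega> \<le> (?x + 1) * K / real (Suc n)" "s n \<omega> \<le> real (Suc n) * K / real (Suc n)"
      unfolding s_def c by blast+
    moreover have "?x * K / real (Suc n) = \<sigma> \<omega>" "(?x + 1) * K / real (Suc n) = \<sigma> \<omega> + K / real (Suc n)" "real (Suc n) * K / real (Suc n) = K"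
      using K by (simp_all add: field_simps del: of_nat_Suc)
    ultimately show "s n \<omega> \<le> K" "\<sigma> \<omega> \<le> s n \<omega>" "s n \<omega> \<le> \<sigma> \<omega> + K / real (Suc n)" by simp_all
    then show "0 \<le> s n \<omega>" using bounds[OF \<omega>] by simp
  qed
  have slim: "(\<lambda>n. s n \<omega>) \<longlonglongrightarrow> \<sigma> \<omega>" if \<omega>: "\<omega> \<in> space M" for \<omega>
  proof (rule tendsto_sandwich[where f="\<lambda>_. \<sigma> \<omega>" and h="\<lambda>n. \<sigma> \<omega> + K * (1 / real (Suc n))"])
    have "(\<lambda>n. \<sigma> \<omega> + K * (1 / real (Suc n))) \<longlonglongrightarrow> \<sigma> \<omega> + K * 0"
      by (intro tendsto_intros LIMSEQ_Suc[OF lim_1_over_n])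
    then show "(\<lambda>n. \<sigma> \<omega> + K * (1 / real (Suc n))) \<longlonglongrightarrow> \<sigma> \<omega>" by simp
  qed (use s[OF \<omega>] in auto)
  have grid: "integrable M (\<lambda>\<omega>. exp_mart W a b (s n \<omega>) \<omega>)" "(\<integral>\<omega>. exp_mart W a b (s n \<omega>) \<omega> \<partial>M) = 1" for n a b
    using exp_mart_grid_stopped[OF S K, of "Suc n" a b] by (simp_all add: s_def \<sigma>_def)
  let ?c = "exp (((cmod a)\<^sup>2 + (cmod b)\<^sup>2) * K)"
  have bound: "(\<integral>\<^sup>+\<omega>. ennreal ((cmod (exp_mart W a b (s n \<omega>) \<omega>))\<^sup>2) \<partial>M) \<le> ennreal ?c" for n
  proof -
    let ?R = "\<lambda>\<omega>. ?c * Re (exp_mart W (of_real (2 * Re a)) (of_real (2 * Re b)) (s n \<omega>) \<omega>)"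
    have i: "integrable M ?R" using integrable_Re[OF grid(1)] by (rule integrable_mult_right)
    have "(\<integral>\<^sup>+\<omega>. ennreal ((cmod (exp_mart W a b (s n \<omega>) \<omega>))\<^sup>2) \<partial>M) \<le> (\<integral>\<^sup>+\<omega>. ennreal (?R \<omega>) \<partial>M)"
      using s by (intro nn_integral_mono ennreal_leI cmod_exp_mart_square_le) auto
    also have "\<dots> = ennreal (\<integral>\<omega>. ?R \<omega> \<partial>M)"
    proof (rule nn_integral_eq_integral[OF i AE_I2])
      fix \<omega> assume "\<omega> \<in> space M"
      then show "0 \<le> ?R \<omega>"
        using order_trans[OF zero_le_power2 cmod_exp_mart_square_le[of "s n \<omega>" K a b \<omega>]] s by blast
    qed
    also have "(\<integral>\<omega>. ?R \<omega> \<partial>M) = ?c * Re (\<integral>\<omega>. exp_mart W (of_real (2 * Re a)) (of_real (2 * Re b)) (s n \<omega>) \<omega> \<partial>M)"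
      using grid(1) by (simp only: integral_mult_right_zero integral_Re)
    finally show ?thesis using grid(2) by simp
  qed
  have lim: "(\<lambda>n. exp_mart W a b (s n \<omega>) \<omega>) \<longlonglongrightarrow> exp_mart W a b (\<sigma> \<omega>) \<omega>" if \<omega>: "\<omega> \<in> space M" for \<omega>
  proof -
    have "(\<lambda>n. W (s n \<omega>) \<omega>) \<longlonglongrightarrow> W (\<sigma> \<omega>) \<omega>"
      by (rule continuous_on_tendsto_compose[OF planar_continuous[OF W \<omega>] slim[OF \<omega>]]) (use s[OF \<omega>] bounds[OF \<omega>] in auto)
    then show ?thesis unfolding exp_mart_def
      by (intro tendsto_intros slim[OF \<omega>]) auto
  qed
  have m: "(\<lambda>\<omega>. exp_mart W a b (s n \<omega>) \<omega>) \<in> borel_measurable M" for n using grid(1) by (rule borel_measurable_integrable)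
  note * = integral_tendsto_of_L2_bounded[OF prob_space_axioms m lim bound]
  show "integrable M (\<lambda>\<omega>. exp_mart W a b (\<sigma> \<omega>) \<omega>)" using *(1) .
  show "(\<integral>\<omega>. exp_mart W a b (\<sigma> \<omega>) \<omega> \<partial>M) = 1"
    using *(2) unfolding grid(2) by (metis LIMSEQ_unique tendsto_const)
qed

end

section \<open>The exit law of a wedge\<close>

text \<open>Here \<open>w\<close> is the driving path started at 0. Taking \<open>max 0\<close>
  matters only on paths that never hit, where the default value could be negative; with it the path
  is always evaluated at a nonnegative time.\<close>

definition wedge_exit_time :: "real \<Rightarrow> real \<Rightarrow> real \<Rightarrow> (real \<Rightarrow> complex) \<Rightarrow> real" where
  "wedge_exit_time h \<theta> r w = max 0 (hitting_time (frontier (wedge (\<theta> - h) (\<theta> + h))) (\<lambda>t. rcis r \<theta> + w t))"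

definition wedge_exit_point :: "real \<Rightarrow> real \<Rightarrow> real \<Rightarrow> (real \<Rightarrow> complex) \<Rightarrow> complex" where
  "wedge_exit_point h \<theta> r w = rcis r \<theta> + w (wedge_exit_time h \<theta> r w)"

definition rotated_exit_point :: "real \<Rightarrow> real \<Rightarrow> real \<Rightarrow> (real \<Rightarrow> complex) \<Rightarrow> complex" where
  "rotated_exit_point h \<theta> r w = cis (- \<theta>) * wedge_exit_point h \<theta> r w"

text \<open>The wedge boundary seen from the driving path: a closed set for \<open>w\<close> itself,
  so that stopping results for a Brownian motion from 0 apply, while positions are measured with the
  bisector turned onto the positive real axis.\<close>

definition rotated_frontier :: "real \<Rightarrow> real \<Rightarrow> real \<Rightarrow> complex set" where
  "rotated_frontier h \<theta> r = {w. of_real r + cis (- \<theta>) * w \<in> frontier (wedge (- h) h)}"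

lemma closed_rotated_frontier: "closed (rotated_frontier h \<theta> r)"
proof -
  have "rotated_frontier h \<theta> r = (\<lambda>w. of_real r + cis (- \<theta>) * w) -` frontier (wedge (- h) h)"
    by (auto simp: rotated_frontier_def)
  then show ?thesis by (simp add: closed_vimage continuous_intros)
qed

lemma cis_minus_mult_rcis: "cis (- \<theta>) * (rcis r \<theta> + w) = of_real r + cis (- \<theta>) * w"
  by (simp add: rcis_def distrib_left mult.left_commute cis_mult)

lemma mem_rotated_frontier:
  "rcis r \<theta> + w \<in> frontier (wedge (\<theta> - h) (\<theta> + h)) \<longleftrightarrow> w \<in> rotated_frontier h \<theta> r"
  using mem_frontier_wedge_iff[of "rcis r \<theta> + w" \<theta> "- h" h]
  by (simp add: rotated_frontier_def cis_minus_mult_rcis)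

lemma wedge_exit_time_rotated:
  "wedge_exit_time h \<theta> r w = max 0 (hitting_time (rotated_frontier h \<theta> r) w)"
  by (simp add: wedge_exit_time_def hitting_time_def mem_rotated_frontier)

text \<open>A connected piece of path with one end in the wedge and the other outside would meet the
  frontier.\<close>

lemma in_wedge_before_hit:
  fixes w :: "real \<Rightarrow> complex"
  assumes h: "0 \<le> h" and r: "0 \<le> r" and w: "continuous_on {0..} w" "w 0 = 0"
    and t: "0 \<le> t" and no: "\<not> (\<exists>u\<in>{0..t}. w u \<in> rotated_frontier h \<theta> r)"
  shows "of_real r + cis (- \<theta>) * w t \<in> wedge (- h) h"
proof (rule ccontr)
  assume n: "\<not> ?thesis"
  let ?y = "\<lambda>u. of_real r + cis (- \<theta>) * w u"
  have "continuous_on {0..t} ?y" using w by (intro continuous_intros continuous_on_subset[OF w(1)]) auto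
  then have "connected (?y ` {0..t})" by (rule connected_continuous_image) (rule connected_Icc)
  moreover have "?y 0 \<in> wedge (- h) h" using rcis_mem_wedge[of r "- h" 0 h] r h w by (simp add: rcis_def)
  then have "?y ` {0..t} \<inter> wedge (- h) h \<noteq> {}" using t by force
  moreover have "?y ` {0..t} - wedge (- h) h \<noteq> {}" using n t by force
  ultimately have "?y ` {0..t} \<inter> frontier (wedge (- h) h) \<noteq> {}" by (rule connected_Int_frontier)
  then show False using no by (auto simp: rotated_frontier_def)
qed

context
  fixes M :: "'a measure" and W :: "real \<Rightarrow> 'a \<Rightarrow> complex" and h \<theta> r :: real
  assumes W: "planar_brownian_motion M W" and h: "0 < h" "h \<le> pi / 2" and r: "0 < r"
begin

interpretation prob_space M by (rule planar_prob_space[OF W])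

abbreviation (input) "bdry \<equiv> rotated_frontier h \<theta> r"
abbreviation (input) "rot w \<equiv> of_real r + cis (- \<theta>) * w"
abbreviation (input) "stopped K \<omega> \<equiv> stop_time (rotated_frontier h \<theta> r) K (\<lambda>u. W u \<omega>)"

text \<open>The wedge lies in the right half-plane because \<open>h \<le> pi / 2\<close>. Hence
  \<open>exp (- l * z)\<close> has modulus at most 1 at the stopped position, uniformly in
  \<open>K\<close>.\<close>

lemma Re_stopped_nonneg:
  assumes \<omega>: "\<omega> \<in> space M" and K: "0 < K"
  shows "0 \<le> Re (rot (W (stopped K \<omega>) \<omega>))"
proof (cases "\<exists>u\<in>{0..K}. W u \<omega> \<in> bdry")
  case True
  then have "W (stopped K \<omega>) \<omega> \<in> bdry"
    using hitting_time_attained(3)[OF planar_continuous[OF W \<omega>] closed_rotated_frontier] by (auto simp: stop_time_def)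
  then have f: "rot (W (stopped K \<omega>) \<omega>) \<in> frontier (wedge (- h) h)"
    by (simp add: rotated_frontier_def)
  have "0 \<le> cos h" using h by (intro cos_ge_zero) auto
  then have "0 \<le> Re (rcis \<rho> h)" "0 \<le> Re (rcis \<rho> (- h))" if "0 \<le> \<rho>" for \<rho>
    using that by simp_all
  then show ?thesis using frontier_wedge_rays[OF h f] by (metis norm_ge_zero)
next
  case False
  then have "rot (W K \<omega>) \<in> wedge (- h) h"
    using h r K by (intro in_wedge_before_hit planar_continuous[OF W \<omega>] planar_0[OF W \<omega>]) auto
  then have "0 \<le> Re (rot (W K \<omega>))" by (rule Re_wedge_nonneg[OF h(2)])
  moreover have "stopped K \<omega> = K" using False by (simp add: stop_time_def)
  ultimately show ?thesis by simp
qed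

lemma AE_of_prob_ge_1:
  assumes "{\<omega> \<in> space M. P \<omega>} \<in> events" "1 \<le> prob {\<omega> \<in> space M. P \<omega>}"
  shows "AE \<omega> in M. P \<omega>"
  using AE_in_set_eq_1[OF assms(1)] assms(2) prob_le_1[of "{\<omega> \<in> space M. P \<omega>}"] by auto

text \<open>The parameters \<open>a\<close> and \<open>b\<close> below give the martingale with
  exponent \<open>- l * x - l^2 * t / 2\<close>, where \<open>x\<close> is the coordinate along the
  bisector, nonnegative when stopped. Its initial value \<open>exp (- l * r)\<close> is therefore at
  most \<open>prob H + exp (- l^2 * K / 2)\<close>. Let \<open>K\<close> tend to infinity and then
  \<open>l\<close> to 0.\<close>

lemma AE_hits_frontier: "AE \<omega> in M. \<exists>u\<ge>0. W u \<omega> \<in> bdry"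
proof -
  define H where "H = {\<omega> \<in> space M. \<exists>u\<ge>0. W u \<omega> \<in> bdry}"
  have H: "H \<in> events" unfolding H_def
    by (rule sets_hit) (use planar_measurable[OF W] planar_continuous[OF W] closed_rotated_frontier in auto)
  have 1: "exp (- l * r) \<le> prob H + exp (- l\<^sup>2 * K / 2)" if l: "0 < l" and K: "0 < K" for l K
  proof -
    define \<sigma> where "\<sigma> = (\<lambda>\<omega>. stopped K \<omega>)"
    define a b :: complex where "a = of_real (- l * cos \<theta>)" and "b = of_real (- l * sin \<theta>)"
    have ab: "a\<^sup>2 + b\<^sup>2 = of_real (l\<^sup>2)"
    proof -
      have "(- l * cos \<theta>)\<^sup>2 + (- l * sin \<theta>)\<^sup>2 = l\<^sup>2 * ((cos \<theta>)\<^sup>2 + (sin \<theta>)\<^sup>2)"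
        by (simp only: power_mult_distrib power2_minus distrib_left)
      then show ?thesis unfolding a_def b_def by (simp only: of_real_power[symmetric] of_real_add[symmetric] sin_cos_squared_add2 mult_1_right)
    qed
    have G: "exp_mart W a b (\<sigma> \<omega>) \<omega> = of_real (exp (l * r) * exp (- l * Re (rot (W (\<sigma> \<omega>) \<omega>)) - l\<^sup>2 * \<sigma> \<omega> / 2))" for \<omega>
      unfolding exp_mart_def ab exp_add[symmetric] exp_of_real[symmetric]
      by (rule arg_cong[where f=exp]) (simp add: a_def b_def algebra_simps)
    let ?f = "\<lambda>\<omega>. exp (l * r) * exp (- l * Re (rot (W (\<sigma> \<omega>) \<omega>)) - l\<^sup>2 * \<sigma> \<omega> / 2)"
    note st = exp_mart_stopped[OF W closed_rotated_frontier[of h \<theta> r] K, where a=a and b=b]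
    have fG: "?f \<omega> = Re (exp_mart W a b (stopped K \<omega>) \<omega>)" for \<omega>
      unfolding G[unfolded \<sigma>_def] \<sigma>_def by simp
    have if': "integrable M ?f" unfolding fG by (rule integrable_Re[OF st(1)])
    have ef: "(\<integral>\<omega>. ?f \<omega> \<partial>M) = 1" unfolding fG integral_Re[OF st(1)] st(2) by simp
    have "?f \<omega> \<le> exp (l * r) * (indicator H \<omega> + exp (- l\<^sup>2 * K / 2))" if \<omega>: "\<omega> \<in> space M" for \<omega>
    proof (rule mult_left_mono)
      have R: "0 \<le> l * Re (rot (W (\<sigma> \<omega>) \<omega>))" using Re_stopped_nonneg[OF \<omega> K] l by (simp add: \<sigma>_def)
      have s: "0 \<le> \<sigma> \<omega>"
        unfolding \<sigma>_def using K by (intro stop_time_bounds planar_continuous[OF W \<omega>] closed_rotated_frontier) auto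
      show "exp (- l * Re (rot (W (\<sigma> \<omega>) \<omega>)) - l\<^sup>2 * \<sigma> \<omega> / 2) \<le> indicator H \<omega> + exp (- l\<^sup>2 * K / 2)"
      proof (cases "\<exists>u\<in>{0..K}. W u \<omega> \<in> bdry")
        case True
        then have "\<omega> \<in> H" using \<omega> by (auto simp: H_def)
        moreover have "0 \<le> l\<^sup>2 * \<sigma> \<omega>" using s by simp
        then have "exp (- l * Re (rot (W (\<sigma> \<omega>) \<omega>)) - l\<^sup>2 * \<sigma> \<omega> / 2) \<le> exp 0" using R by (subst exp_le_cancel_iff) linarith
        ultimately show ?thesis by (simp add: add_increasing2)
      next
        case False
        then have "\<sigma> \<omega> = K" by (simp add: \<sigma>_def stop_time_def)
        then have "exp (- l * Re (rot (W (\<sigma> \<omega>) \<omega>)) - l\<^sup>2 * \<sigma> \<omega> / 2) \<le> exp (- l\<^sup>2 * K / 2)"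
          using R by (subst exp_le_cancel_iff) simp
        then show ?thesis by (simp add: add_increasing)
      qed
    qed simp
    then have "(\<integral>\<omega>. ?f \<omega> \<partial>M) \<le> (\<integral>\<omega>. exp (l * r) * (indicator H \<omega> + exp (- l\<^sup>2 * K / 2)) \<partial>M)"
      using H by (intro integral_mono if' integrable_mult_right Bochner_Integration.integrable_add
          integrable_const integrable_real_indicator) (auto simp: less_top[symmetric])
    also have "\<dots> = exp (l * r) * (prob H + exp (- l\<^sup>2 * K / 2))"
    proof -
      have "integrable M (indicator H :: 'a \<Rightarrow> real)" using H by (intro integrable_real_indicator) (auto simp: less_top[symmetric])
      then show ?thesis using H by (simp add: prob_space)
    qed
    finally have "exp (- l * r) * 1 \<le> exp (- l * r) * (exp (l * r) * (prob H + exp (- l\<^sup>2 * K / 2)))"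
      unfolding ef by (intro mult_left_mono) auto
    then show ?thesis by (simp add: mult.assoc[symmetric] exp_add[symmetric])
  qed
  have 2: "exp (- l * r) \<le> prob H" if l: "0 < l" for l
  proof (rule tendsto_le[OF trivial_limit_at_top_linorder _ tendsto_const])
    have "((\<lambda>K. exp (- l\<^sup>2 * K / 2)) \<longlongrightarrow> 0) at_top" using l by real_asymp
    then have "((\<lambda>K. prob H + exp (- l\<^sup>2 * K / 2)) \<longlongrightarrow> prob H + 0) at_top" by (intro tendsto_intros)
    then show "((\<lambda>K. prob H + exp (- l\<^sup>2 * K / 2)) \<longlongrightarrow> prob H) at_top" by simp
    show "\<forall>\<^sub>F K in at_top. exp (- l * r) \<le> prob H + exp (- l\<^sup>2 * K / 2)"
      using eventually_gt_at_top[of "0::real"] by eventually_elim (rule 1[OF l])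
  qed
  have "1 \<le> prob H"
  proof (rule tendsto_le[OF trivial_limit_at_right_real tendsto_const])
    show "((\<lambda>l. exp (- l * r)) \<longlongrightarrow> 1) (at_right 0)" by real_asymp
    show "\<forall>\<^sub>F l in at_right 0. exp (- l * r) \<le> prob H"
      using eventually_at_right_less[of "0::real"] by eventually_elim (rule 2)
  qed
  then show ?thesis using H unfolding H_def by (intro AE_of_prob_ge_1)
qed

lemma exit_time_measurable: "(\<lambda>\<omega>. wedge_exit_time h \<theta> r (\<lambda>u. W u \<omega>)) \<in> borel_measurable M"
proof -
  have [measurable]: "(\<lambda>\<omega>. hitting_time bdry (\<lambda>u. W u \<omega>)) \<in> borel_measurable M"
    by (rule borel_measurable_hitting_time)
      (use planar_measurable[OF W] planar_continuous[OF W] closed_rotated_frontier in auto)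
  show ?thesis unfolding wedge_exit_time_rotated by measurable
qed

lemma exit_point_measurable: "(\<lambda>\<omega>. wedge_exit_point h \<theta> r (\<lambda>u. W u \<omega>)) \<in> borel_measurable M"
proof -
  have [measurable]: "(\<lambda>\<omega>. W (wedge_exit_time h \<theta> r (\<lambda>u. W u \<omega>)) \<omega>) \<in> borel_measurable M"
    by (rule borel_measurable_at_random_time)
      (use planar_measurable[OF W] planar_continuous[OF W] exit_time_measurable in \<open>auto simp: wedge_exit_time_def\<close>)
  show ?thesis unfolding wedge_exit_point_def by measurable
qed

abbreviation (input) "rotated_exit \<omega> \<equiv> rotated_exit_point h \<theta> r (\<lambda>u. W u \<omega>)"

lemma cmod_rotated_exit: "cmod (rotated_exit \<omega>) = cmod (wedge_exit_point h \<theta> r (\<lambda>u. W u \<omega>))"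
  by (simp add: rotated_exit_point_def norm_mult)

lemma rotated_exit_measurable [measurable]: "(\<lambda>\<omega>. rotated_exit \<omega>) \<in> borel_measurable M"
  unfolding rotated_exit_point_def using exit_point_measurable by measurable

lemma rotated_exit_eq:
  assumes \<omega>: "\<omega> \<in> space M" and hit: "0 \<le> u" "W u \<omega> \<in> bdry"
  shows "rotated_exit \<omega> \<in> frontier (wedge (- h) h)"
    and "u \<le> K \<Longrightarrow> rotated_exit \<omega> = rot (W (stopped K \<omega>) \<omega>)"
proof -
  note a = hitting_time_attained[OF planar_continuous[OF W \<omega>] closed_rotated_frontier hit]
  have e: "rotated_exit \<omega> = rot (W (hitting_time bdry (\<lambda>u. W u \<omega>)) \<omega>)"
    using a(1) by (simp add: rotated_exit_point_def wedge_exit_point_def cis_minus_mult_rcis wedge_exit_time_rotated)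
  then show "rotated_exit \<omega> \<in> frontier (wedge (- h) h)" using a(3) by (simp add: rotated_frontier_def)
  show "rotated_exit \<omega> = rot (W (stopped K \<omega>) \<omega>)" if "u \<le> K"
  proof -
    have "\<exists>u\<in>{0..K}. W u \<omega> \<in> bdry" using that hit by auto
    then show ?thesis by (simp add: e stop_time_def)
  qed
qed

lemma AE_Re_rotated_exit: "AE \<omega> in M. Re (rotated_exit \<omega>) = cmod (rotated_exit \<omega>) * cos h"
  using AE_hits_frontier
proof (rule AE_mp[OF _ AE_I2], intro impI)
  fix \<omega> assume \<omega>: "\<omega> \<in> space M" "\<exists>u\<ge>0. W u \<omega> \<in> bdry"
  then have "rotated_exit \<omega> \<in> frontier (wedge (- h) h)" using rotated_exit_eq(1)[OF \<omega>(1)] by blast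
  from frontier_wedge_rays[OF h this] show "Re (rotated_exit \<omega>) = cmod (rotated_exit \<omega>) * cos h"
    by (metis Re_rcis cos_minus)
qed

lemma cos_h: "0 \<le> cos h" "cos h < 1"
proof -
  show "0 \<le> cos h" using h by (intro cos_ge_zero) auto
  show "cos h < 1" using cos_monotone_0_pi[of 0 h] h by simp
qed

text \<open>With \<open>b = \<i> * a\<close> the sum \<open>a^2 + b^2\<close> vanishes, so the
  stopped identity has no time term. The bound 1 in modulus lets the cap \<open>K\<close> tend to
  infinity by dominated convergence.\<close>

lemma exp_rotated_exit:
  assumes l: "0 \<le> l"
  shows "(\<integral>\<omega>. exp (- (of_real l * rotated_exit \<omega>)) \<partial>M) = exp (- (of_real l * of_real r))"
proof -
  define a :: complex where "a = - (of_real l * cis (- \<theta>))"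
  define \<sigma> where "\<sigma> = (\<lambda>n \<omega>. stopped (real (Suc n)) \<omega>)"
  let ?f = "\<lambda>n \<omega>. exp (- (of_real l * rot (W (\<sigma> n \<omega>) \<omega>)))"
  have G: "exp_mart W a (\<i> * a) t \<omega> = exp (of_real l * of_real r) * exp (- (of_real l * rot (W t \<omega>)))" for t \<omega>
  proof -
    have "a * of_real (Re (W t \<omega>)) + \<i> * a * of_real (Im (W t \<omega>)) = a * W t \<omega>"
      by (subst (3) complex_eq) (simp add: algebra_simps)
    then have "exp_mart W a (\<i> * a) t \<omega> = exp (a * W t \<omega>)" unfolding exp_mart_def by (simp add: power_mult_distrib)
    then show ?thesis unfolding exp_add[symmetric] by (simp add: a_def algebra_simps)
  qed
  have st: "integrable M (?f n)" "(\<integral>\<omega>. ?f n \<omega> \<partial>M) = exp (- (of_real l * of_real r))" for n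
  proof -
    have K: "0 < real (Suc n)" by simp
    note e = exp_mart_stopped[OF W closed_rotated_frontier[of h \<theta> r] K, where a=a and b="\<i> * a", unfolded G]
    show "integrable M (?f n)"
      using integrable_mult_right[OF e(1), of "exp (- (of_real l * of_real r))"]
      by (simp add: mult.assoc[symmetric] exp_add[symmetric] \<sigma>_def)
    have "exp (of_real l * of_real r) * (\<integral>\<omega>. ?f n \<omega> \<partial>M) = 1" using e(2) by (simp add: \<sigma>_def)
    then show "(\<integral>\<omega>. ?f n \<omega> \<partial>M) = exp (- (of_real l * of_real r))"
      by (simp add: exp_minus divide_inverse[symmetric] nonzero_eq_divide_eq mult.commute inverse_eq_divide)
  qed
  have "(\<lambda>n. \<integral>\<omega>. ?f n \<omega> \<partial>M) \<longlonglongrightarrow> (\<integral>\<omega>. exp (- (of_real l * rotated_exit \<omega>)) \<partial>M)"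
  proof (rule integral_dominated_convergence[where w="\<lambda>_. 1"])
    show "?f n \<in> borel_measurable M" for n using st(1) by (rule borel_measurable_integrable)
    show "AE \<omega> in M. (\<lambda>n. ?f n \<omega>) \<longlonglongrightarrow> exp (- (of_real l * rotated_exit \<omega>))"
      using AE_hits_frontier
    proof (rule AE_mp[OF _ AE_I2], intro impI)
      fix \<omega> assume \<omega>: "\<omega> \<in> space M" "\<exists>u\<ge>0. W u \<omega> \<in> bdry"
      then obtain u where u: "0 \<le> u" "W u \<omega> \<in> bdry" by blast
      have "\<forall>\<^sub>F n in sequentially. ?f n \<omega> = exp (- (of_real l * rotated_exit \<omega>))"
        using eventually_ge_at_top[of "nat \<lceil>u\<rceil>"]
      proof eventually_elim
        case (elim n)
        then have "u \<le> real (Suc n)" by linarith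
        then show ?case unfolding \<sigma>_def using rotated_exit_eq(2)[OF \<omega>(1) u] by metis
      qed
      then show "(\<lambda>n. ?f n \<omega>) \<longlonglongrightarrow> exp (- (of_real l * rotated_exit \<omega>))" by (rule tendsto_eventually)
    qed
    show "AE \<omega> in M. norm (?f n \<omega>) \<le> 1" for n
    proof (rule AE_I2)
      fix \<omega> assume "\<omega> \<in> space M"
      then have "0 \<le> l * Re (rot (W (\<sigma> n \<omega>) \<omega>))" unfolding \<sigma>_def using l Re_stopped_nonneg by simp
      then show "norm (?f n \<omega>) \<le> 1" by (simp add: norm_exp_eq_Re)
    qed
  qed auto
  then show ?thesis unfolding st(2) by (metis LIMSEQ_unique tendsto_const)
qed

text \<open>The exponential identity, averaged over \<open>l\<close> on both sides; Tonelli applies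
  since the averaged quantity is nonnegative.\<close>

lemma resolvent_rotated_exit:
  assumes b: "0 < b"
  shows "(\<integral>\<^sup>+\<omega>. ennreal (Re (rotated_exit \<omega> / (rotated_exit \<omega> + of_real b))) \<partial>M) = ennreal (Re (of_real r / (of_real r + of_real b)))"
proof -
  interpret P: pair_sigma_finite M lborel ..
  let ?g = "\<lambda>z l. ennreal (b * exp (- l * b) * (1 - Re (exp (- (of_real l * z))))) * indicator {0..} l"
  have nonneg: "AE \<omega> in M. 0 \<le> Re (rotated_exit \<omega>)" using AE_Re_rotated_exit by eventually_elim (simp add: cos_h)
  have "(\<integral>\<^sup>+\<omega>. ennreal (Re (rotated_exit \<omega> / (rotated_exit \<omega> + of_real b))) \<partial>M) = (\<integral>\<^sup>+\<omega>. \<integral>\<^sup>+l. ?g (rotated_exit \<omega>) l \<partial>lborel \<partial>M)"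
    by (rule nn_integral_cong_AE, rule AE_mp[OF nonneg AE_I2], rule impI,
        rule nn_integral_laplace_resolvent[OF _ b, symmetric])
  also have "\<dots> = (\<integral>\<^sup>+l. \<integral>\<^sup>+\<omega>. ?g (rotated_exit \<omega>) l \<partial>M \<partial>lborel)"
    by (rule P.Fubini'[symmetric]) measurable
  also have "\<dots> = (\<integral>\<^sup>+l. ?g (of_real r) l \<partial>lborel)"
  proof (rule nn_integral_cong)
    fix l :: real
    show "(\<integral>\<^sup>+\<omega>. ?g (rotated_exit \<omega>) l \<partial>M) = ?g (of_real r) l"
    proof (cases "0 \<le> l")
      case True
      have bd: "AE \<omega> in M. cmod (exp (- (of_real l * rotated_exit \<omega>))) \<le> 1"
        using nonneg by eventually_elim (simp add: norm_exp_eq_Re True)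
      then have i: "integrable M (\<lambda>\<omega>. exp (- (of_real l * rotated_exit \<omega>)))"
        by (intro integrable_const_bound[where B=1]) auto
      have "(\<integral>\<^sup>+\<omega>. ?g (rotated_exit \<omega>) l \<partial>M) = (\<integral>\<^sup>+\<omega>. ennreal (b * exp (- l * b) * (1 - Re (exp (- (of_real l * rotated_exit \<omega>))))) \<partial>M)"
        using True by simp
      also have "\<dots> = ennreal (\<integral>\<omega>. b * exp (- l * b) * (1 - Re (exp (- (of_real l * rotated_exit \<omega>)))) \<partial>M)"
      proof (rule nn_integral_eq_integral)
        show "integrable M (\<lambda>\<omega>. b * exp (- l * b) * (1 - Re (exp (- (of_real l * rotated_exit \<omega>)))))"
          using i by (intro integrable_mult_right Bochner_Integration.integrable_diff integrable_Re) auto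
        show "AE \<omega> in M. 0 \<le> b * exp (- l * b) * (1 - Re (exp (- (of_real l * rotated_exit \<omega>))))"
          using bd
        proof eventually_elim
          case (elim \<omega>)
          then have "Re (exp (- (of_real l * rotated_exit \<omega>))) \<le> 1" by (rule order_trans[OF complex_Re_le_cmod])
          then show ?case using b by simp
        qed
      qed
      also have "(\<integral>\<omega>. b * exp (- l * b) * (1 - Re (exp (- (of_real l * rotated_exit \<omega>)))) \<partial>M)
          = b * exp (- l * b) * (1 - Re (\<integral>\<omega>. exp (- (of_real l * rotated_exit \<omega>)) \<partial>M))"
        using i by (simp add: Bochner_Integration.integral_diff integrable_Re integral_Re prob_space)
      finally show ?thesis using True by (simp add: exp_rotated_exit)
    qed simp
  qed
  also have "\<dots> = ennreal (Re (of_real r / (of_real r + of_real b)))"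
    by (rule nn_integral_laplace_resolvent) (use r b in auto)
  finally show ?thesis .
qed

text \<open>The resolvent identity averaged over \<open>b = exp u\<close>. Keeping it multiplied out
  makes it meaningful for infinite moments too; the ratio is formed once the moments are known to be
  finite and positive.\<close>

lemma moment_rotated_exit:
  "(\<integral>\<^sup>+\<omega>. ennreal (cmod (rotated_exit \<omega>) powr d) \<partial>M) * wedge_moment d (cos h) = ennreal (r powr d) * wedge_moment d 1"
proof -
  interpret P: pair_sigma_finite M lborel ..
  let ?g = "\<lambda>z u. ennreal (exp (d * u) * Re (z / (z + of_real (exp u))))"
  have "(\<integral>\<^sup>+\<omega>. ennreal (cmod (rotated_exit \<omega>) powr d) \<partial>M) * wedge_moment d (cos h)
      = (\<integral>\<^sup>+\<omega>. ennreal (cmod (rotated_exit \<omega>) powr d) * wedge_moment d (cos h) \<partial>M)"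
    by (rule nn_integral_multc[symmetric]) measurable
  also have "\<dots> = (\<integral>\<^sup>+\<omega>. \<integral>\<^sup>+u. ?g (rotated_exit \<omega>) u \<partial>lborel \<partial>M)"
    by (rule nn_integral_cong_AE, rule AE_mp[OF AE_Re_rotated_exit AE_I2], rule impI,
        rule nn_integral_resolvent_powr[OF cos_h(1), symmetric])
  also have "\<dots> = (\<integral>\<^sup>+u. \<integral>\<^sup>+\<omega>. ?g (rotated_exit \<omega>) u \<partial>M \<partial>lborel)"
    by (rule P.Fubini'[symmetric]) measurable
  also have "\<dots> = (\<integral>\<^sup>+u. ?g (of_real r) u \<partial>lborel)"
  proof (rule nn_integral_cong)
    fix u :: real
    have "(\<integral>\<^sup>+\<omega>. ?g (rotated_exit \<omega>) u \<partial>M)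
      = (\<integral>\<^sup>+\<omega>. ennreal (exp (d * u)) * ennreal (Re (rotated_exit \<omega> / (rotated_exit \<omega> + of_real (exp u)))) \<partial>M)"
      by (simp add: ennreal_mult')
    also have "\<dots> = ennreal (exp (d * u)) * ennreal (Re (of_real r / (of_real r + of_real (exp u))))"
      by (subst nn_integral_cmult) (simp_all only: resolvent_rotated_exit[OF exp_gt_zero], measurable)
    finally show "(\<integral>\<^sup>+\<omega>. ?g (rotated_exit \<omega>) u \<partial>M) = ?g (of_real r) u" by (simp only: ennreal_mult'[OF exp_ge_zero])
  qed
  also have "\<dots> = ennreal (r powr d) * wedge_moment d 1"
    using nn_integral_resolvent_powr[of 1 "of_real r" d] r by simp
  finally show ?thesis .
qed

text \<open>For \<open>0 \<le> Re z\<close> the quantity \<open>Re (z / (z + b))\<close> is at most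
  1, and it is 0 at the apex. Its mean \<open>r / (r + b)\<close> thus bounds the probability of
  missing the apex from below; let \<open>b\<close> tend to 0.\<close>

lemma AE_exit_nonzero: "AE \<omega> in M. rotated_exit \<omega> \<noteq> 0"
proof -
  define H where "H = {\<omega> \<in> space M. rotated_exit \<omega> \<noteq> 0}"
  have H: "H \<in> events" unfolding H_def by measurable
  have 1: "r / (r + b) \<le> prob H" if b: "0 < b" for b
  proof -
    have "ennreal (r / (r + b)) = (\<integral>\<^sup>+\<omega>. ennreal (Re (rotated_exit \<omega> / (rotated_exit \<omega> + of_real b))) \<partial>M)"
      unfolding resolvent_rotated_exit[OF b] by (simp add: Re_divide power2_eq_square)
    also have "\<dots> \<le> (\<integral>\<^sup>+\<omega>. indicator H \<omega> \<partial>M)"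
    proof (rule nn_integral_mono_AE)
      show "AE \<omega> in M. ennreal (Re (rotated_exit \<omega> / (rotated_exit \<omega> + of_real b))) \<le> indicator H \<omega>"
        using AE_Re_rotated_exit
      proof (rule AE_mp[OF _ AE_I2], intro impI)
        fix \<omega> assume \<omega>: "\<omega> \<in> space M" and R: "Re (rotated_exit \<omega>) = cmod (rotated_exit \<omega>) * cos h"
        show "ennreal (Re (rotated_exit \<omega> / (rotated_exit \<omega> + of_real b))) \<le> indicator H \<omega>"
        proof (cases "rotated_exit \<omega> = 0")
          case False
          have "0 \<le> b * Re (rotated_exit \<omega>)" using R b cos_h by simp
          moreover have "0 < b\<^sup>2" using b by simp
          ultimately have "Re (rotated_exit \<omega> / (rotated_exit \<omega> + of_real b)) \<le> 1"
            unfolding Re_divide_add_of_real by (subst divide_le_eq_1) (auto intro: add_nonneg_pos)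
          then show ?thesis using False \<omega> by (simp add: H_def)
        qed simp
      qed
    qed
    also have "\<dots> = ennreal (prob H)" using H by (simp add: emeasure_eq_measure)
    finally show ?thesis using r b by (simp add: ennreal_le_iff)
  qed
  have "1 \<le> prob H"
  proof (rule tendsto_le[OF trivial_limit_at_right_real tendsto_const])
    show "((\<lambda>b. r / (r + b)) \<longlongrightarrow> 1) (at_right 0)" using r by real_asymp
    show "\<forall>\<^sub>F b in at_right 0. r / (r + b) \<le> prob H"
      using eventually_at_right_less[of "0::real"] by eventually_elim (rule 1)
  qed
  then show ?thesis using H unfolding H_def by (intro AE_of_prob_ge_1)
qed

text \<open>The function \<open>cos (c * x) + cos (c * y)\<close> is an eigenfunction of the Laplacian that vanishes on the
  boundary of the square \<open>c * (\<bar>x\<bar> + \<bar>y\<bar>) < pi\<close>, which fits into the wedge.\<close>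

lemma exit_time_tail:
  assumes K: "0 < K"
  defines "c \<equiv> pi / (r * sin h)"
  shows "exp (- (c\<^sup>2 * K / 2)) \<le> prob {\<omega> \<in> space M. K < wedge_exit_time h \<theta> r (\<lambda>u. W u \<omega>)}"
proof -
  have sh: "0 < sin h" using h by (intro sin_gt_zero) auto
  have c: "0 < c" using r sh by (simp add: c_def)
  define S where "S = {w. c * (\<bar>Re w\<bar> + \<bar>Im w\<bar>) = pi}"
  have S: "closed S" unfolding S_def by (intro closed_Collect_eq continuous_intros)
  define \<sigma> where "\<sigma> = (\<lambda>\<omega>. stop_time S K (\<lambda>u. W u \<omega>))"
  define A where "A = {\<omega> \<in> space M. \<not> (\<exists>u\<in>{0..K}. W u \<omega> \<in> S)}"
  have "{\<omega> \<in> space M. \<exists>u\<in>{0..K}. W u \<omega> \<in> S} \<in> events"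
    by (rule sets_hit_before) (use planar_measurable[OF W] planar_continuous[OF W] S in auto)
  then have "space M - {\<omega> \<in> space M. \<exists>u\<in>{0..K}. W u \<omega> \<in> S} \<in> events" by blast
  also have "space M - {\<omega> \<in> space M. \<exists>u\<in>{0..K}. W u \<omega> \<in> S} = A" by (auto simp: A_def)
  finally have A: "A \<in> events" .
  \<comment> \<open>Real parts of exponential martingales with a purely imaginary parameter, so each
    has mean 1 at the stopping time.\<close>
  let ?f = "\<lambda>\<omega>. exp (c\<^sup>2 * \<sigma> \<omega> / 2) * cos (c * Re (W (\<sigma> \<omega>) \<omega>))"
  let ?g = "\<lambda>\<omega>. exp (c\<^sup>2 * \<sigma> \<omega> / 2) * cos (c * Im (W (\<sigma> \<omega>) \<omega>))"
  have Re_eq: "Re (exp (of_real s + \<i> * of_real x)) = exp s * cos x" for s x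
    by (simp add: Re_exp)
  have fG: "Re (exp_mart W (\<i> * of_real c) 0 (\<sigma> \<omega>) \<omega>) = ?f \<omega>" for \<omega>
    unfolding exp_mart_def Re_eq[symmetric] by (intro arg_cong[where f=Re] arg_cong[where f=exp]) (simp add: power_mult_distrib)
  have gG: "Re (exp_mart W 0 (\<i> * of_real c) (\<sigma> \<omega>) \<omega>) = ?g \<omega>" for \<omega>
    unfolding exp_mart_def Re_eq[symmetric] by (intro arg_cong[where f=Re] arg_cong[where f=exp]) (simp add: power_mult_distrib)
  note st = exp_mart_stopped[OF W S K]
  have f: "integrable M ?f" "(\<integral>\<omega>. ?f \<omega> \<partial>M) = 1"
    unfolding fG[symmetric] unfolding \<sigma>_def integral_Re[OF st(1)] st(2) by (rule integrable_Re[OF st(1)]) simp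
  have g: "integrable M ?g" "(\<integral>\<omega>. ?g \<omega> \<partial>M) = 1"
    unfolding gG[symmetric] unfolding \<sigma>_def integral_Re[OF st(1)] st(2) by (rule integrable_Re[OF st(1)]) simp
  have le: "?f \<omega> + ?g \<omega> \<le> 2 * exp (c\<^sup>2 * K / 2) * indicator A \<omega>" if \<omega>: "\<omega> \<in> space M" for \<omega>
  proof (cases "\<omega> \<in> A")
    case True
    then have "\<sigma> \<omega> = K" by (simp add: \<sigma>_def A_def stop_time_def)
    moreover have "exp (c\<^sup>2 * K / 2) * cos x + exp (c\<^sup>2 * K / 2) * cos y \<le> 2 * exp (c\<^sup>2 * K / 2)" for x y
      unfolding distrib_left[symmetric] mult.commute[of 2]
      using add_mono[OF cos_le_one[of x] cos_le_one[of y]] by (intro mult_left_mono) simp_all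
    ultimately show ?thesis using True by (simp only: indicator_simps mult_1_right)
  next
    case False
    then have hit: "\<exists>u\<in>{0..K}. W u \<omega> \<in> S" using \<omega> by (auto simp: A_def)
    then have "W (\<sigma> \<omega>) \<omega> \<in> S"
      using hitting_time_attained(3)[OF planar_continuous[OF W \<omega>] S] by (auto simp: \<sigma>_def stop_time_def)
    then have e: "c * \<bar>Im (W (\<sigma> \<omega>) \<omega>)\<bar> = pi - c * \<bar>Re (W (\<sigma> \<omega>) \<omega>)\<bar>" by (simp add: S_def algebra_simps)
    have ca: "cos (c * x) = cos (c * \<bar>x\<bar>)" for x by (cases "0 \<le> x") auto
    have "cos (c * Im (W (\<sigma> \<omega>) \<omega>)) = - cos (c * Re (W (\<sigma> \<omega>) \<omega>))"
      unfolding ca[of "Im _"] ca[of "Re _"] e by simp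
    then show ?thesis using False by simp
  qed
  have "2 = (\<integral>\<omega>. ?f \<omega> + ?g \<omega> \<partial>M)" using f g by simp
  also have "\<dots> \<le> (\<integral>\<omega>. 2 * exp (c\<^sup>2 * K / 2) * indicator A \<omega> \<partial>M)"
    using f g A le by (intro integral_mono Bochner_Integration.integrable_add integrable_mult_right
        integrable_real_indicator) (auto simp: less_top[symmetric])
  also have "\<dots> = 2 * exp (c\<^sup>2 * K / 2) * prob A" using A by simp
  finally have "exp (- (c\<^sup>2 * K / 2)) * 1 \<le> exp (- (c\<^sup>2 * K / 2)) * (exp (c\<^sup>2 * K / 2) * prob A)"
    by (intro mult_left_mono) auto
  then have "exp (- (c\<^sup>2 * K / 2)) \<le> prob A" by (simp add: mult.assoc[symmetric] exp_add[symmetric])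
  also have "prob A \<le> prob {\<omega> \<in> space M. K < wedge_exit_time h \<theta> r (\<lambda>u. W u \<omega>)}"
  proof (rule finite_measure_mono_AE)
    show "{\<omega> \<in> space M. K < wedge_exit_time h \<theta> r (\<lambda>u. W u \<omega>)} \<in> events"
      using exit_time_measurable by measurable
    show "AE \<omega> in M. \<omega> \<in> A \<longrightarrow> \<omega> \<in> {\<omega> \<in> space M. K < wedge_exit_time h \<theta> r (\<lambda>u. W u \<omega>)}"
      using AE_hits_frontier
    proof (rule AE_mp[OF _ AE_I2], intro impI)
      fix \<omega> assume \<omega>: "\<omega> \<in> space M" "\<exists>u\<ge>0. W u \<omega> \<in> bdry" "\<omega> \<in> A"
      then obtain u where u: "0 \<le> u" "W u \<omega> \<in> bdry" by blast
      note a = hitting_time_attained[OF planar_continuous[OF W \<omega>(1)] closed_rotated_frontier u]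
      let ?\<tau> = "hitting_time bdry (\<lambda>u. W u \<omega>)"
      \<comment> \<open>At an edge \<open>k\<close> is at least \<open>c * r * sin h = pi\<close>,
        while it starts at 0; by the intermediate value theorem an exit by time \<open>K\<close>
        would have crossed \<open>S\<close> earlier.\<close>
      have "K < ?\<tau>"
      proof (rule ccontr)
        assume "\<not> K < ?\<tau>"
        then have \<tau>: "0 \<le> ?\<tau>" "?\<tau> \<le> K" using a by auto
        define k where "k = (\<lambda>u. c * (\<bar>Re (W u \<omega>)\<bar> + \<bar>Im (W u \<omega>)\<bar>))"
        have "rot (W ?\<tau> \<omega>) \<in> frontier (wedge (- h) h)" using a(3) by (simp add: rotated_frontier_def)
        from dist_frontier_wedge[OF h _ this, of r] have "r * sin h \<le> cmod (W ?\<tau> \<omega>)" using r by (simp add: norm_mult)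
        also have "\<dots> \<le> \<bar>Re (W ?\<tau> \<omega>)\<bar> + \<bar>Im (W ?\<tau> \<omega>)\<bar>" by (rule cmod_le)
        finally have "c * (r * sin h) \<le> k ?\<tau>" unfolding k_def using c by (intro mult_left_mono) auto
        then have 1: "pi \<le> k ?\<tau>" using r sh by (simp add: c_def)
        have 0: "k 0 \<le> pi" using planar_0[OF W \<omega>(1)] by (simp add: k_def)
        have "continuous_on {0..?\<tau>} k" unfolding k_def
          by (intro continuous_intros continuous_on_subset[OF planar_continuous[OF W \<omega>(1)]]) auto
        from IVT'[OF 0 1 \<tau>(1) this] obtain v where "0 \<le> v" "v \<le> ?\<tau>" "k v = pi" by blast
        then show False using \<omega>(3) \<tau>(2) by (auto simp: A_def S_def k_def)
      qed
      then show "\<omega> \<in> {\<omega> \<in> space M. K < wedge_exit_time h \<theta> r (\<lambda>u. W u \<omega>)}"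
        using \<omega>(1) by (simp add: wedge_exit_time_rotated)
    qed
  qed
  finally show ?thesis .
qed

end

section \<open>One step of the algorithm\<close>

text \<open>Neither stopping rule has applied. The criterion is written without division, so
  \<open>t = T\<close> counts as alive, in accordance with stopping only when the time exceeds
  \<open>T\<close>. Positivity of the radius, which holds almost surely, is included for the
  one-step estimates.\<close>

definition alive :: "real \<Rightarrow> real \<Rightarrow> real \<Rightarrow> real \<Rightarrow> bool" where
  "alive T \<epsilon> r t \<longleftrightarrow> t \<le> T \<and> (t < T \<longrightarrow> \<epsilon> * (T - t) \<le> r\<^sup>2) \<and> 0 < r"

text \<open>The function \<open>V\<close> of the overview. The test \<open>T - t \<le> r^2\<close>
  also catches \<open>t \<ge> T\<close>, where the quotient loses its meaning and \<open>s\<close>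
  should be read as infinite.\<close>

definition lyap :: "real \<Rightarrow> real \<Rightarrow> real \<Rightarrow> real \<Rightarrow> real \<Rightarrow> real" where
  "lyap A d T r t = A - (if T - t \<le> r\<^sup>2 then 1 else (r\<^sup>2 / (T - t)) powr (d / 2))"

definition lyap_next :: "real \<Rightarrow> real \<Rightarrow> real \<Rightarrow> real \<Rightarrow> real \<Rightarrow> real \<Rightarrow> real \<Rightarrow> real \<Rightarrow> (real \<Rightarrow> complex) \<Rightarrow> ennreal" where
  "lyap_next h A d T \<epsilon> \<theta> r t w =
     (let \<rho> = cmod (wedge_exit_point h \<theta> r w); s = t + wedge_exit_time h \<theta> r w
      in ennreal (lyap A d T \<rho> s) * indicator {(\<rho>, s). alive T \<epsilon> \<rho> s} (\<rho>, s))"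

lemma lyap_bounds:
  assumes "0 < d"
  shows "A - 1 \<le> lyap A d T r t" "lyap A d T r t \<le> A"
proof -
  have "(r\<^sup>2 / (T - t)) powr (d / 2) \<le> 1" if "\<not> T - t \<le> r\<^sup>2"
  proof (rule powr_le1)
    have "0 \<le> r\<^sup>2" by simp
    then have "0 < T - t" using that by linarith
    then show "\<bar>r\<^sup>2 / (T - t)\<bar> \<le> 1" using that by auto
  qed (use assms in simp)
  then show "A - 1 \<le> lyap A d T r t" "lyap A d T r t \<le> A" by (auto simp: lyap_def)
qed

text \<open>Replacing \<open>s\<close> by the earlier \<open>t\<close> only decreases the ratio, so
  the new radius can be treated apart from its exit time. To remove the cap, note that for a ratio
  at least 1 the difference of powers is at most 0, and for a smaller ratio the cap is inactive and
  the power of order \<open>q\<close> is nonnegative.\<close>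

lemma lyap_le_of_earlier:
  assumes d: "0 < d" "d < q" and R: "0 < T - t" and s: "t \<le> s"
  shows "lyap A d T \<rho> s \<le> A - ((\<rho>\<^sup>2 / (T - t)) powr (d / 2) - (\<rho>\<^sup>2 / (T - t)) powr (q / 2))"
proof (cases "T - t \<le> \<rho>\<^sup>2")
  case True
  then have "1 \<le> \<rho>\<^sup>2 / (T - t)" using R by simp
  then have "(\<rho>\<^sup>2 / (T - t)) powr (d / 2) \<le> (\<rho>\<^sup>2 / (T - t)) powr (q / 2)" using d by (intro powr_mono) auto
  then show ?thesis using lyap_bounds(2)[OF d(1), of A T \<rho> s] by linarith
next
  case False
  have x: "0 \<le> \<rho>\<^sup>2 / (T - t)" "\<rho>\<^sup>2 / (T - t) \<le> 1" using False R by auto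
  have "(\<rho>\<^sup>2 / (T - t)) powr (d / 2) \<le> (if T - s \<le> \<rho>\<^sup>2 then 1 else (\<rho>\<^sup>2 / (T - s)) powr (d / 2))"
  proof (cases "T - s \<le> \<rho>\<^sup>2")
    case True
    then show ?thesis using powr_le1[of "d / 2" "\<rho>\<^sup>2 / (T - t)", unfolded abs_of_nonneg[OF x(1)]] x d by simp
  next
    case F: False
    have "0 \<le> \<rho>\<^sup>2" by simp
    then have "0 < T - s" using F by linarith
    then have "\<rho>\<^sup>2 / (T - t) \<le> \<rho>\<^sup>2 / (T - s)" using s by (intro divide_left_mono) auto
    then show ?thesis using F x d by (auto intro!: powr_mono2)
  qed
  then show ?thesis unfolding lyap_def using powr_ge_zero[of "\<rho>\<^sup>2 / (T - t)" "q / 2"] by linarith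
qed

text \<open>The constants are fixed before the state, the horizon and \<epsilon>. As
  \<open>V \<le> A\<close>, a drop by \<open>\<eta> * \<epsilon> powr (d / 2)\<close> is at least
  the fraction \<open>\<eta> * \<epsilon> powr (d / 2) / A\<close> of \<open>V\<close>, which gives
  the multiplicative form that can be iterated.\<close>

lemma wedge_drift:
  assumes d: "0 < d" "d < q" "q < 1" and h: "0 < h" "h \<le> pi / 2"
  obtains \<eta> A where "0 < \<eta>" "\<eta> \<le> 1" "2 \<le> A"
    "\<And>(M :: 'a measure) W \<theta> r t T \<epsilon>. planar_brownian_motion M W \<Longrightarrow> alive T \<epsilon> r t \<Longrightarrow> 0 < \<epsilon> \<Longrightarrow> \<epsilon> < 1 \<Longrightarrow>
      (\<integral>\<^sup>+\<omega>. lyap_next h A d T \<epsilon> \<theta> r t (\<lambda>u. W u \<omega>) \<partial>M) \<le> ennreal ((1 - \<eta> * \<epsilon> powr (d / 2) / A) * lyap A d T r t)"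
proof -
  have ch: "0 \<le> cos h" "cos h < 1" using cos_ge_zero[of h] cos_monotone_0_pi[of 0 h] h by auto
  obtain k0 k1 where k: "wedge_moment d 1 = ennreal k0" "wedge_moment d (cos h) = ennreal k1" "0 < k1" "k1 < k0"
    using wedge_moment_less[OF ch, of d] d by auto
  obtain l0 l1 where l: "wedge_moment q 1 = ennreal l0" "wedge_moment q (cos h) = ennreal l1" "0 < l1" "l1 < l0"
    using wedge_moment_less[OF ch, of q] d by auto
  define \<eta>' where "\<eta>' = k0 / k1 - 1"
  \<comment> \<open>Half of the relative gain \<open>\<eta>'\<close> in the moment of order
    \<open>d\<close>; the other half absorbs the term of order \<open>q\<close>. The bound by 1
    serves the regime of large ratios, where the available drop is 1.\<close>
  define \<eta> where "\<eta> = min 1 (\<eta>' / 2)"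
  define \<kappa> where "\<kappa> = l0 / l1"
  have \<eta>': "0 < \<eta>'" using k by (simp add: \<eta>'_def)
  have \<eta>: "0 < \<eta>" "\<eta> \<le> 1" "2 * \<eta> \<le> \<eta>'" using \<eta>' by (auto simp: \<eta>_def)
  have \<kappa>: "0 < \<kappa>" using l by (simp add: \<kappa>_def)
  \<comment> \<open>For \<open>y \<le> s1\<close> the term of order \<open>q\<close> is at most
    \<eta> times the power of order \<open>d\<close>; \<open>s1 \<le> 1\<close> ensures that
    \<open>V\<close> at the current state is given by the power itself.\<close>
  define s1 where "s1 = min 1 ((\<eta> / \<kappa>) powr (2 / (q - d)))"
  have s1: "0 < s1" "s1 \<le> 1" using \<eta> \<kappa> by (auto simp: s1_def)
  have small: "\<kappa> * y powr (q / 2) \<le> \<eta> * y powr (d / 2)" if y: "0 < y" "y \<le> s1" for y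
  proof -
    have "y powr ((q - d) / 2) \<le> ((\<eta> / \<kappa>) powr (2 / (q - d))) powr ((q - d) / 2)"
      using y d by (intro powr_mono2) (auto simp: s1_def)
    also have "\<dots> = \<eta> / \<kappa>"
    proof -
      have "2 / (q - d) * ((q - d) / 2) = 1" using d by simp
      then show ?thesis using \<eta> \<kappa> by (simp only: powr_powr) simp
    qed
    finally have "\<kappa> * y powr ((q - d) / 2) \<le> \<eta>" using \<kappa> by (simp add: field_simps)
    then have "\<kappa> * y powr ((q - d) / 2) * y powr (d / 2) \<le> \<eta> * y powr (d / 2)"
      by (rule mult_right_mono) simp
    then show ?thesis by (simp add: mult.assoc powr_add[symmetric] diff_divide_distrib)
  qed
  \<comment> \<open>The bound of \<open>exit_time_tail\<close> for a step longer than
    \<open>r^2 / s1\<close>; the radius cancels.\<close>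
  define p0 where "p0 = exp (- (pi\<^sup>2 / (2 * (sin h)\<^sup>2 * s1)))"
  \<comment> \<open>Chosen so that \<open>A * (1 - p0) = A - 2\<close>, which is at most
    \<open>V - 1\<close> because \<open>V \<ge> A - 1\<close>.\<close>
  define A where "A = 2 / p0"
  have sh: "0 < sin h" using h by (intro sin_gt_zero) auto
  have p0: "0 < p0" "p0 \<le> 1" using s1 by (auto simp: p0_def)
  have A: "2 \<le> A" using p0 by (simp add: A_def pos_le_divide_eq)
  show thesis
  proof (rule that[OF \<eta>(1,2) A])
    fix M :: "'a measure" and W \<theta> r t T \<epsilon>
    assume W: "planar_brownian_motion M W" and al: "alive T \<epsilon> r t" and \<epsilon>: "0 < \<epsilon>" "\<epsilon> < 1"
    have r: "0 < r" and tT: "t \<le> T" using al by (auto simp: alive_def)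
    interpret prob_space M by (rule planar_prob_space[OF W])
    define \<rho> where "\<rho> = (\<lambda>\<omega>. cmod (wedge_exit_point h \<theta> r (\<lambda>u. W u \<omega>)))"
    define \<tau> where "\<tau> = (\<lambda>\<omega>. wedge_exit_time h \<theta> r (\<lambda>u. W u \<omega>))"
    have [measurable]: "\<rho> \<in> borel_measurable M" "\<tau> \<in> borel_measurable M"
      unfolding \<rho>_def[abs_def] \<tau>_def[abs_def] using exit_point_measurable[OF W h r] exit_time_measurable[OF W h r] by auto
    have \<tau>0: "0 \<le> \<tau> \<omega>" for \<omega> by (simp add: \<tau>_def wedge_exit_time_def)
    let ?R = "T - t"
    let ?F = "\<lambda>\<omega>. ennreal (lyap A d T (\<rho> \<omega>) (t + \<tau> \<omega>)) * indicator {(\<rho>, s). alive T \<epsilon> \<rho> s} (\<rho> \<omega>, t + \<tau> \<omega>)"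
    have main: "(\<integral>\<^sup>+\<omega>. ?F \<omega> \<partial>M) \<le> ennreal (lyap A d T r t - \<eta> * \<epsilon> powr (d / 2))"
    proof (cases "r\<^sup>2 \<le> s1 * ?R")
      case True
      have R: "0 < ?R"
      proof -
        have "0 < s1 * ?R" using True r by (meson less_le_trans zero_less_power)
        then show ?thesis using s1 by (simp add: zero_less_mult_iff)
      qed
      have mom: "integrable M (\<lambda>\<omega>. \<rho> \<omega> powr e)" "(\<integral>\<omega>. \<rho> \<omega> powr e \<partial>M) = r powr e * (m0 / m1)"
        if m: "wedge_moment e 1 = ennreal m0" "wedge_moment e (cos h) = ennreal m1" "0 < m1" "m1 < m0" for e m0 m1
      proof -
        have eq: "(\<integral>\<^sup>+\<omega>. ennreal (\<rho> \<omega> powr e) \<partial>M) * ennreal m1 = ennreal (r powr e) * ennreal m0"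
          using moment_rotated_exit[OF W h r, of \<theta> e] unfolding m cmod_rotated_exit[OF W h r] \<rho>_def by simp
        \<comment> \<open>Finiteness comes from the identity itself: an infinite mean times the
          positive \<open>m1\<close> would equal a finite product.\<close>
        have fin: "(\<integral>\<^sup>+\<omega>. ennreal (\<rho> \<omega> powr e) \<partial>M) \<noteq> \<infinity>"
        proof
          assume "(\<integral>\<^sup>+\<omega>. ennreal (\<rho> \<omega> powr e) \<partial>M) = \<infinity>"
          then have "ennreal (r powr e) * ennreal m0 = top" using eq m(3) by (simp add: ennreal_top_mult)
          then show False by (simp add: ennreal_mult_eq_top_iff)
        qed
        then show i: "integrable M (\<lambda>\<omega>. \<rho> \<omega> powr e)"
          by (intro integrableI_bounded) (auto simp: less_top)
        have "ennreal ((\<integral>\<omega>. \<rho> \<omega> powr e \<partial>M) * m1) = ennreal (r powr e * m0)"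
          using eq m unfolding nn_integral_eq_integral[OF i AE_I2[OF powr_ge_zero]]
          by (simp add: ennreal_mult'' ennreal_mult')
        then have "(\<integral>\<omega>. \<rho> \<omega> powr e \<partial>M) * m1 = r powr e * m0"
          using m by (subst (asm) ennreal_inj) (auto intro!: mult_nonneg_nonneg Bochner_Integration.integral_nonneg)
        then show "(\<integral>\<omega>. \<rho> \<omega> powr e \<partial>M) = r powr e * (m0 / m1)" using m by (simp add: field_simps)
      qed
      have pw: "(x\<^sup>2 / ?R) powr (e / 2) = x powr e * ?R powr (- e / 2)" if "0 \<le> x" for x e
      proof (cases "x = 0")
        case False
        then have "x\<^sup>2 = x powr 2" using that by simp
        then have "x\<^sup>2 powr (e / 2) = x powr e" by (simp only: powr_powr) simp
        moreover have "(x\<^sup>2 / ?R) powr (e / 2) = x\<^sup>2 powr (e / 2) / ?R powr (e / 2)"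
          by (rule powr_divide)
        ultimately show ?thesis by (simp only: minus_divide_left[symmetric] powr_minus divide_inverse[of "_ powr _"])
      qed simp
      let ?B = "\<lambda>\<omega>. A - (\<rho> \<omega> powr d * ?R powr (- d / 2) - \<rho> \<omega> powr q * ?R powr (- q / 2))"
      have \<rho>0: "0 \<le> \<rho> \<omega>" for \<omega> by (simp add: \<rho>_def)
      \<comment> \<open>Makes \<open>?B\<close> nonnegative, as needed to pass to the Lebesgue
        integral. It is the comparison for \<open>A = 1\<close>, where \<open>lyap\<close> is
        nonnegative.\<close>
      have le1: "\<rho> \<omega> powr d * ?R powr (- d / 2) - \<rho> \<omega> powr q * ?R powr (- q / 2) \<le> 1" for \<omega>
      proof -
        have "lyap 1 d T (\<rho> \<omega>) t \<ge> 0" using lyap_bounds(1)[of d 1 T "\<rho> \<omega>" t] d by simp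
        then show ?thesis using lyap_le_of_earlier[OF d(1,2) R order_refl, of 1 "\<rho> \<omega>"] unfolding pw[OF \<rho>0] by linarith
      qed
      have iB: "integrable M ?B" using mom(1)[OF k] mom(1)[OF l] by simp
      have "(\<integral>\<^sup>+\<omega>. ?F \<omega> \<partial>M) \<le> (\<integral>\<^sup>+\<omega>. ennreal (?B \<omega>) \<partial>M)"
      proof (rule nn_integral_mono)
        fix \<omega>
        have "lyap A d T (\<rho> \<omega>) (t + \<tau> \<omega>) \<le> ?B \<omega>"
          using lyap_le_of_earlier[OF d(1,2) R, of "t + \<tau> \<omega>" A "\<rho> \<omega>"] \<tau>0 unfolding pw[OF \<rho>0] by simp
        then show "?F \<omega> \<le> ennreal (?B \<omega>)" by (auto simp: ennreal_leI split: split_indicator)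
      qed
      also have "\<dots> = ennreal (\<integral>\<omega>. ?B \<omega> \<partial>M)"
        by (rule nn_integral_eq_integral[OF iB AE_I2]) (use le1 A in \<open>smt (verit)\<close>)
      also have "(\<integral>\<omega>. ?B \<omega> \<partial>M) = A - (r powr d * (k0 / k1) * ?R powr (- d / 2) - r powr q * (l0 / l1) * ?R powr (- q / 2))"
        using mom[OF k] mom[OF l] by (simp add: prob_space)
      also have "\<dots> = A - ((1 + \<eta>') * (r\<^sup>2 / ?R) powr (d / 2) - \<kappa> * (r\<^sup>2 / ?R) powr (q / 2))"
        unfolding pw[OF less_imp_le[OF r]] \<eta>'_def \<kappa>_def by (simp add: mult_ac)
      also have "\<dots> \<le> lyap A d T r t - \<eta> * \<epsilon> powr (d / 2)"
      proof -
        define y where "y = r\<^sup>2 / ?R"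
        have y: "0 < y" "y \<le> s1" using r R True by (auto simp: y_def pos_divide_le_eq)
        have "\<epsilon> \<le> y" using al R by (simp add: alive_def y_def pos_le_divide_eq)
        then have e: "\<epsilon> powr (d / 2) \<le> y powr (d / 2)" using \<epsilon> d by (intro powr_mono2) auto
        have ly: "lyap A d T r t = A - y powr (d / 2)"
        proof (cases "?R \<le> r\<^sup>2")
          case True
          then have "1 \<le> y" using R by (simp add: y_def)
          then have "y = 1" using y s1 by linarith
          then show ?thesis using True by (simp add: lyap_def)
        qed (simp add: lyap_def y_def)
        have "2 * \<eta> * y powr (d / 2) \<le> \<eta>' * y powr (d / 2)" using \<eta> by (intro mult_right_mono) auto
        moreover have "\<eta> * \<epsilon> powr (d / 2) \<le> \<eta> * y powr (d / 2)" using e \<eta> by (intro mult_left_mono) auto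
        ultimately show ?thesis using small[OF y] unfolding ly y_def[symmetric] distrib_right mult_1_left by linarith
      qed
      finally show ?thesis by (simp add: ennreal_leI)
    next
      case False
      \<comment> \<open>\<open>K\<close> exceeds the remaining time, so a step longer than
        \<open>K\<close> ends beyond \<open>T\<close> in a state that is not alive. Only the
        complementary event contributes, with \<open>V\<close> at most \<open>A\<close>.\<close>
      define K where "K = r\<^sup>2 / s1"
      have K: "0 < K" "?R \<le> K" using False r s1 by (auto simp: K_def pos_le_divide_eq mult.commute)
      have "p0 = exp (- ((pi / (r * sin h))\<^sup>2 * K / 2))"
        unfolding p0_def K_def using r s1 sh by (simp add: power_divide power_mult_distrib)
      also have "\<dots> \<le> prob {\<omega> \<in> space M. K < \<tau> \<omega>}" unfolding \<tau>_def by (rule exit_time_tail[OF W h r K(1)])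
      finally have tail: "p0 \<le> prob {\<omega> \<in> space M. K < \<tau> \<omega>}" .
      let ?E = "{\<omega> \<in> space M. K < \<tau> \<omega>}"
      have E: "?E \<in> events" by measurable
      have "(\<integral>\<^sup>+\<omega>. ?F \<omega> \<partial>M) \<le> (\<integral>\<^sup>+\<omega>. ennreal A * indicator (space M - ?E) \<omega> \<partial>M)"
      proof (rule nn_integral_mono)
        fix \<omega> assume \<omega>: "\<omega> \<in> space M"
        show "?F \<omega> \<le> ennreal A * indicator (space M - ?E) \<omega>"
        proof (cases "K < \<tau> \<omega>")
          case True
          then have "T < t + \<tau> \<omega>" using K by linarith
          then show ?thesis by (simp add: alive_def)
        next
          case False
          then show ?thesis using \<omega> lyap_bounds(2)[OF d(1), of A T "\<rho> \<omega>" "t + \<tau> \<omega>"]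
            by (auto split: split_indicator intro: ennreal_leI)
        qed
      qed
      also have "\<dots> = ennreal A * emeasure M (space M - ?E)" using E by (intro nn_integral_cmult_indicator) auto
      also have "\<dots> = ennreal (A * (1 - prob ?E))"
        using E A by (simp add: emeasure_eq_measure prob_compl ennreal_mult')
      also have "\<dots> \<le> ennreal (lyap A d T r t - \<eta> * \<epsilon> powr (d / 2))"
      proof (rule ennreal_leI)
        have "A * (1 - prob ?E) \<le> A * (1 - p0)" using tail A by (intro mult_left_mono) auto
        also have "\<dots> = A - 2" using p0 by (simp add: A_def field_simps)
        finally have "A * (1 - prob ?E) \<le> A - 2" .
        moreover have "\<eta> * \<epsilon> powr (d / 2) \<le> 1 * 1" using \<eta> \<epsilon> d by (intro mult_mono powr_le1) auto
        ultimately show "A * (1 - prob ?E) \<le> lyap A d T r t - \<eta> * \<epsilon> powr (d / 2)"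
          using lyap_bounds(1)[OF d(1), of A T r t] by linarith
      qed
      finally show ?thesis .
    qed
    have "lyap A d T r t - \<eta> * \<epsilon> powr (d / 2) \<le> (1 - \<eta> * \<epsilon> powr (d / 2) / A) * lyap A d T r t"
    proof -
      have "\<eta> * \<epsilon> powr (d / 2) / A * lyap A d T r t \<le> \<eta> * \<epsilon> powr (d / 2) / A * A"
        using \<eta> A lyap_bounds(2)[OF d(1)] by (intro mult_left_mono) auto
      then show ?thesis using A by (simp add: left_diff_distrib)
    qed
    then have "ennreal (lyap A d T r t - \<eta> * \<epsilon> powr (d / 2)) \<le> ennreal ((1 - \<eta> * \<epsilon> powr (d / 2) / A) * lyap A d T r t)"
      by (rule ennreal_leI)
    with main show "(\<integral>\<^sup>+\<omega>. lyap_next h A d T \<epsilon> \<theta> r t (\<lambda>u. W u \<omega>) \<partial>M) \<le> ennreal ((1 - \<eta> * \<epsilon> powr (d / 2) / A) * lyap A d T r t)"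
      unfolding lyap_next_def Let_def \<rho>_def \<tau>_def by (rule order_trans)
  qed
qed

section \<open>Freezing and the Markov chain of the algorithm\<close>

text \<open>Independence lets the diagonal integral be computed by freezing the first argument; the
  measurability is only needed for the two sub-\<open>\<sigma>\<close>-algebras, which avoids measurability on path space.\<close>

lemma (in prob_space) nn_integral_indep_diagonal:
  assumes A: "subalgebra M A" and B: "subalgebra M B" and AB: "indep_set (sets A) (sets B)"
    and f: "f \<in> borel_measurable (A \<Otimes>\<^sub>M B)"
  shows "(\<integral>\<^sup>+\<omega>. f (\<omega>, \<omega>) \<partial>M) = (\<integral>\<^sup>+\<omega>'. \<integral>\<^sup>+\<omega>. f (\<omega>', \<omega>) \<partial>M \<partial>M)"
proof -
  let ?A = "restr_to_subalg M A" and ?B = "restr_to_subalg M B"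
  have sets: "sets ?A = sets A" "sets ?B = sets B" using A B by (simp_all add: sets_restr_to_subalg)
  have sp: "space A = space M" "space B = space M" using A B by (simp_all add: subalgebra_def)
  have sub: "sets A \<subseteq> sets M" "sets B \<subseteq> sets M" using A B by (simp_all add: subalgebra_def)
  interpret A: prob_space ?A by (rule prob_space_restr_to_subalg[OF A prob_space_axioms])
  interpret B: prob_space ?B by (rule prob_space_restr_to_subalg[OF B prob_space_axioms])
  have f': "f \<in> borel_measurable (?A \<Otimes>\<^sub>M ?B)"
    using f by (subst measurable_cong_sets[OF sets_pair_measure_cong[OF sets] refl])
  have D: "(\<lambda>\<omega>. (\<omega>, \<omega>)) \<in> measurable M (?A \<Otimes>\<^sub>M ?B)"
  proof -
    have "(\<lambda>\<omega>. \<omega>) \<in> measurable M A" "(\<lambda>\<omega>. \<omega>) \<in> measurable M B"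
      by (rule measurable_from_subalg[OF A measurable_ident_sets], rule refl,
          rule measurable_from_subalg[OF B measurable_ident_sets], rule refl)
    then show ?thesis
      by (intro measurable_Pair) (simp_all cong: measurable_cong_sets add: sets)
  qed
  \<comment> \<open>Independence says exactly that the diagonal map carries \<open>M\<close> to the
    product of its restrictions.\<close>
  have eq: "?A \<Otimes>\<^sub>M ?B = distr M (?A \<Otimes>\<^sub>M ?B) (\<lambda>\<omega>. (\<omega>, \<omega>))"
  proof (rule pair_measure_eqI)
    show "sigma_finite_measure ?A" "sigma_finite_measure ?B" by unfold_locales
    fix X Y assume X: "X \<in> sets ?A" and Y: "Y \<in> sets ?B"
    have XY: "X \<in> sets A" "Y \<in> sets B" using X Y sets by auto
    have "emeasure (distr M (?A \<Otimes>\<^sub>M ?B) (\<lambda>\<omega>. (\<omega>, \<omega>))) (X \<times> Y) = emeasure M ((\<lambda>\<omega>. (\<omega>, \<omega>)) -` (X \<times> Y) \<inter> space M)"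
      using X Y by (intro emeasure_distr D) auto
    also have "(\<lambda>\<omega>. (\<omega>, \<omega>)) -` (X \<times> Y) \<inter> space M = X \<inter> Y" using sets.sets_into_space[OF XY(1)] sp by auto
    also have "emeasure M (X \<inter> Y) = emeasure M X * emeasure M Y"
      using indep_setD[OF AB XY] by (simp add: emeasure_eq_measure ennreal_mult')
    also have "\<dots> = emeasure ?A X * emeasure ?B Y"
      using XY by (simp add: emeasure_restr_to_subalg[OF A] emeasure_restr_to_subalg[OF B])
    finally show "emeasure ?A X * emeasure ?B Y = emeasure (distr M (?A \<Otimes>\<^sub>M ?B) (\<lambda>\<omega>. (\<omega>, \<omega>))) (X \<times> Y)" ..
  qed simp
  have "(\<integral>\<^sup>+\<omega>. f (\<omega>, \<omega>) \<partial>M) = (\<integral>\<^sup>+x. f x \<partial>distr M (?A \<Otimes>\<^sub>M ?B) (\<lambda>\<omega>. (\<omega>, \<omega>)))"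
    by (rule nn_integral_distr[OF D, symmetric]) (simp add: f')
  also have "\<dots> = (\<integral>\<^sup>+x. f x \<partial>(?A \<Otimes>\<^sub>M ?B))" using eq by simp
  also have "\<dots> = (\<integral>\<^sup>+\<omega>'. \<integral>\<^sup>+\<omega>. f (\<omega>', \<omega>) \<partial>?B \<partial>?A)" by (rule B.nn_integral_fst[OF f', symmetric])
  also have "\<dots> = (\<integral>\<^sup>+\<omega>'. \<integral>\<^sup>+\<omega>. f (\<omega>', \<omega>) \<partial>?B \<partial>M)"
  proof (rule nn_integral_subalgebra2[OF A])
    have "(\<lambda>\<omega>'. \<integral>\<^sup>+\<omega>. f (\<omega>', \<omega>) \<partial>?B) \<in> borel_measurable ?A" using f' by measurable
    then show "(\<lambda>\<omega>'. \<integral>\<^sup>+\<omega>. f (\<omega>', \<omega>) \<partial>?B) \<in> borel_measurable A"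
      by (subst measurable_cong_sets[OF sets(1)[symmetric] refl])
  qed
  also have "\<dots> = (\<integral>\<^sup>+\<omega>'. \<integral>\<^sup>+\<omega>. f (\<omega>', \<omega>) \<partial>M \<partial>M)"
  proof (rule nn_integral_cong)
    fix \<omega>' assume "\<omega>' \<in> space M"
    then have "(\<lambda>\<omega>. f (\<omega>', \<omega>)) \<in> borel_measurable B"
      using measurable_compose[OF measurable_Pair1'[of \<omega>' A B] f] sp by simp
    then show "(\<integral>\<^sup>+\<omega>. f (\<omega>', \<omega>) \<partial>?B) = (\<integral>\<^sup>+\<omega>. f (\<omega>', \<omega>) \<partial>M)" by (rule nn_integral_subalgebra2[OF B])
  qed
  finally show ?thesis .
qed

section \<open>A measurable version of the recursion\<close>

definition exit_side :: "real \<Rightarrow> real \<Rightarrow> complex \<Rightarrow> real" where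
  "exit_side h \<theta> p = (if p = rcis (cmod p) (\<theta> - h) then \<theta> - h else \<theta> + h)"

text \<open>The algorithm driven by the increments \<open>w n\<close>. It differs from \<open>alg_angle\<close>, \<open>alg_radius\<close> and \<open>alg_time\<close> only on
  trajectories that never leave their wedge: there \<open>hitting_time\<close> is the junk value
  \<open>Inf {}\<close>, which may be negative, so the original recursion need not be measurable.\<close>

fun chain :: "real \<Rightarrow> complex \<Rightarrow> (nat \<Rightarrow> real \<Rightarrow> complex) \<Rightarrow> nat \<Rightarrow> real \<times> real \<times> real" where
  "chain \<alpha> x0 w 0 = (Arg2pi x0, cmod x0, 0)"
| "chain \<alpha> x0 w (Suc n) = (case chain \<alpha> x0 w n of (\<theta>, r, t) \<Rightarrow>
     (reflect_angle \<alpha> (exit_side (Theta \<alpha> / 2) \<theta> (wedge_exit_point (Theta \<alpha> / 2) \<theta> r (w n))),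
      cmod (wedge_exit_point (Theta \<alpha> / 2) \<theta> r (w n)),
      t + wedge_exit_time (Theta \<alpha> / 2) \<theta> r (w n)))"

definition angle_of :: "real \<times> real \<times> real \<Rightarrow> real" where "angle_of s = fst s"
definition radius_of :: "real \<times> real \<times> real \<Rightarrow> real" where "radius_of s = fst (snd s)"
definition time_of :: "real \<times> real \<times> real \<Rightarrow> real" where "time_of s = snd (snd s)"

lemma chain_Suc:
  "angle_of (chain \<alpha> x0 w (Suc n)) = reflect_angle \<alpha> (exit_side (Theta \<alpha> / 2) (angle_of (chain \<alpha> x0 w n))
      (wedge_exit_point (Theta \<alpha> / 2) (angle_of (chain \<alpha> x0 w n)) (radius_of (chain \<alpha> x0 w n)) (w n)))"
  "radius_of (chain \<alpha> x0 w (Suc n)) =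
      cmod (wedge_exit_point (Theta \<alpha> / 2) (angle_of (chain \<alpha> x0 w n)) (radius_of (chain \<alpha> x0 w n)) (w n))"
  "time_of (chain \<alpha> x0 w (Suc n)) = time_of (chain \<alpha> x0 w n) +
      wedge_exit_time (Theta \<alpha> / 2) (angle_of (chain \<alpha> x0 w n)) (radius_of (chain \<alpha> x0 w n)) (w n)"
  by (simp_all add: angle_of_def radius_of_def time_of_def split: prod.split)

declare chain.simps(2) [simp del]

definition leaves_wedge :: "real \<Rightarrow> real \<Rightarrow> real \<Rightarrow> (real \<Rightarrow> complex) \<Rightarrow> bool" where
  "leaves_wedge h \<theta> r w \<longleftrightarrow> (\<exists>u\<ge>0. w u \<in> rotated_frontier h \<theta> r)"

definition alg_state :: "real \<Rightarrow> complex \<Rightarrow> (nat \<Rightarrow> real \<Rightarrow> complex) \<Rightarrow> nat \<Rightarrow> real \<times> real \<times> real" where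
  "alg_state \<alpha> x0 \<zeta> n = (alg_angle \<alpha> x0 \<zeta> n, alg_radius \<alpha> x0 \<zeta> n, alg_time \<alpha> x0 \<zeta> n)"

text \<open>On a path that does leave its wedge the hitting time is attained and nonnegative, so
  \<open>max 0\<close> changes nothing and the two recursions agree step by step. Leaving is assumed
  along \<open>chain\<close>, for which it can be shown almost surely.\<close>

lemma chain_eq_alg:
  fixes \<zeta> :: "nat \<Rightarrow> real \<Rightarrow> complex" and \<alpha> :: real and x0 :: complex
  defines "w \<equiv> \<lambda>n t. \<zeta> (Suc n) t - alg_position \<alpha> x0 \<zeta> n"
  assumes cont: "\<And>n. continuous_on {0..} (w n)"
    and leaves: "\<And>n. leaves_wedge (Theta \<alpha> / 2) (angle_of (chain \<alpha> x0 w n)) (radius_of (chain \<alpha> x0 w n)) (w n)"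
  shows "chain \<alpha> x0 w n = alg_state \<alpha> x0 \<zeta> n"
proof (induction n)
  case (Suc n)
  let ?h = "Theta \<alpha> / 2" and ?\<theta> = "alg_angle \<alpha> x0 \<zeta> n" and ?r = "alg_radius \<alpha> x0 \<zeta> n"
  have st: "angle_of (chain \<alpha> x0 w n) = ?\<theta>" "radius_of (chain \<alpha> x0 w n) = ?r" "time_of (chain \<alpha> x0 w n) = alg_time \<alpha> x0 \<zeta> n"
    by (simp_all add: Suc alg_state_def angle_of_def radius_of_def time_of_def)
  obtain u where u: "0 \<le> u" "w n u \<in> rotated_frontier ?h ?\<theta> ?r"
    using leaves[of n] unfolding st leaves_wedge_def by blast
  have z: "(\<lambda>t. rcis ?r ?\<theta> + w n t) = \<zeta> (Suc n)" by (auto simp: w_def alg_position_def)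
  have "0 \<le> hitting_time (rotated_frontier ?h ?\<theta> ?r) (w n)"
    by (rule hitting_time_attained(1)[OF cont closed_rotated_frontier u])
  moreover have "hitting_time (rotated_frontier ?h ?\<theta> ?r) (w n) = exit_time \<alpha> ?\<theta> (\<zeta> (Suc n))"
    unfolding exit_time_def hitting_time_def mem_rotated_frontier[symmetric] z[symmetric] ..
  ultimately have t: "wedge_exit_time ?h ?\<theta> ?r (w n) = exit_time \<alpha> ?\<theta> (\<zeta> (Suc n))"
    by (simp add: wedge_exit_time_rotated)
  then have p: "wedge_exit_point ?h ?\<theta> ?r (w n) = exit_point \<alpha> ?\<theta> (\<zeta> (Suc n))"
    unfolding wedge_exit_point_def exit_point_def z[symmetric] by simp
  have "exit_side ?h ?\<theta> (exit_point \<alpha> ?\<theta> (\<zeta> (Suc n))) = exit_angle \<alpha> ?\<theta> (\<zeta> (Suc n))"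
    by (simp add: exit_side_def exit_angle_def Let_def)
  then have "angle_of (chain \<alpha> x0 w (Suc n)) = alg_angle \<alpha> x0 \<zeta> (Suc n)"
    "radius_of (chain \<alpha> x0 w (Suc n)) = alg_radius \<alpha> x0 \<zeta> (Suc n)"
    "time_of (chain \<alpha> x0 w (Suc n)) = alg_time \<alpha> x0 \<zeta> (Suc n)"
    unfolding chain_Suc st t p by simp_all
  then show ?case unfolding alg_state_def angle_of_def radius_of_def time_of_def by (metis prod.collapse)
qed (simp add: alg_state_def)

text \<open>Angle and radius vary with the sample point, so the target would move with it. Rotating
  the path instead fixes the target as the frontier of \<open>wedge (- h) h\<close>.\<close>

lemma wedge_exit_measurable:
  fixes V :: "real \<Rightarrow> 'b \<Rightarrow> complex"
  assumes \<theta> [measurable]: "\<theta> \<in> borel_measurable N" and r [measurable]: "r \<in> borel_measurable N"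
    and V: "\<And>u. 0 \<le> u \<Longrightarrow> V u \<in> borel_measurable N"
    and cont: "\<And>x. x \<in> space N \<Longrightarrow> continuous_on {0..} (\<lambda>u. V u x)"
  shows "(\<lambda>x. wedge_exit_time h (\<theta> x) (r x) (\<lambda>u. V u x)) \<in> borel_measurable N" (is "?\<tau> \<in> _")
    and "(\<lambda>x. wedge_exit_point h (\<theta> x) (r x) (\<lambda>u. V u x)) \<in> borel_measurable N"
    and "{x \<in> space N. leaves_wedge h (\<theta> x) (r x) (\<lambda>u. V u x)} \<in> sets N"
proof -
  have cis_m [measurable]: "cis \<in> borel_measurable borel"
    by (intro borel_measurable_continuous_onI continuous_intros)
  define Y where "Y = (\<lambda>u x. of_real (r x) + cis (- \<theta> x) * V u x)"
  have Y: "Y u \<in> borel_measurable N" if "0 \<le> u" for u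
    using V[OF that] unfolding Y_def by measurable
  have Yc: "continuous_on {0..} (\<lambda>u. Y u x)" if "x \<in> space N" for x
    unfolding Y_def by (intro continuous_intros cont that)
  have e: "hitting_time (rotated_frontier h (\<theta> x) (r x)) (\<lambda>u. V u x) = hitting_time (frontier (wedge (- h) h)) (\<lambda>u. Y u x)" for x
    by (simp add: hitting_time_def rotated_frontier_def Y_def)
  have [measurable]: "(\<lambda>x. hitting_time (frontier (wedge (- h) h)) (\<lambda>u. Y u x)) \<in> borel_measurable N"
    by (rule borel_measurable_hitting_time[OF Y Yc]) auto
  show \<tau> [measurable]: "?\<tau> \<in> borel_measurable N" unfolding wedge_exit_time_rotated e by measurable
  have [measurable]: "(\<lambda>x. V (?\<tau> x) x) \<in> borel_measurable N"
    by (rule borel_measurable_at_random_time[OF V cont \<tau>]) (auto simp: wedge_exit_time_def)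
  show "(\<lambda>x. wedge_exit_point h (\<theta> x) (r x) (\<lambda>u. V u x)) \<in> borel_measurable N"
    unfolding wedge_exit_point_def rcis_def by measurable
  have "{x \<in> space N. \<exists>u\<ge>0. Y u x \<in> frontier (wedge (- h) h)} \<in> sets N"
    by (rule sets_hit[OF Y Yc]) auto
  then show "{x \<in> space N. leaves_wedge h (\<theta> x) (r x) (\<lambda>u. V u x)} \<in> sets N"
    by (simp add: leaves_wedge_def rotated_frontier_def Y_def)
qed

lemma chain_measurable:
  assumes V: "\<And>k u. k < n \<Longrightarrow> 0 \<le> u \<Longrightarrow> V k u \<in> borel_measurable N"
    and cont: "\<And>k \<omega>. \<omega> \<in> space N \<Longrightarrow> continuous_on {0..} (\<lambda>u. V k u \<omega>)"
  shows "(\<lambda>\<omega>. angle_of (chain \<alpha> x0 (\<lambda>k u. V k u \<omega>) n)) \<in> borel_measurable N \<and>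
    (\<lambda>\<omega>. radius_of (chain \<alpha> x0 (\<lambda>k u. V k u \<omega>) n)) \<in> borel_measurable N \<and>
    (\<lambda>\<omega>. time_of (chain \<alpha> x0 (\<lambda>k u. V k u \<omega>) n)) \<in> borel_measurable N"
  using V
proof (induction n)
  case 0
  then show ?case by (simp add: angle_of_def radius_of_def time_of_def)
next
  case (Suc n)
  then have IH [measurable]: "(\<lambda>\<omega>. angle_of (chain \<alpha> x0 (\<lambda>k u. V k u \<omega>) n)) \<in> borel_measurable N"
    "(\<lambda>\<omega>. radius_of (chain \<alpha> x0 (\<lambda>k u. V k u \<omega>) n)) \<in> borel_measurable N"
    "(\<lambda>\<omega>. time_of (chain \<alpha> x0 (\<lambda>k u. V k u \<omega>) n)) \<in> borel_measurable N" by auto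
  note [measurable] = wedge_exit_measurable(1,2)[OF IH(1,2) Suc.prems[of n] cont, simplified]
  have cis_m [measurable]: "cis \<in> borel_measurable borel"
    by (intro borel_measurable_continuous_onI continuous_intros)
  show ?case unfolding chain_Suc reflect_angle_def exit_side_def rcis_def by measurable
qed

section \<open>The number of iterations\<close>

text \<open>Bounds the power by the square and expands \<open>(j + 1)^2\<close> as 1 plus the sum of
  \<open>2 * n + 3\<close> over \<open>n < j\<close>, a tail-sum formula for the second moment. The
  weights \<open>p n\<close> will be indicators of being alive through step \<open>n\<close>. An
  infinite \<open>N\<close> exceeds every finite \<open>k\<close>, so the same bound makes the right
  side infinite.\<close>

lemma enat_powr_le_suminf:
  assumes a: "1 \<le> a" "a \<le> 2" and P: "\<And>n. enat (Suc n) < N \<Longrightarrow> 1 \<le> p n"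
  shows "enat_powr N a \<le> 1 + (\<Sum>n. ennreal (real (2 * n + 3)) * p n)"
proof -
  let ?S = "\<Sum>n. ennreal (real (2 * n + 3)) * p n"
  have *: "ennreal ((real k)\<^sup>2) \<le> 1 + ?S" if k: "enat k \<le> N" for k
  proof (cases k)
    case (Suc j)
    have sq: "(real (Suc j))\<^sup>2 = 1 + (\<Sum>n<j. real (2 * n + 3))" for j
      by (induction j) (simp_all add: power2_eq_square algebra_simps)
    have "ennreal ((real k)\<^sup>2) = 1 + (\<Sum>n<j. ennreal (real (2 * n + 3)))"
      unfolding Suc sq sum_ennreal[OF of_nat_0_le_iff] by (subst ennreal_plus) (simp_all add: sum_nonneg)
    also have "(\<Sum>n<j. ennreal (real (2 * n + 3))) \<le> (\<Sum>n<j. ennreal (real (2 * n + 3)) * p n)"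
    proof (rule sum_mono)
      fix n assume "n \<in> {..<j}"
      then have "enat (Suc n) < N" using k Suc by (auto intro: less_le_trans[of _ "enat k"])
      then have "ennreal (real (2 * n + 3)) * 1 \<le> ennreal (real (2 * n + 3)) * p n"
        by (intro mult_left_mono P) auto
      then show "ennreal (real (2 * n + 3)) \<le> ennreal (real (2 * n + 3)) * p n" by simp
    qed
    also have "\<dots> \<le> ?S" by (rule sum_le_suminf) auto
    finally show ?thesis by (simp add: add_left_mono)
  qed simp
  show ?thesis
  proof (cases N)
    case (enat k)
    have "real k powr a \<le> (real k)\<^sup>2"
    proof (cases "k = 0")
      case False
      then have "real k powr a \<le> real k powr 2" using a by (intro powr_mono) auto
      then show ?thesis by simp
    qed simp
    then have "enat_powr N a \<le> ennreal ((real k)\<^sup>2)" by (simp add: enat_powr_def enat ennreal_leI)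
    also have "\<dots> \<le> 1 + ?S" by (rule *) (simp add: enat)
    finally show ?thesis .
  next
    case infinity
    have "of_nat k \<le> 1 + ?S" for k
    proof -
      have "real k \<le> (real k)\<^sup>2" using mult_right_mono[of 1 "real k" "real k"] by (cases k) (auto simp: power2_eq_square)
      then have "(of_nat k :: ennreal) \<le> ennreal ((real k)\<^sup>2)"
        unfolding ennreal_of_nat_eq_real_of_nat by (rule ennreal_leI)
      then show ?thesis by (rule order_trans[OF _ *]) (simp add: infinity)
    qed
    then have "(SUP k. of_nat k :: ennreal) \<le> 1 + ?S" by (intro SUP_least)
    then show ?thesis by (simp add: ennreal_SUP_of_nat_eq_top top_unique)
  qed
qed

text \<open>A cutoff at step \<open>L\<close> counts \<open>L + 1\<close> iterations, so
  \<open>Suc n < N\<close> gives \<open>n < L\<close>, with no cutoff and no overrun up to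
  \<open>n\<close>. Without any cutoff, \<open>N\<close> is the first index beyond \<open>T\<close>,
  which again lies after \<open>n\<close>.\<close>

lemma alive_before_num_iterations:
  assumes N: "enat (Suc n) < num_iterations \<alpha> T \<epsilon> x0 \<zeta>" and k: "k \<le> n"
    and r: "0 < alg_radius \<alpha> x0 \<zeta> k"
  shows "alive T \<epsilon> (alg_radius \<alpha> x0 \<zeta> k) (alg_time \<alpha> x0 \<zeta> k)"
proof -
  have *: "(\<forall>j\<le>n. alg_time \<alpha> x0 \<zeta> j \<le> T) \<and> \<not> alg_cutoff \<alpha> T \<epsilon> x0 \<zeta> k"
  proof (cases "\<exists>n. alg_cutoff \<alpha> T \<epsilon> x0 \<zeta> n")
    case True
    define L where "L = (LEAST n. alg_cutoff \<alpha> T \<epsilon> x0 \<zeta> n)"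
    have L: "alg_cutoff \<alpha> T \<epsilon> x0 \<zeta> L" using True unfolding L_def by (rule LeastI_ex)
    have "n < L" using N True by (simp add: num_iterations_def L_def)
    moreover have "\<not> alg_cutoff \<alpha> T \<epsilon> x0 \<zeta> k" using \<open>n < L\<close> k unfolding L_def by (intro not_less_Least) simp
    ultimately show ?thesis using L by (auto simp: alg_cutoff_def)
  next
    case False
    have "alg_time \<alpha> x0 \<zeta> j \<le> T" if "j \<le> n" for j
    proof (rule ccontr)
      assume "\<not> ?thesis"
      then have "Inf (enat ` {n. alg_time \<alpha> x0 \<zeta> n > T}) \<le> enat j" by (intro Inf_lower) auto
      also have "\<dots> < enat (Suc n)" using that by simp
      finally show False using N False by (simp add: num_iterations_def)
    qed
    then show ?thesis using False by blast
  qed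
  then have t: "\<forall>j\<le>k. alg_time \<alpha> x0 \<zeta> j \<le> T" using k by auto
  then have "\<epsilon> * (T - alg_time \<alpha> x0 \<zeta> k) \<le> (alg_radius \<alpha> x0 \<zeta> k)\<^sup>2" if "alg_time \<alpha> x0 \<zeta> k < T"
    using * that by (auto simp: alg_cutoff_def not_less pos_le_divide_eq)
  then show ?thesis using t r by (auto simp: alive_def)
qed

section \<open>A random run: filtration, almost sure agreement with the chain, geometric
  decay\<close>

locale run =
  fixes M :: "'a measure" and \<alpha> :: real and x0 :: complex and Z :: "nat \<Rightarrow> real \<Rightarrow> 'a \<Rightarrow> complex"
  assumes run: "algorithm_run M \<alpha> x0 Z" and \<alpha>: "0 < \<alpha>" and x0: "x0 \<noteq> 0"
begin

definition W :: "nat \<Rightarrow> real \<Rightarrow> 'a \<Rightarrow> complex" where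
  "W n t \<omega> = Z (Suc n) t \<omega> - alg_position \<alpha> x0 (\<lambda>k s. Z k s \<omega>) n"

lemma W: "planar_brownian_motion M (W n)"
  using run by (simp add: algorithm_run_def Let_def W_def[abs_def])

sublocale prob_space M by (rule planar_prob_space[OF W])

definition earlier :: "nat \<Rightarrow> 'a measure" where
  "earlier n = path_algebra M ({1..n} \<times> {0..}) (\<lambda>i. Z (fst i) (snd i))"

definition current :: "nat \<Rightarrow> 'a measure" where
  "current n = path_algebra M {0..} (W n)"

lemma space_earlier [simp]: "space (earlier n) = space M" and space_current [simp]: "space (current n) = space M"
  by (simp_all add: earlier_def current_def)

lemma indep_earlier_current: "indep_set (sets (earlier n)) (sets (current n))"
  unfolding earlier_def current_def
  using run by (intro indep_rv_imp_indep_vimage) (simp add: algorithm_run_def Let_def W_def[abs_def])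

lemma subalgebras: "subalgebra M (earlier n)" "subalgebra M (current n)"
  using indep_earlier_current[of n] by (auto simp: indep_sets2_eq subalgebra_def)

text \<open>As \<open>W k\<close> starts at 0, it equals \<open>Z (Suc k) u - Z (Suc k) 0\<close>.
  Subtracting the initial value avoids the position of the original recursion, whose measurability
  is doubtful.\<close>

lemma W_earlier:
  assumes "k < n" "0 \<le> u"
  shows "W k u \<in> borel_measurable (earlier n)"
proof -
  have Zm: "Z (Suc k) v \<in> borel_measurable (earlier n)" if "0 \<le> v" for v
    using path_algebra_component[of "(Suc k, v)" "{1..n} \<times> {0..}" "\<lambda>i. Z (fst i) (snd i)" M] assms that
    by (simp add: earlier_def)
  have "W k u \<omega> = Z (Suc k) u \<omega> - Z (Suc k) 0 \<omega>" if "\<omega> \<in> space M" for \<omega>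
    using planar_0[OF W that, of k] by (simp add: W_def)
  then show ?thesis using Zm[OF assms(2)] Zm[of 0]
    by (subst measurable_cong[where g="\<lambda>\<omega>. Z (Suc k) u \<omega> - Z (Suc k) 0 \<omega>"]) auto
qed

lemma W_current: "0 \<le> u \<Longrightarrow> W n u \<in> borel_measurable (current n)"
  unfolding current_def by (rule path_algebra_component) simp

definition ang :: "nat \<Rightarrow> 'a \<Rightarrow> real" where "ang n \<omega> = angle_of (chain \<alpha> x0 (\<lambda>k u. W k u \<omega>) n)"
definition rad :: "nat \<Rightarrow> 'a \<Rightarrow> real" where "rad n \<omega> = radius_of (chain \<alpha> x0 (\<lambda>k u. W k u \<omega>) n)"
definition tim :: "nat \<Rightarrow> 'a \<Rightarrow> real" where "tim n \<omega> = time_of (chain \<alpha> x0 (\<lambda>k u. W k u \<omega>) n)"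

abbreviation (input) "h \<equiv> Theta \<alpha> / 2"

lemma h: "0 < h" "h \<le> pi / 2"
proof -
  obtain k :: nat where "Theta \<alpha> = pi / real k" "1 \<le> k" using Theta_is_max(1)[OF \<alpha>] by auto
  moreover from this have "0 < pi / real k" "pi / real k \<le> pi" by (simp_all add: pos_divide_le_eq)
  ultimately show "0 < h" "h \<le> pi / 2" by simp_all
qed

lemma state_measurable:
  assumes "k \<le> n"
  shows "ang k \<in> borel_measurable (earlier n)" "rad k \<in> borel_measurable (earlier n)" "tim k \<in> borel_measurable (earlier n)"
proof -
  have "continuous_on {0..} (\<lambda>u. W k u \<omega>)" if "\<omega> \<in> space (earlier n)" for k \<omega>
    using that by (intro planar_continuous[OF W]) simp
  from chain_measurable[OF W_earlier[OF less_le_trans[OF _ assms]] this, where n=k and \<alpha>=\<alpha> and ?x0.0=x0]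
  show "ang k \<in> borel_measurable (earlier n)" "rad k \<in> borel_measurable (earlier n)" "tim k \<in> borel_measurable (earlier n)"
    by (simp_all add: ang_def[abs_def] rad_def[abs_def] tim_def[abs_def])
qed

lemma state_0: "rad 0 \<omega> = cmod x0" "tim 0 \<omega> = 0"
  by (simp_all add: rad_def tim_def radius_of_def time_of_def)

lemma state_Suc:
  "rad (Suc n) \<omega> = cmod (wedge_exit_point h (ang n \<omega>) (rad n \<omega>) (\<lambda>u. W n u \<omega>))"
  "tim (Suc n) \<omega> = tim n \<omega> + wedge_exit_time h (ang n \<omega>) (rad n \<omega>) (\<lambda>u. W n u \<omega>)"
  unfolding rad_def tim_def ang_def chain_Suc by simp_all

abbreviation prod_algebra :: "nat \<Rightarrow> ('a \<times> 'a) measure" where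
  "prod_algebra n \<equiv> earlier n \<Otimes>\<^sub>M current n"

abbreviation (input) "frozen_time n x \<equiv> wedge_exit_time h (ang n (fst x)) (rad n (fst x)) (\<lambda>u. W n u (snd x))"
abbreviation (input) "frozen_point n x \<equiv> wedge_exit_point h (ang n (fst x)) (rad n (fst x)) (\<lambda>u. W n u (snd x))"
abbreviation (input) "frozen_leaves n x \<equiv> leaves_wedge h (ang n (fst x)) (rad n (fst x)) (\<lambda>u. W n u (snd x))"

lemma frozen_exit_measurable:
  shows "(\<lambda>x. frozen_time n x) \<in> borel_measurable (prod_algebra n)"
    and "(\<lambda>x. frozen_point n x) \<in> borel_measurable (prod_algebra n)"
    and "{x \<in> space (prod_algebra n). frozen_leaves n x} \<in> sets (prod_algebra n)"
proof -
  have 1: "(\<lambda>x. ang n (fst x)) \<in> borel_measurable (prod_algebra n)" "(\<lambda>x. rad n (fst x)) \<in> borel_measurable (prod_algebra n)"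
    by (rule measurable_compose[OF measurable_fst]; rule state_measurable; simp)+
  have 2: "(\<lambda>x. W n u (snd x)) \<in> borel_measurable (prod_algebra n)" if "0 \<le> u" for u
    by (rule measurable_compose[OF measurable_snd W_current[OF that]])
  have 3: "continuous_on {0..} (\<lambda>u. W n u (snd x))" if "x \<in> space (prod_algebra n)" for x
    using that by (intro planar_continuous[OF W]) (auto simp: space_pair_measure)
  note m = wedge_exit_measurable[where V="\<lambda>u x. W n u (snd x)", OF 1 2 3]
  show "(\<lambda>x. frozen_time n x) \<in> borel_measurable (prod_algebra n)" by (rule m(1))
  show "(\<lambda>x. frozen_point n x) \<in> borel_measurable (prod_algebra n)" by (rule m(2))
  show "{x \<in> space (prod_algebra n). frozen_leaves n x} \<in> sets (prod_algebra n)" by (rule m(3))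
qed

text \<open>With angle and radius frozen at any state of positive radius, the exit law of the wedge
  makes failure a null event; integrating over the earlier iterations transfers this to the actual
  state.\<close>

lemma AE_leaves_step:
  "AE \<omega> in M. 0 < rad n \<omega> \<longrightarrow> leaves_wedge h (ang n \<omega>) (rad n \<omega>) (\<lambda>u. W n u \<omega>) \<and> 0 < rad (Suc n) \<omega>"
proof -
  note [measurable] = frozen_exit_measurable[of n] measurable_compose[OF measurable_fst state_measurable(2)[of n n]]
  let ?p = "\<lambda>x. frozen_point n x"
  \<comment> \<open>The bad pairs: the first component supplies angle and radius, the second the
    path of the current iteration.\<close>
  define B where "B = {x \<in> space (prod_algebra n). 0 < rad n (fst x)} \<inter>
    (space (prod_algebra n) - ({x \<in> space (prod_algebra n). frozen_leaves n x}
      \<inter> {x \<in> space (prod_algebra n). 0 < cmod (?p x)}))"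
  have B: "B \<in> sets (prod_algebra n)" unfolding B_def by measurable
  have "(\<integral>\<^sup>+\<omega>. indicator B (\<omega>, \<omega>) \<partial>M) = (\<integral>\<^sup>+\<omega>'. \<integral>\<^sup>+\<omega>. indicator B (\<omega>', \<omega>) \<partial>M \<partial>M)"
    by (rule nn_integral_indep_diagonal[OF subalgebras[of n] indep_earlier_current]) (use B in simp)
  also have "\<dots> = (\<integral>\<^sup>+\<omega>'. 0 \<partial>M)"
  proof (rule nn_integral_cong)
    fix \<omega>' assume \<omega>': "\<omega>' \<in> space M"
    show "(\<integral>\<^sup>+\<omega>. indicator B (\<omega>', \<omega>) \<partial>M) = (0 :: ennreal)"
    proof (cases "0 < rad n \<omega>'")
      case True
      have "AE \<omega> in M. (\<omega>', \<omega>) \<notin> B"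
        using AE_hits_frontier[OF W[of n] h True, of "ang n \<omega>'"] AE_exit_nonzero[OF W[of n] h True, of "ang n \<omega>'"]
      proof eventually_elim
        case (elim \<omega>)
        have "leaves_wedge h (ang n \<omega>') (rad n \<omega>') (\<lambda>u. W n u \<omega>)" using elim(1) by (simp add: leaves_wedge_def)
        moreover have "0 < cmod (?p (\<omega>', \<omega>))" using elim(2) by (simp add: rotated_exit_point_def)
        ultimately show ?case by (auto simp: B_def)
      qed
      then have "AE \<omega> in M. indicator B (\<omega>', \<omega>) = (0 :: ennreal)" by eventually_elim simp
      then have "(\<integral>\<^sup>+\<omega>. indicator B (\<omega>', \<omega>) \<partial>M) = (\<integral>\<^sup>+\<omega>. 0 \<partial>M)" by (rule nn_integral_cong_AE)
      then show ?thesis by simp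
    next
      case False
      then have "indicator B (\<omega>', \<omega>) = (0 :: ennreal)" for \<omega> by (simp add: B_def)
      then show ?thesis by simp
    qed
  qed
  finally have 0: "(\<integral>\<^sup>+\<omega>. indicator B (\<omega>, \<omega>) \<partial>M) = 0" by simp
  have D: "(\<lambda>\<omega>. (\<omega>, \<omega>)) \<in> measurable M (prod_algebra n)"
    by (intro measurable_Pair; rule measurable_from_subalg[OF _ measurable_ident_sets], rule subalgebras, rule refl)
  have "(\<lambda>\<omega>. indicator B (\<omega>, \<omega>) :: ennreal) \<in> borel_measurable M"
    by (rule measurable_compose[OF D]) (use B in simp)
  from 0 nn_integral_0_iff_AE[OF this] have "AE \<omega> in M. indicator B (\<omega>, \<omega>) = (0 :: ennreal)" by simp
  then show ?thesis
  proof (rule AE_mp[OF _ AE_I2], intro impI)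
    fix \<omega> assume \<omega>: "\<omega> \<in> space M" "indicator B (\<omega>, \<omega>) = (0 :: ennreal)" "0 < rad n \<omega>"
    then have "(\<omega>, \<omega>) \<notin> B" by (auto split: split_indicator_asm)
    then show "leaves_wedge h (ang n \<omega>) (rad n \<omega>) (\<lambda>u. W n u \<omega>) \<and> 0 < rad (Suc n) \<omega>"
      using \<omega> unfolding B_def state_Suc by (simp add: space_pair_measure)
  qed
qed

lemma AE_good:
  "AE \<omega> in M. \<forall>n. 0 < rad n \<omega> \<and> chain \<alpha> x0 (\<lambda>k u. W k u \<omega>) n = alg_state \<alpha> x0 (\<lambda>k s. Z k s \<omega>) n"
proof -
  have "AE \<omega> in M. \<forall>n. 0 < rad n \<omega> \<longrightarrow> leaves_wedge h (ang n \<omega>) (rad n \<omega>) (\<lambda>u. W n u \<omega>) \<and> 0 < rad (Suc n) \<omega>"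
    using AE_leaves_step by (simp add: AE_all_countable)
  then show ?thesis
  proof (rule AE_mp[OF _ AE_I2], intro impI)
    fix \<omega> assume \<omega>: "\<omega> \<in> space M"
      and *: "\<forall>n. 0 < rad n \<omega> \<longrightarrow> leaves_wedge h (ang n \<omega>) (rad n \<omega>) (\<lambda>u. W n u \<omega>) \<and> 0 < rad (Suc n) \<omega>"
    have r: "0 < rad n \<omega>" for n by (induction n) (use * x0 in \<open>auto simp: state_0\<close>)
    have "chain \<alpha> x0 (\<lambda>k u. W k u \<omega>) n = alg_state \<alpha> x0 (\<lambda>k s. Z k s \<omega>) n" for n
      unfolding W_def
    proof (rule chain_eq_alg)
      show "continuous_on {0..} (\<lambda>t. Z (Suc n) t \<omega> - alg_position \<alpha> x0 (\<lambda>k s. Z k s \<omega>) n)" for n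
        using planar_continuous[OF W \<omega>, of n] by (simp add: W_def)
      show "leaves_wedge h (angle_of (chain \<alpha> x0 (\<lambda>n t. Z (Suc n) t \<omega> - alg_position \<alpha> x0 (\<lambda>k s. Z k s \<omega>) n) n))
          (radius_of (chain \<alpha> x0 (\<lambda>n t. Z (Suc n) t \<omega> - alg_position \<alpha> x0 (\<lambda>k s. Z k s \<omega>) n) n))
          (\<lambda>t. Z (Suc n) t \<omega> - alg_position \<alpha> x0 (\<lambda>k s. Z k s \<omega>) n)" for n
        using *[rule_format, OF r[of n]] by (simp add: W_def ang_def rad_def)
    qed
    with r show "\<forall>n. 0 < rad n \<omega> \<and> chain \<alpha> x0 (\<lambda>k u. W k u \<omega>) n = alg_state \<alpha> x0 (\<lambda>k s. Z k s \<omega>) n"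
      by blast
  qed
qed

definition alive_until :: "real \<Rightarrow> real \<Rightarrow> nat \<Rightarrow> 'a set" where
  "alive_until T \<epsilon> n = {\<omega> \<in> space M. \<forall>k\<le>n. alive T \<epsilon> (rad k \<omega>) (tim k \<omega>)}"

lemma alive_until_earlier: "alive_until T \<epsilon> n \<in> sets (earlier n)"
proof -
  have "{\<omega> \<in> space (earlier n). \<forall>k\<in>{..n}. alive T \<epsilon> (rad k \<omega>) (tim k \<omega>)} \<in> sets (earlier n)"
  proof (rule sets.sets_Collect_finite_All)
    fix k assume "k \<in> {..n}"
    then have [measurable]: "rad k \<in> borel_measurable (earlier n)" "tim k \<in> borel_measurable (earlier n)"
      using state_measurable[of k n] by auto
    show "{\<omega> \<in> space (earlier n). alive T \<epsilon> (rad k \<omega>) (tim k \<omega>)} \<in> sets (earlier n)"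
      unfolding alive_def by measurable
  qed simp
  then show ?thesis unfolding alive_until_def by (simp only: Ball_def atMost_iff space_earlier)
qed

lemma alive_until_events: "alive_until T \<epsilon> n \<in> events"
  using alive_until_earlier[of T \<epsilon> n] subalgebras(1)[of n] unfolding subalgebra_def by blast

lemma lyap_measurable: "(\<lambda>(r, t). lyap A d T r t) \<in> borel_measurable (borel \<Otimes>\<^sub>M borel)"
  unfolding lyap_def by measurable

lemma alive_measurable: "{(r, t). alive T \<epsilon> r t} \<in> sets (borel \<Otimes>\<^sub>M borel)"
proof -
  have "{x \<in> space (borel \<Otimes>\<^sub>M borel). alive T \<epsilon> (fst x) (snd x)} \<in> sets (borel \<Otimes>\<^sub>M borel)"
    unfolding alive_def by measurable
  then show ?thesis by (simp add: space_pair_measure case_prod_beta')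
qed

text \<open>\<open>V\<close>, set to 0 once the run is no longer alive, shrinks in mean by the
  factor \<open>1 - g\<close> per step; freezing the earlier iterations reduces this to the one-step
  drift. It starts at most at \<open>A\<close>, and it is at least 1 while alive because
  \<open>A \<ge> 2\<close>, so its mean dominates the survival probability.\<close>

lemma emeasure_alive_until:
  assumes d: "0 < d" and A: "2 \<le> A" and g: "0 \<le> g" "g \<le> 1"
    and drift: "\<And>n \<theta> r t. alive T \<epsilon> r t \<Longrightarrow>
      (\<integral>\<^sup>+\<omega>. lyap_next h A d T \<epsilon> \<theta> r t (\<lambda>u. W n u \<omega>) \<partial>M)
      \<le> ennreal ((1 - g) * lyap A d T r t)"
  shows "emeasure M (alive_until T \<epsilon> n) \<le> ennreal (A * (1 - g) ^ n)"
proof -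
  define L where "L = (\<lambda>n \<omega>. ennreal (lyap A d T (rad n \<omega>) (tim n \<omega>)) * indicator (alive_until T \<epsilon> n) \<omega>)"
  have "(\<integral>\<^sup>+\<omega>. L n \<omega> \<partial>M) \<le> ennreal (A * (1 - g) ^ n)"
  proof (induction n)
    case 0
    have "L 0 \<omega> \<le> ennreal A" for \<omega>
      using lyap_bounds(2)[OF d, of A T "rad 0 \<omega>" "tim 0 \<omega>"] by (auto simp: L_def ennreal_leI split: split_indicator)
    then have "(\<integral>\<^sup>+\<omega>. L 0 \<omega> \<partial>M) \<le> (\<integral>\<^sup>+\<omega>. ennreal A \<partial>M)" by (intro nn_integral_mono)
    then show ?case by (simp add: emeasure_space_1)
  next
    case (Suc n)
    let ?\<rho> = "\<lambda>x. cmod (frozen_point n x)"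
    let ?s = "\<lambda>x. tim n (fst x) + frozen_time n x"
    let ?v = "\<lambda>x. ennreal (lyap A d T (?\<rho> x) (?s x)) * indicator {(\<rho>, s). alive T \<epsilon> \<rho> s} (?\<rho> x, ?s x)"
    let ?f = "\<lambda>x. indicator (alive_until T \<epsilon> n) (fst x) * ?v x"
    have \<rho>s: "(\<lambda>x. (?\<rho> x, ?s x)) \<in> measurable (prod_algebra n) (borel \<Otimes>\<^sub>M borel)"
    proof -
      note [measurable] = frozen_exit_measurable[of n] measurable_compose[OF measurable_fst state_measurable(3)[of n n]]
      show ?thesis by measurable
    qed
    have f: "?f \<in> borel_measurable (prod_algebra n)"
    proof (intro borel_measurable_times_ennreal)
      show "(\<lambda>x. indicator (alive_until T \<epsilon> n) (fst x) :: ennreal) \<in> borel_measurable (prod_algebra n)"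
        by (rule measurable_compose[OF measurable_fst]) (use alive_until_earlier in simp)
      show "(\<lambda>x. ennreal (lyap A d T (?\<rho> x) (?s x))) \<in> borel_measurable (prod_algebra n)"
        using measurable_compose[OF \<rho>s lyap_measurable] by simp
      show "(\<lambda>x. indicator {(\<rho>, s). alive T \<epsilon> \<rho> s} (?\<rho> x, ?s x) :: ennreal) \<in> borel_measurable (prod_algebra n)"
        by (rule measurable_compose[OF \<rho>s]) (use alive_measurable in simp)
    qed
    have "L (Suc n) \<omega> \<le> ?f (\<omega>, \<omega>)" for \<omega>
    proof (cases "\<omega> \<in> alive_until T \<epsilon> (Suc n)")
      case True
      then have "\<omega> \<in> alive_until T \<epsilon> n" "alive T \<epsilon> (rad (Suc n) \<omega>) (tim (Suc n) \<omega>)"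
        by (auto simp: alive_until_def)
      then show ?thesis using True by (simp add: L_def state_Suc)
    qed (simp add: L_def)
    then have "(\<integral>\<^sup>+\<omega>. L (Suc n) \<omega> \<partial>M) \<le> (\<integral>\<^sup>+\<omega>. ?f (\<omega>, \<omega>) \<partial>M)" by (intro nn_integral_mono)
    also have "\<dots> = (\<integral>\<^sup>+\<omega>'. \<integral>\<^sup>+\<omega>. ?f (\<omega>', \<omega>) \<partial>M \<partial>M)"
      by (rule nn_integral_indep_diagonal[OF subalgebras[of n] indep_earlier_current f])
    also have "\<dots> \<le> (\<integral>\<^sup>+\<omega>'. ennreal (1 - g) * L n \<omega>' \<partial>M)"
    proof (rule nn_integral_mono)
      fix \<omega>' assume "\<omega>' \<in> space M"
      show "(\<integral>\<^sup>+\<omega>. ?f (\<omega>', \<omega>) \<partial>M) \<le> ennreal (1 - g) * L n \<omega>'"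
      proof (cases "\<omega>' \<in> alive_until T \<epsilon> n")
        case True
        then have "alive T \<epsilon> (rad n \<omega>') (tim n \<omega>')" by (simp add: alive_until_def)
        from drift[OF this, of "ang n \<omega>'" n] show ?thesis
          using True g by (simp add: L_def lyap_next_def Let_def ennreal_mult')
      qed simp
    qed
    also have "\<dots> = ennreal (1 - g) * (\<integral>\<^sup>+\<omega>'. L n \<omega>' \<partial>M)"
    proof (rule nn_integral_cmult)
      have "L n \<in> borel_measurable (earlier n)"
        unfolding L_def
        using measurable_compose[OF measurable_Pair[OF state_measurable(2)[of n n] state_measurable(3)[of n n]] lyap_measurable[of A d T]]
          alive_until_earlier[of T \<epsilon> n] by simp
      then show "L n \<in> borel_measurable M" by (rule measurable_from_subalg[OF subalgebras(1)])
    qed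
    also have "\<dots> \<le> ennreal (1 - g) * ennreal (A * (1 - g) ^ n)" by (intro mult_left_mono Suc.IH) simp
    also have "\<dots> = ennreal (A * (1 - g) ^ Suc n)"
      using g by (simp add: ennreal_mult'[symmetric] mult.left_commute)
    finally show ?case .
  qed
  moreover have "emeasure M (alive_until T \<epsilon> n) \<le> (\<integral>\<^sup>+\<omega>. L n \<omega> \<partial>M)"
  proof -
    have "emeasure M (alive_until T \<epsilon> n) = (\<integral>\<^sup>+\<omega>. indicator (alive_until T \<epsilon> n) \<omega> \<partial>M)"
      by (simp add: alive_until_events)
    also have "\<dots> \<le> (\<integral>\<^sup>+\<omega>. L n \<omega> \<partial>M)"
    proof (rule nn_integral_mono)
      fix \<omega>
      have "1 \<le> lyap A d T (rad n \<omega>) (tim n \<omega>)" using lyap_bounds(1)[OF d, of A T "rad n \<omega>" "tim n \<omega>"] A by linarith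
      then have "1 \<le> ennreal (lyap A d T (rad n \<omega>) (tim n \<omega>))" by simp
      then show "indicator (alive_until T \<epsilon> n) \<omega> \<le> L n \<omega>" by (auto simp: L_def split: split_indicator)
    qed
    finally show ?thesis .
  qed
  ultimately show ?thesis by (rule order_trans[rotated])
qed

text \<open>The weights satisfy \<open>2 * n + 3 \<le> 3 * (n + 1)\<close>, and the derivative of
  the geometric series sums \<open>(n + 1) * (1 - g) ^ n\<close> to \<open>1 / g^2\<close>.\<close>

lemma nn_integral_num_iterations:
  assumes a: "1 \<le> a" "a \<le> 2" and A: "0 \<le> A" and g: "0 < g" "g \<le> 1"
    and decay: "\<And>n. emeasure M (alive_until T \<epsilon> n) \<le> ennreal (A * (1 - g) ^ n)"
  shows "(\<integral>\<^sup>+\<omega>. enat_powr (num_iterations \<alpha> T \<epsilon> x0 (\<lambda>n t. Z n t \<omega>)) a \<partial>M) \<le> ennreal (1 + 3 * A / g\<^sup>2)"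
proof -
  let ?I = "\<lambda>n \<omega>. indicator (alive_until T \<epsilon> n) \<omega> :: ennreal"
  have "AE \<omega> in M. enat_powr (num_iterations \<alpha> T \<epsilon> x0 (\<lambda>n t. Z n t \<omega>)) a \<le> 1 + (\<Sum>n. ennreal (real (2 * n + 3)) * ?I n \<omega>)"
    using AE_good
  proof (rule AE_mp[OF _ AE_I2], intro impI)
    fix \<omega> assume \<omega>: "\<omega> \<in> space M" and *: "\<forall>n. 0 < rad n \<omega> \<and> chain \<alpha> x0 (\<lambda>k u. W k u \<omega>) n = alg_state \<alpha> x0 (\<lambda>k s. Z k s \<omega>) n"
    have eq: "rad n \<omega> = alg_radius \<alpha> x0 (\<lambda>n t. Z n t \<omega>) n" "tim n \<omega> = alg_time \<alpha> x0 (\<lambda>n t. Z n t \<omega>) n" for n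
      using * by (simp_all add: alg_state_def rad_def tim_def radius_of_def time_of_def)
    show "enat_powr (num_iterations \<alpha> T \<epsilon> x0 (\<lambda>n t. Z n t \<omega>)) a \<le> 1 + (\<Sum>n. ennreal (real (2 * n + 3)) * ?I n \<omega>)"
    proof (rule enat_powr_le_suminf[OF a])
      fix n assume n: "enat (Suc n) < num_iterations \<alpha> T \<epsilon> x0 (\<lambda>n t. Z n t \<omega>)"
      have "alive T \<epsilon> (rad k \<omega>) (tim k \<omega>)" if "k \<le> n" for k
        using alive_before_num_iterations[OF n that] * unfolding eq by simp
      then show "1 \<le> ?I n \<omega>" using \<omega> by (simp add: alive_until_def)
    qed
  qed
  then have "(\<integral>\<^sup>+\<omega>. enat_powr (num_iterations \<alpha> T \<epsilon> x0 (\<lambda>n t. Z n t \<omega>)) a \<partial>M)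
      \<le> (\<integral>\<^sup>+\<omega>. 1 + (\<Sum>n. ennreal (real (2 * n + 3)) * ?I n \<omega>) \<partial>M)"
    by (rule nn_integral_mono_AE)
  also have "\<dots> = 1 + (\<Sum>n. ennreal (real (2 * n + 3)) * emeasure M (alive_until T \<epsilon> n))"
  proof -
    note [measurable] = alive_until_events
    have "(\<integral>\<^sup>+\<omega>. 1 + (\<Sum>n. ennreal (real (2 * n + 3)) * ?I n \<omega>) \<partial>M)
        = (\<integral>\<^sup>+\<omega>. 1 \<partial>M) + (\<integral>\<^sup>+\<omega>. (\<Sum>n. ennreal (real (2 * n + 3)) * ?I n \<omega>) \<partial>M)"
      by (rule nn_integral_add) measurable
    also have "(\<integral>\<^sup>+\<omega>. (\<Sum>n. ennreal (real (2 * n + 3)) * ?I n \<omega>) \<partial>M)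
        = (\<Sum>n. \<integral>\<^sup>+\<omega>. ennreal (real (2 * n + 3)) * ?I n \<omega> \<partial>M)"
      by (rule nn_integral_suminf) measurable
    finally show ?thesis by (simp only: nn_integral_cmult_indicator[OF alive_until_events])
        (simp add: emeasure_space_1)
  qed
  also have "\<dots> \<le> 1 + (\<Sum>n. ennreal (3 * A * (real (Suc n) * (1 - g) ^ n)))"
  proof (intro add_left_mono suminf_le summableI)
    fix n
    have "ennreal (real (2 * n + 3)) * emeasure M (alive_until T \<epsilon> n) \<le> ennreal (real (2 * n + 3)) * ennreal (A * (1 - g) ^ n)"
      by (intro mult_left_mono decay) simp
    also have "\<dots> = ennreal (real (2 * n + 3) * (A * (1 - g) ^ n))" by (rule ennreal_mult'[symmetric]) simp
    also have "\<dots> \<le> ennreal (3 * real (Suc n) * (A * (1 - g) ^ n))"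
      using A g by (intro ennreal_leI mult_right_mono) auto
    also have "3 * real (Suc n) * (A * (1 - g) ^ n) = 3 * A * (real (Suc n) * (1 - g) ^ n)" by (simp only: mult_ac)
    finally show "ennreal (real (2 * n + 3)) * emeasure M (alive_until T \<epsilon> n) \<le> ennreal (3 * A * (real (Suc n) * (1 - g) ^ n))" .
  qed
  also have "(\<Sum>n. ennreal (3 * A * (real (Suc n) * (1 - g) ^ n))) = ennreal (3 * A * (1 / g\<^sup>2))"
  proof (rule suminf_ennreal_eq)
    show "(\<lambda>n. 3 * A * (real (Suc n) * (1 - g) ^ n)) sums (3 * A * (1 / g\<^sup>2))"
      using geometric_deriv_sums[of "1 - g"] g by (intro sums_mult) simp
    show "0 \<le> 3 * A * (real (Suc n) * (1 - g) ^ n)" for n using A g by simp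
  qed
  also have "1 + ennreal (3 * A * (1 / g\<^sup>2)) = ennreal (1 + 3 * A / g\<^sup>2)" using A by simp
  finally show ?thesis .
qed

end

text \<open>The exponents are \<open>d = p - 1\<close> and \<open>q = p / 2\<close>;
  \<open>p < 2\<close> is equivalent to \<open>p - 1 < p / 2\<close> and to
  \<open>p / 2 < 1\<close>. The rate is \<open>g = \<eta> * \<epsilon> powr (d / 2) / A\<close>, so
  \<open>1 / g^2\<close> is of order \<open>\<epsilon> powr (- d)\<close>, and the additive 1 is
  absorbed because \<open>\<epsilon> < 1\<close>.\<close>

lemma iterations_bound:
  assumes p: "1 < p" "p < 2" and h: "0 < h" "h \<le> pi / 2"
  shows "\<exists>C>0. \<forall>\<alpha> T x0 a \<epsilon> (M :: 'a measure) Z. 0 < \<alpha> \<longrightarrow> Theta \<alpha> / 2 = h \<longrightarrow> x0 \<noteq> 0 \<longrightarrow> 1 \<le> a \<longrightarrow> a < p \<longrightarrow>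
    0 < \<epsilon> \<longrightarrow> \<epsilon> < 1 \<longrightarrow> algorithm_run M \<alpha> x0 Z \<longrightarrow>
      (\<integral>\<^sup>+ \<omega>. enat_powr (num_iterations \<alpha> T \<epsilon> x0 (\<lambda>n t. Z n t \<omega>)) a \<partial>M) \<le> ennreal (C / \<epsilon> powr (p - 1))"
proof -
  define d where "d = p - 1"
  have d: "0 < d" "d < p / 2" "p / 2 < 1" using p by (auto simp: d_def)
  obtain \<eta> A where \<eta>: "0 < \<eta>" "\<eta> \<le> 1" and A: "2 \<le> A" and drift:
    "\<And>(M :: 'a measure) W \<theta> r t T \<epsilon>. planar_brownian_motion M W \<Longrightarrow> alive T \<epsilon> r t \<Longrightarrow> 0 < \<epsilon> \<Longrightarrow> \<epsilon> < 1 \<Longrightarrow>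
      (\<integral>\<^sup>+\<omega>. lyap_next h A d T \<epsilon> \<theta> r t (\<lambda>u. W u \<omega>) \<partial>M) \<le> ennreal ((1 - \<eta> * \<epsilon> powr (d / 2) / A) * lyap A d T r t)"
    by (rule wedge_drift[OF d h]) blast
  show ?thesis
  proof (intro exI[of _ "1 + 3 * A ^ 3 / \<eta>\<^sup>2"] conjI allI impI)
    show "0 < 1 + 3 * A ^ 3 / \<eta>\<^sup>2" using A by (intro add_pos_nonneg) auto
    fix \<alpha> T :: real and x0 :: complex and a \<epsilon> :: real and M :: "'a measure" and Z
    assume \<alpha>: "0 < \<alpha>" and th: "Theta \<alpha> / 2 = h" and x0: "x0 \<noteq> 0" and a: "1 \<le> a" "a < p" and \<epsilon>: "0 < \<epsilon>" "\<epsilon> < 1"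
      and run: "algorithm_run M \<alpha> x0 Z"
    interpret run M \<alpha> x0 Z by unfold_locales fact+
    define g where "g = \<eta> * \<epsilon> powr (d / 2) / A"
    have e1: "\<epsilon> powr (d / 2) \<le> 1" using \<epsilon> d by (intro powr_le1) auto
    have "\<eta> * \<epsilon> powr (d / 2) \<le> 1 * 1" using \<eta> e1 by (intro mult_mono) auto
    then have g: "0 < g" "g \<le> 1" using \<eta> \<epsilon> A by (auto simp: g_def)
    have "(\<integral>\<^sup>+ \<omega>. enat_powr (num_iterations \<alpha> T \<epsilon> x0 (\<lambda>n t. Z n t \<omega>)) a \<partial>M) \<le> ennreal (1 + 3 * A / g\<^sup>2)"
    proof (rule nn_integral_num_iterations[OF a(1) _ _ g])
      show "emeasure M (alive_until T \<epsilon> n) \<le> ennreal (A * (1 - g) ^ n)" for n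
        using emeasure_alive_until[OF d(1) A less_imp_le[OF g(1)] g(2), of T \<epsilon> n] drift[OF W _ \<epsilon>]
        unfolding th g_def by blast
    qed (use a p A in auto)
    also have "1 + 3 * A / g\<^sup>2 \<le> (1 + 3 * A ^ 3 / \<eta>\<^sup>2) / \<epsilon> powr (p - 1)"
    proof -
      have "(\<epsilon> powr (d / 2))\<^sup>2 = \<epsilon> powr d" by (simp add: power2_eq_square powr_add[symmetric])
      then have "g\<^sup>2 = \<eta>\<^sup>2 * \<epsilon> powr d / A\<^sup>2" by (simp add: g_def power_divide power_mult_distrib)
      then have "3 * A / g\<^sup>2 = 3 * A ^ 3 / \<eta>\<^sup>2 / \<epsilon> powr d"
        by (simp add: power2_eq_square power3_eq_cube mult_ac)
      moreover have "1 \<le> 1 / \<epsilon> powr d" using \<epsilon> d powr_le1[of d \<epsilon>] by simp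
      ultimately show ?thesis by (simp add: d_def add_divide_distrib)
    qed
    finally show "(\<integral>\<^sup>+ \<omega>. enat_powr (num_iterations \<alpha> T \<epsilon> x0 (\<lambda>n t. Z n t \<omega>)) a \<partial>M)
        \<le> ennreal ((1 + 3 * A ^ 3 / \<eta>\<^sup>2) / \<epsilon> powr (p - 1))" by (simp add: ennreal_leI)
  qed
qed

theorem proposition8:
  "\<exists>C :: real \<Rightarrow> real \<Rightarrow> complex \<Rightarrow> real \<Rightarrow> nat \<Rightarrow> real.
     \<forall>\<alpha> T x0 a p.
       0 < \<alpha> \<and> \<alpha> < 2 * pi \<and> 0 < T \<and> x0 \<in> wedge 0 \<alpha> - {0} \<and> 1 \<le> a \<and> a < p \<and> p < 2 \<longrightarrow>
       0 < C a p x0 T (wedge_order \<alpha>) \<and>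
       (\<exists>\<epsilon>0>0. \<forall>\<epsilon>. 0 < \<epsilon> \<and> \<epsilon> < \<epsilon>0 \<longrightarrow>
          (\<forall>(M :: 'a measure) Z. algorithm_run M \<alpha> x0 Z \<longrightarrow>
             (\<integral>\<^sup>+ \<omega>. enat_powr (num_iterations \<alpha> T \<epsilon> x0 (\<lambda>n t. Z n t \<omega>)) a \<partial>M)
               \<le> ennreal (C a p x0 T (wedge_order \<alpha>) / \<epsilon> powr (p - 1))))"
proof -
  \<comment> \<open>Phrased through \<open>m\<close> and the half-angle \<open>pi / m / 2\<close>,
    since the constant may see \<alpha> only through \<open>wedge_order \<alpha>\<close>.\<close>
  define B where "B = (\<lambda>p m C. 0 < C \<and>
      (\<forall>\<alpha> T x0 a \<epsilon> (M :: 'a measure) Z. 0 < \<alpha> \<longrightarrow> Theta \<alpha> / 2 = pi / real m / 2 \<longrightarrow> x0 \<noteq> 0 \<longrightarrow> 1 \<le> a \<longrightarrow> a < p \<longrightarrow>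
        0 < \<epsilon> \<longrightarrow> \<epsilon> < 1 \<longrightarrow> algorithm_run M \<alpha> x0 Z \<longrightarrow>
        (\<integral>\<^sup>+ \<omega>. enat_powr (num_iterations \<alpha> T \<epsilon> x0 (\<lambda>n t. Z n t \<omega>)) a \<partial>M) \<le> ennreal (C / \<epsilon> powr (p - 1))))"
  \<comment> \<open>The side conditions stand inside the existential, so that one function
    \<open>C\<close> can be chosen for all \<open>p\<close> and \<open>m\<close>.\<close>
  have "\<exists>C. 1 < p \<and> p < 2 \<and> 1 \<le> m \<longrightarrow> B p m C" for p :: real and m :: nat
  proof (cases "1 < p \<and> p < 2 \<and> 1 \<le> m")
    case True
    then have "0 < pi / real m / 2" "pi / real m / 2 \<le> pi / 2" by (auto simp: divide_simps)
    with True iterations_bound[where 'a='a, of p "pi / real m / 2"] show ?thesis unfolding B_def by blast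
  qed blast
  then obtain C where C: "\<And>p m. 1 < p \<and> p < 2 \<and> 1 \<le> m \<Longrightarrow> B p m (C p m)"
    by metis
  show ?thesis
  proof (intro exI[of _ "\<lambda>a p x0 T m. C p m"] allI impI)
    fix \<alpha> T :: real and x0 :: complex and a p :: real
    assume H: "0 < \<alpha> \<and> \<alpha> < 2 * pi \<and> 0 < T \<and> x0 \<in> wedge 0 \<alpha> - {0} \<and> 1 \<le> a \<and> a < p \<and> p < 2"
    obtain k :: nat where k: "Theta \<alpha> = pi / real k" "1 \<le> k" using Theta_is_max(1)[of \<alpha>] H by auto
    have "real (wedge_order \<alpha>) = real k" using wedge_order[of \<alpha>] H k by simp
    then have m: "1 \<le> wedge_order \<alpha>" "Theta \<alpha> / 2 = pi / real (wedge_order \<alpha>) / 2" using k by auto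
    have "1 < p \<and> p < 2 \<and> 1 \<le> wedge_order \<alpha>" using H m by auto
    note * = C[OF this, unfolded B_def]
    show "0 < C p (wedge_order \<alpha>) \<and>
       (\<exists>\<epsilon>0>0. \<forall>\<epsilon>. 0 < \<epsilon> \<and> \<epsilon> < \<epsilon>0 \<longrightarrow>
          (\<forall>(M :: 'a measure) Z. algorithm_run M \<alpha> x0 Z \<longrightarrow>
             (\<integral>\<^sup>+ \<omega>. enat_powr (num_iterations \<alpha> T \<epsilon> x0 (\<lambda>n t. Z n t \<omega>)) a \<partial>M)
               \<le> ennreal (C p (wedge_order \<alpha>) / \<epsilon> powr (p - 1))))"
      using * H m(2) by (intro conjI exI[of _ 1]) auto
  qed
qed

end
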